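(* Let $N>10$ be an integer, and let a tiling of the regular $N$-gon $R_N$ with triangles of angles $\alpha,\beta,\gamma$ be given, where $\alpha,\beta,\gamma$ are rational multiples of $\pi$. If the equation at every vertex $V_j$ ($j=1,\ldots,N$) of $R_N$ is $\alpha+\beta=\delta_N$, then $\alpha=\beta=\delta_N/2$ and $\gamma=2\pi/N$.
   Context: A tiling of a polygon $A$ is a decomposition of $A$ into finitely many nonoverlapping polygons (pairwise disjoint interiors, union $A$); no other condition is imposed, so two pieces may share a boundary point without sharing a common side. Here all tiles are triangles with angles $\alpha,\beta,\gamma$ (hence similar to each other, possibly of different sizes and possibly reflected). In each tile the three angles are labelled $\alpha,\beta,\gamma$. $\delta_N=(N-2)\pi/N$ is the angle of $R_N$, and $V_1,\ldots,V_N$ are its vertices. If the numbers of angles $\alpha,\beta,\gamma$ of the tiles meeting at $V_j$ are $p_j,q_j,r_j$, respectively, then $p_j\alpha+q_j\beta+r_j\gamma=\delta_N$ is called the equation at the vertex $V_j$; thus the equation at $V_j$ is $\alpha+\beta=\delta_N$ means $(p_j,q_j,r_j)=(1,1,0)$. *)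

theory Defs
  imports "HOL-Analysis.Analysis"
begin

text \<open>The plane is \<^typ>\<open>complex\<close>, regarded as a real inner product space. The following is the
  unoriented angle at \<open>b\<close> of the triangle \<open>a b c\<close>, a number in \<open>[0, pi]\<close>; it is only meaningful
  for \<open>a \<noteq> b\<close> and \<open>c \<noteq> b\<close>.\<close>

definition angle :: "complex \<Rightarrow> complex \<Rightarrow> complex \<Rightarrow> real" where
  "angle a b c = arccos (((a - b) \<bullet> (c - b)) / (norm (a - b) * norm (c - b)))"

text \<open>A tile is given by its ordered triple of vertices: the angles at the first, second and third
  vertex are the ones labelled \<open>\<alpha>\<close>, \<open>\<beta>\<close> and \<open>\<gamma>\<close>, respectively. The order matters only when two of the
  three angles are equal. As angles are unoriented, both orientations are allowed.\<close>

type_synonym tile = "complex \<times> complex \<times> complex"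

fun region :: "tile \<Rightarrow> complex set" where
  "region (a, b, c) = convex hull {a, b, c}"

fun is_tile :: "real \<Rightarrow> real \<Rightarrow> real \<Rightarrow> tile \<Rightarrow> bool" where
  "is_tile \<alpha> \<beta> \<gamma> (a, b, c) \<longleftrightarrow>
     \<not> collinear {a, b, c} \<and> angle b a c = \<alpha> \<and> angle a b c = \<beta> \<and> angle a c b = \<gamma>"

text \<open>Two different labellings of the same triangle are distinct tiles with overlapping interiors,
  so a tiling contains each of its triangles with exactly one labelling.\<close>

definition is_tiling :: "real \<Rightarrow> real \<Rightarrow> real \<Rightarrow> complex set \<Rightarrow> tile set \<Rightarrow> bool" where
  "is_tiling \<alpha> \<beta> \<gamma> A T \<longleftrightarrow>
     finite T \<and> (\<forall>t\<in>T. is_tile \<alpha> \<beta> \<gamma> t) \<and>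
     pairwise (\<lambda>s t. interior (region s) \<inter> interior (region t) = {}) T \<and>
     (\<Union>t\<in>T. region t) = A"

text \<open>The regular \<open>N\<close>-gon with centre \<open>z\<close> and first vertex \<open>z + w\<close>. Up to the numbering of the
  vertices, every regular \<open>N\<close>-gon in the plane is of this form with \<open>w \<noteq> 0\<close>.\<close>

definition ngon_vertex :: "nat \<Rightarrow> complex \<Rightarrow> complex \<Rightarrow> nat \<Rightarrow> complex" where
  "ngon_vertex N z w j = z + w * cis (2 * pi * (real j - 1) / real N)"

definition regular_ngon :: "nat \<Rightarrow> complex \<Rightarrow> complex \<Rightarrow> complex set" where
  "regular_ngon N z w = convex hull (ngon_vertex N z w ` {1..N})"

definition ngon_angle :: "nat \<Rightarrow> real" where
  "ngon_angle N = (real N - 2) * pi / real N"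

text \<open>The numbers \<open>(p, q, r)\<close> of angles \<open>\<alpha>\<close>, \<open>\<beta>\<close>, \<open>\<gamma>\<close> of the tiles of \<open>T\<close> meeting at the point \<open>v\<close>.
  At a vertex of the tiled \<open>N\<close>-gon, they are the coefficients of the equation
  \<open>p \<alpha> + q \<beta> + r \<gamma> = ngon_angle N\<close> at that vertex.\<close>

definition angle_numbers :: "tile set \<Rightarrow> complex \<Rightarrow> nat \<times> nat \<times> nat" where
  "angle_numbers T v =
     (card {(a, b, c) \<in> T. a = v}, card {(a, b, c) \<in> T. b = v}, card {(a, b, c) \<in> T. c = v})"

end

theory Submission
  imports Defs "HOL-Number_Theory.Cong"
begin

text \<open>
  Put \<open>\<theta> = 2 * pi / N\<close>. Comparing angles at one vertex of the polygon gives \<open>\<alpha> + \<beta> = pi - \<theta>\<close>, so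
  \<open>\<gamma> = \<theta>\<close>, and the point is to exclude \<open>\<alpha> \<noteq> \<beta>\<close>. This is done with conjugate tilings.

  Choose \<open>M\<close> such that the angles of the tiles, \<open>\<theta> / 2\<close> and \<open>pi / 2\<close> are multiples of \<open>2 * pi / M\<close>,
  let \<open>\<zeta> = cis (2 * pi / M)\<close>, and let \<open>k\<close> be coprime to \<open>M\<close>. There is an additive map \<open>\<Phi>\<close> of the
  plane with \<open>\<Phi> (\<zeta> * x) = \<zeta> ^ k * \<Phi> x\<close> that commutes with complex conjugation and fixes \<open>1\<close>
  (\<open>ex_semilinear_conjugation\<close>). Up to normalisation, it sends the vertices of the regular \<open>N\<close>-gon to
  those of the star polygon with step \<open>k\<close>. The vertices of a tile whose sides have directions \<open>\<zeta> ^ j\<close>,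
  in counterclockwise order, are sent to the vertices of a triangle, possibly reduced to a point, whose
  signed area is a nonnegative multiple of \<open>sin (k * \<alpha>) * sin (k * \<beta>) * sin (k * \<gamma>)\<close>. Tiles with
  sides in other directions can be left out. The signed areas of the image triangles still add up to
  the signed area of the image polygon, which is a positive multiple of \<open>sin (k * \<theta>)\<close>; as
  \<open>\<gamma> = \<theta>\<close>, it follows that \<open>sin (k * \<alpha>) * sin (k * \<beta>) > 0\<close> for every \<open>k\<close> coprime to \<open>M\<close>.

  Additivity of the signed areas holds although \<open>\<Phi>\<close> need not be continuous: a function \<open>F\<close> on
  directed segments that is antisymmetric and additive under subdivision has the same sum over the
  boundary of a polygon as over the boundaries of the pieces of a tiling of it
  (\<open>sum_edges_tiling\<close>), because every segment inside the polygon is traversed equally often in both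
  directions. The equation at a vertex is another instance of this principle.

  Finally, with \<open>\<psi> = 2 * \<alpha> + \<theta>\<close> the sine condition reads \<open>cos (k * \<psi>) < cos (k * \<theta>)\<close>. Writing
  \<open>\<psi> = 2 * pi * l / m\<close> in lowest terms, it says that \<open>k / N\<close> is closer to the nearest integer than
  \<open>k * l / m\<close> is, for all \<open>k\<close> coprime to \<open>M\<close>. For \<open>N > 10\<close> this forces \<open>m = 2\<close>
  (\<open>denominator_eq_2\<close>), hence \<open>\<psi> = pi\<close> and \<open>\<alpha> = \<beta>\<close>.
\<close>

section \<open>Congruences and distances to the nearest integer\<close>

text \<open>A residue class of units modulo \<open>n\<close> contains a number that is also coprime to \<open>m\<close>.\<close>

lemma ex_cong_coprime:
  fixes x n m :: int
  assumes "coprime x n" "m \<noteq> 0"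
  obtains k where "[k = x] (mod n)" "coprime k m"
proof -
  \<comment> \<open>Add the multiple \<open>t * n\<close>, where \<open>t\<close> is the product of the primes of \<open>m\<close> that do not divide \<open>x\<close>.\<close>
  define S where "S = {p \<in> prime_factors m. \<not> p dvd x}"
  define t where "t = \<Prod>S"
  have fS: "finite S" by (auto simp: S_def)
  have "coprime (x + t * n) m"
  proof (rule ccontr)
    assume "\<not> coprime (x + t * n) m"
    then obtain c where c: "c dvd x + t * n" "c dvd m" "\<not> is_unit c"
      by (rule not_coprimeE)
    then have "c \<noteq> 0" using assms(2) by auto
    then obtain p where "prime p" "p dvd c"
      using c(3) by (metis prime_divisor_exists)
    then have p: "prime p" "p dvd x + t * n" "p dvd m"
      using c dvd_trans by blast+
    show False
    proof (cases "p dvd x")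
      case True
      then have "p dvd t * n" using p(2) by (simp add: dvd_add_right_iff)
      moreover have "\<not> p dvd n" using True assms(1) p(1)
        by (meson coprime_def not_prime_unit)
      ultimately have "p dvd t" using p(1) prime_dvd_multD by blast
      then obtain q where q: "q \<in> S" "p dvd q"
        using prime_dvd_prod_iff[OF fS p(1), of "\<lambda>x. x"] unfolding t_def by auto
      then have "prime q" by (auto simp: S_def)
      then have "p = q" using p(1) q(2) primes_dvd_imp_eq by blast
      then show False using True q(1) by (auto simp: S_def)
    next
      case False
      then have "p \<in> S" using p assms(2) by (auto simp: S_def prime_factors_dvd)
      then have "p dvd t" unfolding t_def using dvd_prodI[OF fS, of p "\<lambda>x. x"] by simp
      then show False using p(2) False by (simp add: dvd_add_left_iff)
    qed
  qed
  then show thesis by (intro that[of "x + t * n"]) (auto simp: Cong.cong_def)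
qed

text \<open>The witness \<open>b\<close> is the distance of \<open>k\<close> to the nearest multiple of \<open>m\<close>.\<close>

lemma ex_abs_residue:
  fixes k m :: int
  assumes "m > 0"
  obtains b where "0 \<le> b" "2 * b \<le> m" "[b = k] (mod m) \<or> [b = - k] (mod m)"
proof (cases "2 * (k mod m) \<le> m")
  case True
  then show thesis using assms by (intro that[of "k mod m"]) auto
next
  case False
  have "[m - k mod m = - k] (mod m)"
    by (metis add.commute Cong.cong_def diff_conv_add_uminus mod_add_self1 mod_minus_eq add_uminus_conv_diff)
  then show thesis using assms False pos_mod_bound[of m k] by (intro that[of "m - k mod m"]) (auto intro: less_imp_le)
qed

lemma ex_unit_prescribed:
  fixes n m q c :: int
  assumes "coprime q n" "coprime c q"
  obtains u where "[u = 1] (mod n)" "[u = c] (mod q)" "coprime u n" "coprime u q"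
proof -
  obtain u where u: "[u = 1] (mod n)" "[u = c] (mod q)"
    using binary_chinese_remainder_int[of n q 1 c] assms(1) by (auto simp: coprime_commute)
  have "coprime u n" using u(1) by (metis cong_imp_coprime cong_sym coprime_1_left)
  moreover have "coprime u q" using u(2) assms(2) by (metis cong_imp_coprime cong_sym)
  ultimately show thesis using u that by blast
qed


lemma coprime_bezout:
  fixes x y a b :: int
  assumes "a * x + b * y = 1" shows "coprime x y"
  by (rule coprimeI) (metis assms dvd_add dvd_mult)

lemma dvd_combination:
  fixes a x y z r s :: int
  assumes "a dvd x" "a dvd y" "z = r * x + s * y"
  shows "a dvd z"
  unfolding assms(3) using assms(1,2) by (intro dvd_add dvd_mult)

text \<open>Here \<open>q\<close> is the largest power of \<open>p\<close> dividing \<open>m\<close>. The unit \<open>u\<close> is trivial modulo \<open>N\<close> and the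
  rest of \<open>m\<close>, but not modulo \<open>q\<close>.\<close>

lemma ex_unit_two:
  fixes N m p :: int
  assumes "m > 0" "odd m" "prime p" "p dvd m" "\<not> p dvd N"
  obtains q m' u where "m = q * m'" "q > 1" "m' > 0" "coprime q N"
    "N dvd u - 1" "m' dvd u - 1" "q dvd u - 2" "coprime u N" "coprime u m"
proof -
  have pp: "p > 1" using assms(3) prime_gt_1_int by blast
  obtain m' where m': "m = p ^ multiplicity p m * m'" "\<not> p dvd m'"
    using multiplicity_decompose'[of m p] assms(1) pp
    by (metis abs_of_pos assms(3) less_irrefl not_prime_unit zdvd1_eq)
  define q where "q = p ^ multiplicity p m"
  have mult: "multiplicity p m > 0"
    using assms by (intro prime_multiplicity_gt_zero_iff[THEN iffD2]) auto
  have q1: "q > 1" unfolding q_def using pp mult by simp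
  have m'0: "m' > 0" using m'(1) assms(1) q1 unfolding q_def[symmetric]
    by (simp add: zero_less_mult_iff)
  have cop: "coprime q N" "coprime q m'"
    unfolding q_def using assms(3,5) m'(2) by (simp_all add: prime_imp_coprime)
  have oddq: "odd q" using assms(2) m'(1) unfolding q_def[symmetric] by auto
  obtain u where u: "[u = 1] (mod (N * m'))" "[u = 2] (mod q)" "coprime u (N * m')" "coprime u q"
    using ex_unit_prescribed[of q "N * m'" 2] cop oddq by auto
  have "m = q * m'" using m'(1) by (simp add: q_def)
  moreover have "coprime u m" using u calculation by simp
  moreover have "N dvd u - 1" "m' dvd u - 1" "q dvd u - 2" "coprime u N"
    using u by (auto simp: cong_iff_dvd_diff dest: dvd_mult_left dvd_mult_right)
  ultimately show thesis using that q1 m'0 cop by blast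
qed

lemma odd_coprime_pow2: "odd (x::int) \<Longrightarrow> coprime x (2 ^ n)"
  by (cases "n = 0") (auto simp: coprime_commute)

lemma odd_coprime_four: "odd (x::int) \<Longrightarrow> coprime x 4"
  using odd_coprime_pow2[of x 2] by simp

lemma odd_dvd_four: "odd (m::int) \<Longrightarrow> m > 0 \<Longrightarrow> m dvd 4 \<Longrightarrow> m = 1"
  using odd_coprime_four[of m] by (simp add: coprime_absorb_left)

lemma coprime_double_plus: "coprime x c \<Longrightarrow> coprime x (2 * x + c)" for x c :: int
  by (simp add: coprime_iff_gcd_eq_1 gcd_add_mult)

lemma coprime_Suc_of_primes_dvd:
  fixes N m :: int
  assumes "m \<noteq> 0" and "\<And>p. prime p \<Longrightarrow> p dvd m \<Longrightarrow> p dvd N"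
  shows "coprime (N + 1) m"
proof (rule ccontr)
  assume "\<not> ?thesis"
  then obtain c where c: "c dvd N + 1" "c dvd m" "\<not> is_unit c" by (rule not_coprimeE)
  then have "c \<noteq> 0" using assms(1) by auto
  then obtain p where p: "prime p" "p dvd c" using c(3) by (metis prime_divisor_exists)
  have "p dvd N" using assms(2)[OF p(1) dvd_trans[OF p(2) c(2)]] .
  then have "p dvd 1"
    by (rule dvd_combination[OF dvd_trans[OF p(2) c(1)], of _ _ 1 "-1"]) simp
  then show False using p(1) by (meson not_prime_unit)
qed

lemma odd_prime_dvd_four: "prime (p::int) \<Longrightarrow> p dvd m \<Longrightarrow> odd m \<Longrightarrow> \<not> p dvd 4"
  using odd_dvd_four[of p] prime_gt_1_int[of p] by (auto elim: dvdE)

lemma half_eq_dist: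
  fixes k m b :: int
  assumes "[b = k] (mod m) \<or> [b = - k] (mod m)" "2 * b = m - c"
  shows "m dvd 2 * k - c \<or> m dvd 2 * k + c"
proof -
  from assms(1) consider "m dvd b - k" | "m dvd b + k"
    by (auto simp: cong_iff_dvd_diff)
  then show ?thesis
  proof cases
    case 1
    then have "m dvd 2 * k + c"
      by (rule dvd_combination[of _ _ m _ "-2" 1]) (use assms(2) in auto)
    then show ?thesis ..
  next
    case 2
    then have "m dvd 2 * k - c"
      by (rule dvd_combination[of _ _ m _ 2 "-1"]) (use assms(2) in auto)
    then show ?thesis ..
  qed
qed

lemma dvd_transfer:
  fixes m u x e e' :: int
  assumes "m dvd x - e" "m dvd u * x - e'"
  shows "m dvd u * e - e'"
  using assms(2,1) by (rule dvd_combination[of _ _ _ _ 1 "-u"]) (simp add: algebra_simps)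

text \<open>Write \<open>\<parallel>x\<parallel>\<close> for the distance of \<open>x\<close> to the nearest integer, so that \<open>\<parallel>k / N\<parallel> = a / N\<close> and
  \<open>\<parallel>k * l / m\<parallel> = b / m\<close> in the assumption \<open>H\<close> below. It says \<open>\<parallel>k / N\<parallel> < \<parallel>k * l / m\<parallel>\<close> for all units
  \<open>k\<close> modulo \<open>N * m\<close>, where \<open>l / m\<close> is in lowest terms. The conclusion will be \<open>m = 2\<close>. The bound
  \<open>N > 10\<close> is sharp: \<open>N = 10\<close> and \<open>l / m = 1 / 3\<close> satisfy \<open>H\<close>.

  Two choices of \<open>k\<close> do most of the work. An inverse of \<open>l\<close> modulo \<open>m\<close> yields \<open>m < N\<close>. A unit \<open>x\<close>
  modulo \<open>N\<close> as close as possible to \<open>N / 2\<close>, namely \<open>(N - 1) / 2\<close>, \<open>N / 2 - 1\<close> or \<open>N / 2 - 2\<close>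
  depending on \<open>N\<close> modulo \<open>4\<close>, leaves only the values \<open>m / 2 - i / 2\<close> with \<open>0 \<le> i \<le> 3\<close> for \<open>b\<close>.
  Multiplying such a \<open>k\<close> by a unit \<open>u \<equiv> 1\<close> modulo \<open>N\<close> does not change \<open>k\<close> modulo \<open>N\<close>, so all these \<open>u\<close>
  are restricted to a few residues modulo \<open>m\<close>, which is too few unless \<open>m = 2\<close>.\<close>

context
  fixes N m l :: int
  assumes N: "N > 10" and m0: "m > 0" and l: "coprime l m"
    and H: "\<And>k a b. \<lbrakk>coprime k N; coprime k m; [a = k] (mod N) \<or> [a = - k] (mod N);
        [b = k * l] (mod m) \<or> [b = - (k * l)] (mod m); 0 \<le> a; 2 * a \<le> N; 0 \<le> b; 2 * b \<le> m\<rbrakk>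
        \<Longrightarrow> a * m < b * N"
begin

lemma ex_numerator:
  assumes "coprime k N" "coprime k m" "[a = k] (mod N)" "0 \<le> a" "2 * a \<le> N"
  obtains b where "0 \<le> b" "2 * b \<le> m" "[b = k * l] (mod m) \<or> [b = - (k * l)] (mod m)"
    "a * m < b * N" "coprime b m"
proof -
  obtain b where b: "0 \<le> b" "2 * b \<le> m" "[b = k * l] (mod m) \<or> [b = - (k * l)] (mod m)"
    using ex_abs_residue[OF m0] by blast
  have "coprime (k * l) m" using assms(2) l by simp
  then have "coprime b m" using b(3) by (metis cong_imp_coprime cong_sym coprime_minus_left_iff)
  then show thesis using that b H[of k a b] assms by blast
qed

lemma m_ge_2: "m \<ge> 2"
proof (rule ccontr)
  assume "\<not> ?thesis"
  then have "m = 1" using m0 by simp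
  obtain b where "0 \<le> b" "2 * b \<le> m" "1 * m < b * N"
    by (rule ex_numerator[of 1 1]) (use N in auto)
  moreover from this have "b = 0" using \<open>m = 1\<close> by simp
  ultimately show False using m0 by simp
qed

lemma ex_inverse_l: obtains k where "[k * l = 1] (mod m)" "coprime k m"
proof -
  obtain k where k: "[l * k = 1] (mod m)"
    using cong_solve_coprime_int[OF l] by blast
  then have "coprime k m"
    by (metis cong_imp_coprime cong_sym coprime_1_left coprime_mult_left_iff)
  then show thesis using that k by (simp add: mult.commute)
qed

lemma m_less_N: "m < N"
proof -
  obtain j where j: "[j * l = 1] (mod m)" "coprime j m" by (rule ex_inverse_l)
  obtain k where k: "[k = j] (mod m)" "coprime k N"
    using ex_cong_coprime[OF j(2), of N] N by auto
  have km: "coprime k m" using j k by (metis cong_imp_coprime cong_sym)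
  obtain a where a: "0 \<le> a" "2 * a \<le> N" "[a = k] (mod N) \<or> [a = - k] (mod N)"
    using ex_abs_residue[of N k] N by auto
  have "a \<noteq> 0"
  proof
    assume "a = 0"
    then have "N dvd k" using a(3) by (auto simp: cong_iff_dvd_diff)
    then show False using k(2) N by (simp add: coprime_absorb_right)
  qed
  have "[k * l = 1] (mod m)" using j(1) k(1) cong_scalar_right cong_trans by blast
  then have "[1 = k * l] (mod m)" by (rule cong_sym)
  then have "a * m < 1 * N" using H[of k a 1] k km a m_ge_2 by auto
  moreover have "1 * m \<le> a * m" using a(1) \<open>a \<noteq> 0\<close> m0 by (intro mult_right_mono) auto
  ultimately show ?thesis by simp
qed

lemma two_numerator_neq: "m \<noteq> 2 \<Longrightarrow> coprime b m \<Longrightarrow> 2 * b \<noteq> m"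
proof
  assume "m \<noteq> 2" "coprime b m" "2 * b = m"
  then have "is_unit b" by (metis coprime_absorb_left dvd_triv_right)
  then show False using \<open>m \<noteq> 2\<close> \<open>2 * b = m\<close> m0 by auto
qed

lemma odd_case: assumes "odd N" shows "m = 2"
proof (rule ccontr)
  assume m2: "m \<noteq> 2"
  obtain x where x: "N = 2 * x + 1" using assms by (elim oddE)
  have "coprime x N" by (rule coprime_bezout[of "-2" _ 1]) (simp add: x)
  then obtain k where k: "[k = x] (mod N)" "coprime k m"
    using ex_cong_coprime m0 by (metis less_irrefl)
  have kN: "coprime k N" using k(1) \<open>coprime x N\<close> by (metis cong_imp_coprime cong_sym)
  obtain b where b: "2 * b \<le> m" "x * m < b * N" "coprime b m"
    using ex_numerator[OF kN k(2) cong_sym[OF k(1)]] x N by auto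
  have "2 * b \<le> m - 1" using two_numerator_neq[OF m2 b(3)] b(1) by simp
  then have "2 * b * N \<le> (m - 1) * N" using N by (intro mult_right_mono) auto
  moreover have "2 * (x * m) = (N - 1) * m" by (simp add: x)
  ultimately show False using b(2) m_less_N by (simp add: algebra_simps)
qed

lemma doubly_even_case: assumes "4 dvd N" shows "m = 2"
proof (rule ccontr)
  assume m2: "m \<noteq> 2"
  obtain r where r: "N = 4 * r" using assms by (elim dvdE)
  define x where "x = 2 * r - 1"
  have xN: "coprime x N"
    by (rule coprime_bezout[of "- (2 * r + 1)" _ r]) (simp add: x_def r algebra_simps)
  have main: "odd m \<and> N < 2 * m \<and> (m dvd 2 * (k * l) - 1 \<or> m dvd 2 * (k * l) + 1)"
    if k: "[k = x] (mod N)" "coprime k m" for k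
  proof -
    have kN: "coprime k N" using k(1) xN by (metis cong_imp_coprime cong_sym)
    obtain b where b: "2 * b \<le> m" "[b = k * l] (mod m) \<or> [b = - (k * l)] (mod m)"
        "x * m < b * N" "coprime b m"
      using ex_numerator[OF kN k(2) cong_sym[OF k(1)]] r N by (auto simp: x_def)
    have low: "(2 * r - 1) * m < 2 * b * (2 * r)" using b(3) by (simp add: x_def r algebra_simps)
    have "2 * b \<noteq> m" using two_numerator_neq[OF m2 b(4)] .
    moreover have "\<not> 2 * b \<le> m - 2"
    proof
      assume "2 * b \<le> m - 2"
      then have "2 * b * (2 * r) \<le> (m - 2) * (2 * r)" using N r by (intro mult_right_mono) auto
      then show False using low m_less_N r by (simp add: algebra_simps)
    qed
    ultimately have b2: "2 * b = m - 1" using b(1) by simp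
    then have "m = 2 * b + 1" by simp
    moreover have "N < 2 * m" using low r unfolding b2 by (simp add: algebra_simps)
    ultimately show ?thesis using half_eq_dist[OF b(2) b2] by auto
  qed
  obtain k where k: "[k = x] (mod N)" "coprime k m"
    using ex_cong_coprime[OF xN] m0 by (metis less_irrefl)
  have mm: "odd m" "N < 2 * m" using main[OF k] by auto
  have unit: "m dvd u - 1 \<or> m dvd u + 1" if u: "N dvd u - 1" "coprime u m" for u
  proof -
    have "[u * k = 1 * x] (mod N)"
      using u(1) k(1) by (intro cong_mult) (auto simp: cong_iff_dvd_diff)
    then have "m dvd 2 * (u * k * l) - 1 \<or> m dvd 2 * (u * k * l) + 1"
      using main[of "u * k"] u k by simp
    then have "m dvd u * (2 * (k * l)) - 1 \<or> m dvd u * (2 * (k * l)) - (-1)"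
      by (simp add: mult_ac)
    moreover have "m dvd 2 * (k * l) - 1 \<or> m dvd 2 * (k * l) - (-1)" using main[OF k] by simp
    ultimately consider "m dvd u * 1 - 1" | "m dvd u * 1 - (-1)" | "m dvd u * (-1) - 1" | "m dvd u * (-1) - (-1)"
      using dvd_transfer by blast
    then show ?thesis
    proof cases
      case 3
      have "m dvd u + 1" by (rule dvd_combination[OF 3 3, of _ "-1" 0]) simp
      then show ?thesis ..
    next
      case 4
      have "m dvd u - 1" by (rule dvd_combination[OF 4 4, of _ "-1" 0]) simp
      then show ?thesis ..
    qed auto
  qed
  show False
  proof (cases "\<exists>p. prime p \<and> p dvd m \<and> \<not> p dvd N")
    case True
    then obtain p where p: "prime p" "p dvd m" "\<not> p dvd N" by blast
    obtain q m' u where q: "m = q * m'" "q > 1" "m' > 0" "coprime q N"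
      "N dvd u - 1" "m' dvd u - 1" "q dvd u - 2" "coprime u N" "coprime u m"
      by (rule ex_unit_two[OF m0 mm(1) p])
    have qm: "q dvd m" "m' dvd m" using q(1) by auto
    from unit[OF q(5,9)] show False
    proof
      assume *: "m dvd u - 1"
      have "q dvd 1" by (rule dvd_combination[OF dvd_trans[OF qm(1) *] q(7), of _ 1 "-1"]) simp
      then show False using q(2) by simp
    next
      assume *: "m dvd u + 1"
      have "q dvd 3" by (rule dvd_combination[OF dvd_trans[OF qm(1) *] q(7), of _ 1 "-1"]) simp
      then have "q \<le> 3" by (simp add: zdvd_imp_le)
      moreover have "m' dvd 4"
        by (rule dvd_combination[OF dvd_trans[OF qm(2) *] q(6), of _ 2 "-2"]) simp
      then have "m' = 1" using odd_dvd_four[of m'] q(1,3) mm(1) by auto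
      ultimately show False using q(1) mm(2) N by simp
    qed
  next
    case False
    obtain p where p: "prime p" "p dvd m" using m_ge_2 prime_divisor_exists[of m] by auto
    then have pN: "p dvd N" using False by blast
    \<comment> \<open>Every prime of \<open>m\<close> divides \<open>N\<close>, so that \<open>N + 1\<close> can serve as \<open>u\<close>.\<close>
    have "coprime (N + 1) m" using False m0 by (intro coprime_Suc_of_primes_dvd) auto
    then have "m dvd N \<or> m dvd N + 2" using unit[of "N + 1"] by (simp add: add.assoc)
    then show False
    proof
      assume "m dvd N"
      moreover have "coprime m 4" using mm(1) by (rule odd_coprime_four)
      ultimately have "m dvd r" unfolding r by (simp add: coprime_dvd_mult_right_iff)
      then have "m \<le> r" using N r by (intro zdvd_imp_le) auto
      then show False using mm(2) r m0 by simp
    next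
      assume "m dvd N + 2"
      with p(2) have "p dvd N + 2" by (rule dvd_trans)
      then have "p dvd 4" by (rule dvd_combination[OF _ pN, of _ _ 2 "-2"]) simp
      then show False using odd_prime_dvd_four p mm(1) by blast
    qed
  qed
qed

text \<open>For \<open>N \<equiv> 2\<close> modulo \<open>4\<close> the parities of \<open>m\<close> are treated separately.\<close>

lemma singly_even_even_case:
  assumes N_eq: "N = 4 * h + 2" and "even m" shows "m = 2"
proof (rule ccontr)
  assume m2: "m \<noteq> 2"
  define x where "x = 2 * h - 1"
  have "N = 2 * x + 4" by (simp add: x_def N_eq)
  then have xN: "coprime x N"
    using coprime_double_plus[OF odd_coprime_four[of x]] by (simp add: x_def)
  define b where "b = m div 2 - 1"
  have main: "2 * h + 1 < m \<and> coprime b m \<and> (m dvd k * l - b \<or> m dvd k * l - (- b))"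
    if k: "[k = x] (mod N)" "coprime k m" for k
  proof -
    have kN: "coprime k N" using k(1) xN by (metis cong_imp_coprime cong_sym)
    obtain c where c: "2 * c \<le> m" "[c = k * l] (mod m) \<or> [c = - (k * l)] (mod m)"
        "x * m < c * N" "coprime c m"
      using ex_numerator[OF kN k(2) cong_sym[OF k(1)]] N by (auto simp: x_def N_eq)
    have low: "(2 * h - 1) * m < 2 * c * (2 * h + 1)" using c(3) by (simp add: x_def N_eq algebra_simps)
    have "2 * c \<noteq> m" using two_numerator_neq[OF m2 c(4)] .
    moreover have "\<not> 2 * c \<le> m - 4"
    proof
      assume "2 * c \<le> m - 4"
      then have "2 * c * (2 * h + 1) \<le> (m - 4) * (2 * h + 1)" using N N_eq by (intro mult_right_mono) auto
      then show False using low m_less_N N_eq by (simp add: algebra_simps)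
    qed
    ultimately have c2: "2 * c = m - 2" using c(1) \<open>even m\<close> by presburger
    then have cb: "c = b" by (simp add: b_def)
    have "2 * h + 1 < m" using low unfolding c2 by (simp add: algebra_simps)
    moreover have "m dvd k * l - b \<or> m dvd k * l - (- b)"
      using c(2) by (auto simp: cong_iff_dvd_diff cb dvd_diff_commute add.commute)
    ultimately show ?thesis using c(4) cb by simp
  qed
  obtain k where k: "[k = x] (mod N)" "coprime k m"
    using ex_cong_coprime[OF xN] m0 by (metis less_irrefl)
  have mm: "2 * h + 1 < m" "coprime b m" using main[OF k] by auto
  have unit: "m dvd u - 1 \<or> m dvd u + 1" if u: "N dvd u - 1" "coprime u m" for u
  proof -
    have "[u * k = 1 * x] (mod N)"
      using u(1) k(1) by (intro cong_mult) (auto simp: cong_iff_dvd_diff)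
    then have "m dvd (u * k) * l - b \<or> m dvd (u * k) * l - (- b)"
      using main[of "u * k"] u k by simp
    then have "m dvd u * (k * l) - b \<or> m dvd u * (k * l) - (- b)"
      by (simp add: mult_ac)
    moreover have "m dvd k * l - b \<or> m dvd k * l - (- b)" using main[OF k] by simp
    ultimately consider "m dvd u * b - b" | "m dvd u * b - (- b)" | "m dvd u * (- b) - b" | "m dvd u * (- b) - (- b)"
      using dvd_transfer by blast
    then have "m dvd b * (u - 1) \<or> m dvd b * (u + 1)"
    proof cases
      case 1
      have "m dvd b * (u - 1)" by (rule dvd_combination[OF 1 1, of _ 1 0]) (simp add: algebra_simps)
      then show ?thesis ..
    next
      case 2
      have "m dvd b * (u + 1)" by (rule dvd_combination[OF 2 2, of _ 1 0]) (simp add: algebra_simps)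
      then show ?thesis ..
    next
      case 3
      have "m dvd b * (u + 1)" by (rule dvd_combination[OF 3 3, of _ "-1" 0]) (simp add: algebra_simps)
      then show ?thesis ..
    next
      case 4
      have "m dvd b * (u - 1)" by (rule dvd_combination[OF 4 4, of _ "-1" 0]) (simp add: algebra_simps)
      then show ?thesis ..
    qed
    then show ?thesis using mm(2) by (simp add: coprime_dvd_mult_right_iff coprime_commute)
  qed
  have b2: "m = 2 * b + 2" using \<open>even m\<close> by (auto simp: b_def)
  have "odd b"
  proof
    assume "even b"
    then have "is_unit (2::int)" using mm(2) \<open>even m\<close> by (auto intro: coprime_common_divisor)
    then show False by simp
  qed
  then have m4: "4 dvd m" using b2 by (auto elim!: oddE)
  obtain m' where m': "m = 2 ^ multiplicity 2 m * m'" "odd m'"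
    using multiplicity_decompose'[of m 2] m0 by auto
  define q :: int where "q = 2 ^ multiplicity 2 m"
  have qm1: "m = q * m'" using m'(1) unfolding q_def .
  have qm: "m = q * m'" "q dvd m" "m' dvd m" by (rule qm1, simp_all only: qm1 dvd_triv_left dvd_triv_right)
  have "4 dvd q * m'" using m4 qm(1) by simp
  then have q4: "4 dvd q" using odd_coprime_four[OF m'(2)]
    by (simp add: coprime_dvd_mult_left_iff coprime_commute)
  have "q > 0" by (simp add: q_def)
  then have m'0: "m' > 0" using qm(1) m0 by (simp add: zero_less_mult_iff)
  have "coprime q ((2 * h + 1) * m')"
    unfolding q_def using odd_coprime_pow2[of "(2 * h + 1) * m'"] m'(2) by (simp add: coprime_commute)
  moreover have "coprime (3::int) q" unfolding q_def by (intro odd_coprime_pow2) simp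
  \<comment> \<open>A unit \<open>u\<close> violating \<open>unit\<close> unless \<open>m = 4\<close>.\<close>
  ultimately obtain u where u: "[u = 1] (mod ((2 * h + 1) * m'))" "[u = 3] (mod q)"
      "coprime u ((2 * h + 1) * m')" "coprime u q"
    by (rule ex_unit_prescribed)
  have u1: "(2 * h + 1) * m' dvd u - 1" "q dvd u - 3" using u(1,2) by (auto simp: cong_iff_dvd_diff)
  have u2: "2 * h + 1 dvd u - 1" "m' dvd u - 1" "4 dvd u - 3"
    using u1 q4 dvd_mult_left dvd_mult_right dvd_trans by blast+
  have "coprime u m" using u(3,4) qm(1) by simp
  moreover have "N dvd u - 1"
  proof -
    have "2 dvd u - 1"
      by (rule dvd_combination[OF dvd_trans[of 2 4, OF _ u2(3)] dvd_refl, of _ 1 1]) auto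
    moreover have "coprime 2 (2 * h + 1)" by simp
    ultimately have "2 * (2 * h + 1) dvd u - 1" using u2(1) by (intro divides_mult)
    moreover have "N = 2 * (2 * h + 1)" by (simp add: N_eq)
    ultimately show ?thesis by simp
  qed
  ultimately consider "m dvd u - 1" | "m dvd u + 1" using unit by blast
  then show False
  proof cases
    case 1
    have "(4::int) dvd 2"
      by (rule dvd_combination[OF dvd_trans[OF m4 1] u2(3), of _ 1 "-1"]) simp
    then show False by simp
  next
    case 2
    have q4: "q dvd 4"
      by (rule dvd_combination[OF dvd_trans[OF qm(2) 2] u1(2), of _ 1 "-1"]) simp
    have "m' dvd 4"
      by (rule dvd_combination[OF dvd_trans[OF qm(3) 2] u2(2), of _ 2 "-2"]) simp
    then have "m' = 1" using odd_dvd_four m'(2) m'0 by blast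
    then have "m dvd 4" using q4 qm(1) by simp
    then have "m \<le> 4" by (simp add: zdvd_imp_le)
    then show False using mm(1) N N_eq by simp
  qed
qed

lemma singly_even_odd_case:
  assumes N_eq: "N = 4 * h + 2" and "odd m" shows False
proof -
  have h: "h \<ge> 3" using N N_eq by simp
  define x where "x = 2 * h - 1"
  have "N = 2 * x + 4" by (simp add: x_def N_eq)
  then have xN: "coprime x N"
    using coprime_double_plus[OF odd_coprime_four[of x]] by (simp add: x_def)
  have main: "2 * h + 1 < 2 * m \<and> (\<exists>c\<in>{1,-1,3,-3}. m dvd 2 * (k * l) - c \<and> coprime c m \<and>
      (3 * (2 * h + 1) < 2 * m \<or> c \<in> {1,-1}))"
    if k: "[k = x] (mod N)" "coprime k m" for k
  proof -
    have kN: "coprime k N" using k(1) xN by (metis cong_imp_coprime cong_sym)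
    obtain b where b: "2 * b \<le> m" "[b = k * l] (mod m) \<or> [b = - (k * l)] (mod m)"
        "x * m < b * N" "coprime b m"
      using ex_numerator[OF kN k(2) cong_sym[OF k(1)]] N by (auto simp: x_def N_eq)
    have low: "(2 * h - 1) * m < 2 * b * (2 * h + 1)" using b(3) by (simp add: x_def N_eq algebra_simps)
    have "2 * b \<noteq> m" "2 * b \<noteq> m - 2" using \<open>odd m\<close> by (auto dest: arg_cong[of _ _ even])
    moreover have "\<not> 2 * b \<le> m - 4"
    proof
      assume "2 * b \<le> m - 4"
      then have "2 * b * (2 * h + 1) \<le> (m - 4) * (2 * h + 1)" using N N_eq by (intro mult_right_mono) auto
      then show False using low m_less_N N_eq by (simp add: algebra_simps)
    qed
    ultimately consider "2 * b = m - 1" | "2 * b = m - 3" using b(1) by linarith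
    then show ?thesis
    proof cases
      case 1
      have "2 * h + 1 < 2 * m" using low unfolding 1 by (simp add: algebra_simps)
      then show ?thesis using half_eq_dist[OF b(2) 1] by auto
    next
      case 2
      have *: "3 * (2 * h + 1) < 2 * m" using low unfolding 2 by (simp add: algebra_simps)
      have "coprime 3 m"
      proof (rule ccontr)
        assume "\<not> ?thesis"
        then have "3 dvd m" using prime_imp_coprime[of 3 m] prime_int_numeral_eq[of "Num.Bit1 num.One"] by auto
        then have "3 dvd 2 * b" unfolding 2 by simp
        then have "3 dvd b" by (simp add: prime_dvd_mult_iff)
        then show False using \<open>3 dvd m\<close> b(4) coprime_common_divisor[of b m 3] by simp
      qed
      then show ?thesis using * h half_eq_dist[OF b(2) 2] by auto
    qed
  qed
  obtain k where k: "[k = x] (mod N)" "coprime k m"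
    using ex_cong_coprime[OF xN] m0 by (metis less_irrefl)
  have sm: "2 * h + 1 < 2 * m" using main[OF k] by auto
  have unit: "m dvd u - 1 \<or> m dvd u + 1 \<or> m dvd u - 3 \<or> m dvd u + 3 \<or> m dvd 3 * u - 1 \<or> m dvd 3 * u + 1"
    if u: "N dvd u - 1" "coprime u m" for u
  proof -
    have "[u * k = 1 * x] (mod N)"
      using u(1) k(1) by (intro cong_mult) (auto simp: cong_iff_dvd_diff)
    then obtain c' where c': "c' \<in> {1,-1,3,-3}" "m dvd 2 * (u * k * l) - c'"
      using main[of "u * k"] u k by fastforce
    obtain c where c: "c \<in> {1,-1,3,-3}" "m dvd 2 * (k * l) - c" "coprime c m"
      using main[OF k] by blast
    have "m dvd u * (2 * (k * l)) - c'" using c'(2) by (simp add: mult_ac)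
    with c(2) have d: "m dvd u * c - c'" by (rule dvd_transfer)
    then have d': "m dvd (- 1) * (u * c - c')" by (rule dvd_mult)
    have cancel: "m dvd v" if "m dvd 3 * v" "coprime 3 m" for v
      using that by (simp add: coprime_dvd_mult_right_iff coprime_commute)
    have "c = 1 \<or> c = -1 \<or> c = 3 \<or> c = -3" "c' = 1 \<or> c' = -1 \<or> c' = 3 \<or> c' = -3"
      using c(1) c'(1) by auto
    then show ?thesis
      using d d' c(3) cancel[of "u - 1"] cancel[of "u + 1"] unfolding right_diff_distrib distrib_left
      by (elim disjE; hypsubst; simp add: mult.commute add.commute)
  qed
  obtain p0 where p0: "prime p0" "p0 dvd m" using m_ge_2 prime_divisor_exists[of m] by auto
  show False
  proof (cases "\<exists>p. prime p \<and> p dvd m \<and> \<not> p dvd N")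
    case True
    then obtain p where p: "prime p" "p dvd m" "\<not> p dvd N" by blast
    obtain q m' u where q: "m = q * m'" "q > 1" "m' > 0" "coprime q N"
      "N dvd u - 1" "m' dvd u - 1" "q dvd u - 2" "coprime u N" "coprime u m"
      by (rule ex_unit_two[OF m0 \<open>odd m\<close> p])
    have qm: "q dvd m" "m' dvd m" using q(1) by auto
    have "\<not> q dvd 1" using q(2) by simp
    have "m' dvd 4" using unit[OF q(5,9)]
    proof (elim disjE)
      assume *: "m dvd u - 1"
      have "q dvd 1" by (rule dvd_combination[OF dvd_trans[OF qm(1) *] q(7), of _ 1 "-1"]) simp
      then show ?thesis using \<open>\<not> q dvd 1\<close> by blast
    next
      assume *: "m dvd u - 3"
      have "q dvd 1" by (rule dvd_combination[OF dvd_trans[OF qm(1) *] q(7), of _ "-1" 1]) simp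
      then show ?thesis using \<open>\<not> q dvd 1\<close> by blast
    next
      assume *: "m dvd u + 1"
      show ?thesis by (rule dvd_combination[OF dvd_trans[OF qm(2) *] q(6), of _ 2 "-2"]) simp
    next
      assume *: "m dvd u + 3"
      show ?thesis by (rule dvd_combination[OF dvd_trans[OF qm(2) *] q(6), of _ 1 "-1"]) simp
    next
      assume *: "m dvd 3 * u - 1"
      show ?thesis by (rule dvd_combination[OF dvd_trans[OF qm(2) *] q(6), of _ 2 "-6"]) simp
    next
      assume *: "m dvd 3 * u + 1"
      show ?thesis by (rule dvd_combination[OF dvd_trans[OF qm(2) *] q(6), of _ 1 "-3"]) simp
    qed
    moreover have "odd m'" using \<open>odd m\<close> q(1) by simp
    ultimately have "m' = 1" using odd_dvd_four q(3) by blast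
    then have mN: "coprime m N" using q(1,4) by simp
    obtain j where j: "[j * l = 1] (mod m)" "coprime j m" by (rule ex_inverse_l)
    obtain i where i: "[i = x] (mod N)" "[i = j] (mod m)"
      using binary_chinese_remainder_int[of N m x j] mN by (auto simp: coprime_commute)
    have "coprime i N" "coprime i m"
      using i xN j(2) by (metis cong_imp_coprime cong_sym)+
    moreover have "[i * l = 1] (mod m)" using j(1) i(2) cong_scalar_right cong_trans by blast
    ultimately have "x * m < 1 * N" using H[of i x 1] i h m_ge_2 by (auto simp: x_def N_eq cong_sym)
    moreover have "x * 3 \<le> x * m" using m_ge_2 \<open>odd m\<close> h
      by (intro mult_left_mono) (auto simp: x_def elim!: oddE)
    ultimately show False using h by (simp add: x_def N_eq)
  next
    case False
    then have pN: "p0 dvd N" using p0 by blast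
    have no: False if "m dvd r * N + c" "c dvd 4" for r c
    proof -
      have "p0 dvd c"
        by (rule dvd_combination[OF dvd_trans[OF p0(2) that(1)] pN, of _ 1 "- r"]) simp
      then show False
        using odd_prime_dvd_four[OF p0 \<open>odd m\<close>] dvd_trans that(2) by blast
    qed
    have "coprime (N + 1) m" using False m0 by (intro coprime_Suc_of_primes_dvd) auto
    then have "m dvd (N + 1) - 1 \<or> m dvd (N + 1) + 1 \<or> m dvd (N + 1) - 3 \<or> m dvd (N + 1) + 3 \<or>
        m dvd 3 * (N + 1) - 1 \<or> m dvd 3 * (N + 1) + 1" by (intro unit) auto
    moreover have "(N + 1) - 1 = N" "(N + 1) + 1 = 1 * N + 2" "(N + 1) - 3 = 1 * N + (-2)"
      "(N + 1) + 3 = 1 * N + 4" "3 * (N + 1) - 1 = 3 * N + 2" "3 * (N + 1) + 1 = 3 * N + 4" by simp_all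
    moreover have "(2::int) dvd 4" "(-2::int) dvd 4" "(4::int) dvd 4" by simp_all
    ultimately have "m dvd N" using no by metis
    moreover have "coprime m 2" using \<open>odd m\<close> by simp
    moreover have "N = 2 * (2 * h + 1)" by (simp add: N_eq)
    ultimately have "m dvd 2 * h + 1" by (simp only: coprime_dvd_mult_right_iff)
    then obtain t where t: "2 * h + 1 = m * t" by (elim dvdE)
    have "t > 0" using t h m0 by (smt (verit) zero_less_mult_pos)
    moreover have "\<not> t \<ge> 2"
    proof
      assume "t \<ge> 2"
      then have "m * 2 \<le> m * t" using m0 by (intro mult_left_mono) auto
      then show False using t sm by simp
    qed
    ultimately have ms: "m = 2 * h + 1" using t by auto
    have "\<not> 3 * (2 * h + 1) < 2 * m" using ms h by simp
    then obtain c where c: "c \<in> {1,-1}" "m dvd 2 * (k * l) - c"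
      using main[OF k] by blast
    \<comment> \<open>Now \<open>m = N / 2\<close> and \<open>4 * l \<equiv> 1\<close> or \<open>-1\<close> modulo \<open>m\<close>; the unit \<open>N / 2 - 4\<close> is congruent to \<open>-4\<close>.\<close>
    define j where "j = 2 * h - 3"
    have "N = 2 * j + 2 ^ 3" by (simp add: N_eq j_def)
    then have jN: "coprime j N"
      using coprime_double_plus[OF odd_coprime_pow2[of j 3]] by (simp add: j_def)
    have jm: "coprime j m"
      using jN unfolding \<open>N = 2 * (2 * h + 1)\<close> ms coprime_mult_right_iff by blast
    have kx: "m dvd k - x"
      using k(1) \<open>m dvd N\<close> unfolding cong_iff_dvd_diff by (blast intro: dvd_trans)
    have jk: "m dvd 2 * k - j"
      by (rule dvd_combination[OF kx dvd_refl, of _ 2 1]) (simp add: x_def j_def ms)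
    have "m dvd j * l - c"
      by (rule dvd_combination[OF c(2) jk, of _ 1 "- l"]) (simp add: algebra_simps)
    then have "m dvd c - j * l" by (simp add: dvd_diff_commute)
    then have "[1 = j * l] (mod m) \<or> [1 = - (j * l)] (mod m)"
      using c(1) \<open>m dvd j * l - c\<close> by (auto simp: cong_iff_dvd_diff add.commute)
    then have "j * m < 1 * N" using H[of j j 1] jN jm h by (auto simp: j_def ms N_eq)
    moreover have "3 * m \<le> j * m" using h m0 by (intro mult_right_mono) (auto simp: j_def)
    ultimately show False using h by (simp add: ms N_eq)
  qed
qed

lemma denominator_eq_2: "m = 2"
proof -
  have "odd N \<or> 4 dvd N \<or> (\<exists>h. N = 4 * h + 2)" by presburger
  then show ?thesis
  proof (elim disjE exE)
    fix h assume h: "N = 4 * h + 2"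
    show ?thesis using singly_even_even_case[OF h] singly_even_odd_case[OF h] by blast
  qed (rule odd_case doubly_even_case; assumption)+
qed

end

section \<open>Conjugation of roots of unity\<close>

lemma power_prime_add:
  fixes x y :: "'a::comm_ring_1"
  assumes "prime p"
  shows "(x + y) ^ p = x ^ p + y ^ p +
    of_nat p * (\<Sum>k\<in>{1..<p}. of_nat ((p choose k) div p) * x ^ k * y ^ (p - k))"
proof -
  have "p > 0" using assms prime_gt_0_nat by blast
  then have "{..p} = insert 0 (insert p {1..<p})" by auto
  then have "(x + y) ^ p = x ^ p + y ^ p + (\<Sum>k\<in>{1..<p}. of_nat (p choose k) * x ^ k * y ^ (p - k))"
    using \<open>p > 0\<close> by (simp add: binomial_ring add_ac)
  also have "(\<Sum>k\<in>{1..<p}. of_nat (p choose k) * x ^ k * y ^ (p - k)) =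
      (\<Sum>k\<in>{1..<p}. of_nat p * (of_nat ((p choose k) div p) * x ^ k * y ^ (p - k)))"
  proof (rule sum.cong)
    fix k assume "k \<in> {1..<p}"
    then have "p dvd (p choose k)" using assms by (intro dvd_choose_prime) auto
    then have "p choose k = p * ((p choose k) div p)" by simp
    then have "(of_nat (p choose k) :: 'a) = of_nat p * of_nat ((p choose k) div p)"
      by (metis of_nat_mult)
    then show "of_nat (p choose k) * x ^ k * y ^ (p - k) =
        of_nat p * (of_nat ((p choose k) div p) * x ^ k * y ^ (p - k))" by (simp add: mult_ac)
  qed simp
  finally show ?thesis by (simp add: sum_distrib_left)
qed

lemma fermat_int:
  assumes "prime p"
  shows "int p dvd a ^ p - a"
proof (induction a rule: int_induct[of _ 0])
  case base
  show ?case using assms prime_gt_0_nat by (simp add: zero_power)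
next
  case (step1 i)
  have "(i + 1) ^ p - (i + 1) = (i ^ p - i) +
      int p * (\<Sum>k\<in>{1..<p}. of_nat ((p choose k) div p) * i ^ k * 1 ^ (p - k))"
    using power_prime_add[OF assms, of i 1] by simp
  then show ?case using step1(2) by (simp only: dvd_add dvd_triv_left)
next
  case (step2 i)
  have "(i - 1) ^ p - (i - 1) = (i ^ p - i) -
      int p * (\<Sum>k\<in>{1..<p}. of_nat ((p choose k) div p) * (i - 1) ^ k * 1 ^ (p - k))"
    using power_prime_add[OF assms, of "i - 1" 1] by simp
  then show ?case using step2(2) by (simp only: dvd_diff dvd_triv_left)
qed

text \<open>Complex polynomials with integer coefficients. They are used instead of integer polynomials because
  they can be evaluated at complex numbers without a coercion.\<close>

definition int_coeffs :: "complex poly \<Rightarrow> bool" where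
  "int_coeffs P \<longleftrightarrow> (\<forall>i. coeff P i \<in> \<int>)"

lemma int_coeffs_pCons [simp]: "int_coeffs (pCons a P) \<longleftrightarrow> a \<in> \<int> \<and> int_coeffs P"
  unfolding int_coeffs_def by (auto simp: coeff_pCons split: nat.splits)

lemma int_coeffs_0 [simp]: "int_coeffs 0" by (simp add: int_coeffs_def)
lemma int_coeffs_1 [simp]: "int_coeffs 1" by (simp add: one_pCons)
lemma int_coeffs_add: "int_coeffs P \<Longrightarrow> int_coeffs Q \<Longrightarrow> int_coeffs (P + Q)"
  by (simp add: int_coeffs_def)
lemma int_coeffs_minus: "int_coeffs P \<Longrightarrow> int_coeffs (- P)"
  by (simp add: int_coeffs_def)
lemma int_coeffs_mult: "int_coeffs P \<Longrightarrow> int_coeffs Q \<Longrightarrow> int_coeffs (P * Q)"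
  by (auto simp: int_coeffs_def coeff_mult intro!: Ints_sum Ints_mult)
lemma int_coeffs_power: "int_coeffs P \<Longrightarrow> int_coeffs (P ^ n)"
  by (induction n) (auto intro: int_coeffs_mult)
lemma int_coeffs_of_nat [simp]: "int_coeffs (of_nat n)"
  by (induction n) (auto intro: int_coeffs_add)
lemma int_coeffs_sum: "(\<And>i. i \<in> A \<Longrightarrow> int_coeffs (f i)) \<Longrightarrow> int_coeffs (sum f A)"
  by (induction A rule: infinite_finite_induct) (auto intro: int_coeffs_add)

text \<open>The congruence of \<open>P(x) ^ p\<close> and \<open>P(x ^ p)\<close> modulo a prime \<open>p\<close>.\<close>

lemma poly_power_prime:
  assumes p: "prime p" and "int_coeffs P"
  shows "\<exists>Q. int_coeffs Q \<and> (\<forall>z. poly P z ^ p = poly P (z ^ p) + of_nat p * poly Q z)"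
  using assms(2)
proof (induction P)
  case 0
  then show ?case using p prime_gt_0_nat by (intro exI[of _ 0]) (simp add: zero_power)
next
  case (pCons a P)
  then obtain Q where Q: "int_coeffs Q" "\<And>z. poly P z ^ p = poly P (z ^ p) + of_nat p * poly Q z"
    by auto
  obtain a' where a': "a = of_int a'" using pCons.prems by (auto elim: Ints_cases)
  obtain b where "a' ^ p - a' = int p * b" using fermat_int[OF p, of a'] by (elim dvdE)
  then have "(of_int a' :: complex) ^ p - of_int a' = of_nat p * of_int b"
    by (metis of_int_diff of_int_mult of_int_of_nat_eq of_int_power)
  then have b: "a ^ p = a + of_nat p * of_int b" by (simp add: a' algebra_simps)
  define C where "C = (\<Sum>k\<in>{1..<p}. of_nat ((p choose k) div p) * [:a:] ^ k * ([:0, 1:] * P) ^ (p - k))"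
  have intC: "int_coeffs C" unfolding C_def using pCons.prems
    by (intro int_coeffs_sum int_coeffs_mult int_coeffs_power) auto
  have C: "(a + z * poly P z) ^ p = a ^ p + (z * poly P z) ^ p + of_nat p * poly C z" for z
    unfolding power_prime_add[OF p] C_def by (simp add: poly_sum poly_power)
  show ?case
  proof (intro exI conjI allI)
    show "int_coeffs (C + [:of_int b:] + [:0, 1:] ^ p * Q)"
      using intC Q(1) by (intro int_coeffs_add int_coeffs_mult int_coeffs_power) auto
    show "poly (pCons a P) z ^ p =
        poly (pCons a P) (z ^ p) + of_nat p * poly (C + [:of_int b:] + [:0, 1:] ^ p * Q) z" for z
      by (simp add: C b power_mult_distrib Q(2) poly_power algebra_simps)
  qed
qed

text \<open>The complex numbers as a vector space over the rationals.\<close>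

abbreviation rat_scale :: "rat \<Rightarrow> complex \<Rightarrow> complex" where
  "rat_scale q x \<equiv> of_rat q * x"

interpretation rat_complex: vector_space rat_scale
  by unfold_locales (auto simp: of_rat_add of_rat_mult algebra_simps)

interpretation rat_complex_rat: vector_space_pair rat_scale "(*) :: rat \<Rightarrow> rat \<Rightarrow> rat"
  by unfold_locales (auto simp: algebra_simps)

interpretation rat_complex_pair: vector_space_pair rat_scale rat_scale
  by unfold_locales

lemma rat_common_denominator:
  fixes A :: "rat set"
  assumes "finite A"
  shows "\<exists>D::int. D > 0 \<and> (\<forall>x\<in>A. of_int D * x \<in> \<int>)"
  using assms
proof (induction A)
  case empty
  show ?case by (intro exI[of _ 1]) auto
next
  case (insert x A)
  then obtain D :: int where D: "D > 0" "\<forall>x\<in>A. of_int D * x \<in> \<int>" by auto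
  obtain a b :: int where ab: "b > 0" "x = of_int a / of_int b"
    by (cases x) (auto simp: Fract_of_int_quotient)
  have "of_int (D * b) * y \<in> \<int>" if "y \<in> A" for y
  proof -
    have "of_int (D * b) * y = of_int b * (of_int D * y)" by simp
    also have "\<dots> \<in> \<int>" by (rule Ints_mult[OF Ints_of_int]) (use D(2) that in blast)
    finally show ?thesis .
  qed
  moreover have "of_int (D * b) * x = of_int (D * a)" using ab by simp
  then have "of_int (D * b) * x \<in> \<int>" by (metis Ints_of_int)
  ultimately show ?case using D ab by (intro exI[of _ "D * b"]) auto
qed

lemma power_mod_eq:
  assumes "(\<zeta>::'a::monoid_mult) ^ M = 1" shows "\<zeta> ^ (j mod M) = \<zeta> ^ j"
proof -
  have "\<zeta> ^ j = \<zeta> ^ (M * (j div M) + j mod M)" by simp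
  also have "\<dots> = \<zeta> ^ (j mod M)" unfolding power_add power_mult using assms by simp
  finally show ?thesis by simp
qed

text \<open>A nonzero number is divisible by only finitely many primes in \<open>\<int>[\<zeta>]\<close>: a rational linear
  functional \<open>\<psi>\<close> that is \<open>1\<close> at \<open>y\<close> has values with bounded denominator on this ring.\<close>

lemma not_divisible_large:
  fixes \<zeta> y :: complex
  assumes "\<zeta> ^ M = 1" "M > 0" "y \<noteq> 0"
  shows "\<exists>B. \<forall>p>B. \<forall>r Q. int_coeffs Q \<longrightarrow> y \<noteq> of_nat p * poly Q (\<zeta> ^ r)"
proof -
  have "rat_complex.independent {y}" using assms(3) by simp
  then obtain \<psi> where \<psi>: "Vector_Spaces.linear rat_scale (*) \<psi>" "\<psi> y = 1"
    using rat_complex_rat.linear_independent_extend[of "{y}" "\<lambda>_. 1"] by auto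
  interpret \<psi>: Vector_Spaces.linear rat_scale "(*)" \<psi> by fact
  define A where "A = (\<lambda>j. \<psi> (\<zeta> ^ j)) ` {..<M}"
  have "\<exists>D::int. D > 0 \<and> (\<forall>x\<in>A. of_int D * x \<in> \<int>)"
    by (rule rat_common_denominator) (auto simp: A_def)
  then obtain D :: int where D: "D > 0" "\<And>x. x \<in> A \<Longrightarrow> of_int D * x \<in> \<int>" by blast
  have D\<zeta>: "of_int D * \<psi> (\<zeta> ^ j) \<in> \<int>" for j
  proof -
    have "\<psi> (\<zeta> ^ j) \<in> A" unfolding A_def using assms(2)
      by (intro image_eqI[of _ _ "j mod M"]) (auto simp: power_mod_eq[OF assms(1)])
    then show ?thesis by (rule D(2))
  qed
  show ?thesis
  proof (intro exI[of _ "nat D"] allI impI notI)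
    fix p r Q assume p: "nat D < p" and Q: "int_coeffs Q" and y: "y = of_nat p * poly Q (\<zeta> ^ r)"
    define s where "s = (\<Sum>i\<le>degree Q. of_int D * \<psi> (coeff Q i * (\<zeta> ^ r) ^ i))"
    have "of_int D * \<psi> (coeff Q i * (\<zeta> ^ r) ^ i) \<in> \<int>" for i
    proof -
      obtain c where c: "coeff Q i = of_int c" using Q unfolding int_coeffs_def by (meson Ints_cases)
      have "\<psi> (rat_scale (of_int c) (\<zeta> ^ (r * i))) = of_int c * \<psi> (\<zeta> ^ (r * i))"
        by (rule \<psi>.scale)
      then have "of_int D * \<psi> (coeff Q i * (\<zeta> ^ r) ^ i) = of_int c * (of_int D * \<psi> (\<zeta> ^ (r * i)))"
        by (simp add: c power_mult)
      then show ?thesis using D\<zeta> by (metis Ints_mult Ints_of_int)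
    qed
    then have "s \<in> \<int>" unfolding s_def by (intro Ints_sum)
    then obtain t where t: "s = of_int t" by (elim Ints_cases)
    have "of_int D * \<psi> y = of_nat p * s"
    proof -
      have "\<psi> y = \<psi> (rat_scale (of_nat p) (poly Q (\<zeta> ^ r)))" by (simp add: y)
      also have "\<dots> = of_nat p * \<psi> (poly Q (\<zeta> ^ r))" by (rule \<psi>.scale)
      finally show ?thesis
        by (simp add: s_def poly_altdef \<psi>.sum sum_distrib_left mult_ac)
    qed
    then have "(of_int D :: rat) = of_int (int p * t)" using \<psi>(2) t by simp
    then have "D = int p * t" by (simp only: of_int_eq_iff)
    then have "int p dvd D" by simp
    then have "int p \<le> D" using D(1) zdvd_imp_le by blast
    then show False using p by simp
  qed
qed

text \<open>In effect the irreducibility of the cyclotomic polynomials, by an argument of Landau. If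
  \<open>P(\<zeta> ^ j) = 0\<close>, then \<open>P(\<zeta> ^ (j * p))\<close> is divisible by the prime \<open>p\<close>; as it takes only finitely many
  values, it vanishes if \<open>p\<close> is large. Modulo \<open>M\<close>, the exponent \<open>k\<close> can be replaced by a product of
  large primes.\<close>

lemma int_poly_conjugate_root:
  fixes \<zeta> :: complex
  assumes \<zeta>: "\<zeta> ^ M = 1" and M: "M > 0" and P: "int_coeffs P" and "coprime k M" and P0: "poly P \<zeta> = 0"
  shows "poly P (\<zeta> ^ k) = 0"
proof -
  define Y where "Y = (\<lambda>r. poly P (\<zeta> ^ r)) ` {..<M} - {0}"
  have "finite Y" by (simp add: Y_def)
  have "\<forall>y\<in>Y. \<exists>B. \<forall>p>B. \<forall>r Q. int_coeffs Q \<longrightarrow> y \<noteq> of_nat p * poly Q (\<zeta> ^ r)"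
    using not_divisible_large[OF \<zeta> M] by (auto simp: Y_def)
  then obtain B where B: "\<And>y p r Q. y \<in> Y \<Longrightarrow> p > B y \<Longrightarrow> int_coeffs Q \<Longrightarrow> y \<noteq> of_nat p * poly Q (\<zeta> ^ r)"
    by metis
  define b where "b = Max (insert 0 (B ` Y))"
  have b: "B y \<le> b" if "y \<in> Y" for y unfolding b_def using that \<open>finite Y\<close> by (intro Max_ge) auto
  have step: "poly P (\<zeta> ^ (j * p)) = 0" if p: "prime p" "p > b" "poly P (\<zeta> ^ j) = 0" for j p
  proof (rule ccontr)
    assume nz: "poly P (\<zeta> ^ (j * p)) \<noteq> 0"
    then have Y: "poly P (\<zeta> ^ (j * p)) \<in> Y"
      unfolding Y_def using M
      by (auto simp: power_mod_eq[OF \<zeta>] intro!: image_eqI[of _ _ "(j * p) mod M"])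
    obtain Q where Q: "int_coeffs Q" "\<And>z. poly P z ^ p = poly P (z ^ p) + of_nat p * poly Q z"
      using poly_power_prime[OF p(1) P] by blast
    have "poly P (\<zeta> ^ (j * p)) = of_nat p * poly (- Q) (\<zeta> ^ j)"
      using Q(2)[of "\<zeta> ^ j"] p(1,3) prime_gt_0_nat
      by (simp add: power_mult zero_power eq_neg_iff_add_eq_0)
    moreover have "p > B (poly P (\<zeta> ^ (j * p)))" using b[OF Y] p(2) by simp
    ultimately show False using B[OF Y _ int_coeffs_minus[OF Q(1)]] by blast
  qed
  have steps: "poly P (\<zeta> ^ n) = 0" if "coprime n (fact b)" "n > 0" for n :: nat
    using that
  proof (induction n rule: less_induct)
    case (less n)
    show ?case
    proof (cases "n = 1")
      case False
      then obtain p where p: "prime p" "p dvd n" by (metis prime_factor_nat)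
      then obtain j where j: "n = j * p" by (metis dvd_def mult.commute)
      have "coprime p (fact b)" using less.prems(1) p(2) by (metis coprime_divisors dvd_refl)
      have "p > b"
      proof (rule ccontr)
        assume "\<not> p > b"
        then have "p dvd fact b" using prime_gt_0_nat[OF p(1)] by (simp add: dvd_fact)
        then show False using \<open>coprime p (fact b)\<close> p(1) by (metis coprime_absorb_left not_prime_unit)
      qed
      moreover have "coprime j (fact b)" "j > 0" "j < n"
        using less.prems j p(1) prime_gt_1_nat by auto
      ultimately show ?thesis using step[OF p(1)] less.IH j by blast
    qed (use P0 in simp)
  qed
  have "coprime (int k) (int M)" using assms(4) by simp
  then obtain k' where k': "[k' = int k] (mod int M)" "coprime k' (int (fact b))"
    using ex_cong_coprime[of "int k" "int M" "int (fact b)"] by auto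
  define n where "n = nat (k' mod (int M * int (fact b))) + M * fact b"
  have n: "int n = k' mod (int M * int (fact b)) + int M * int (fact b)"
    unfolding n_def using M by simp
  have "[int n = k'] (mod (int M * int (fact b)))" unfolding n Cong.cong_def by (simp only: mod_add_self2 mod_mod_trivial)
  then have "[int n = k'] (mod int M)" "[int n = k'] (mod int (fact b))"
    using cong_dvd_modulus by (metis dvd_triv_left, metis dvd_triv_right)
  then have "[int n = int k] (mod int M)" "coprime (int n) (int (fact b))"
    using k' by (metis cong_trans, metis cong_imp_coprime cong_sym)
  then have nk: "n mod M = k mod M" and cop: "coprime n (fact b)"
    unfolding cong_int_iff coprime_int_iff by (simp_all add: Cong.cong_def)
  have "n > 0" using M by (simp add: n_def)
  then have "poly P (\<zeta> ^ n) = 0" using steps[OF cop] by blast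
  then show ?thesis using nk power_mod_eq[OF \<zeta>, of n] power_mod_eq[OF \<zeta>, of k] by simp
qed

text \<open>The field automorphism of the cyclotomic field with \<open>\<zeta> \<mapsto> \<zeta> ^ k\<close>, extended to a rational linear
  map of the complex numbers.\<close>

lemma ex_conjugation_on_powers:
  fixes \<zeta> :: complex
  assumes \<zeta>: "\<zeta> ^ M = 1" and M: "M > 0" and k: "coprime k M"
  obtains \<psi> :: "complex \<Rightarrow> complex" where
    "\<And>x y. \<psi> (x + y) = \<psi> x + \<psi> y" "\<And>j. \<psi> (\<zeta> ^ j) = \<zeta> ^ (k * j)"
proof -
  define S where "S = range (\<lambda>j. \<zeta> ^ j)"
  have "S \<subseteq> (\<lambda>j. \<zeta> ^ j) ` {..<M}"
    using M by (auto simp: S_def power_mod_eq[OF \<zeta>] intro!: image_eqI[of _ _ "_ mod M"])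
  then have "finite S" by (rule finite_subset) simp
  obtain B where B: "B \<subseteq> S" "rat_complex.independent B" "S \<subseteq> rat_complex.span B"
    using rat_complex.maximal_independent_subset[of S] by blast
  have "finite B" using B(1) \<open>finite S\<close> finite_subset by blast
  have "\<forall>b\<in>B. \<exists>j. b = \<zeta> ^ j" using B(1) by (auto simp: S_def)
  then obtain e where e: "\<And>b. b \<in> B \<Longrightarrow> b = \<zeta> ^ e b" by metis
  obtain \<psi> where \<psi>: "Vector_Spaces.linear rat_scale rat_scale \<psi>" "\<And>b. b \<in> B \<Longrightarrow> \<psi> b = \<zeta> ^ (k * e b)"
    using rat_complex_pair.linear_independent_extend[OF B(2), of "\<lambda>b. \<zeta> ^ (k * e b)"] by auto
  interpret \<psi>: Vector_Spaces.linear rat_scale rat_scale \<psi> by fact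
  have "\<psi> (\<zeta> ^ j) = \<zeta> ^ (k * j)" for j
  proof -
    have "\<zeta> ^ j \<in> rat_complex.span B" using B(3) by (auto simp: S_def)
    then obtain u where u: "\<zeta> ^ j = (\<Sum>b\<in>B. rat_scale (u b) b)"
      using rat_complex.span_finite[OF \<open>finite B\<close>] by auto
    obtain D :: int where D: "D > 0" "\<And>b. b \<in> B \<Longrightarrow> of_int D * u b \<in> \<int>"
      using rat_common_denominator[of "u ` B"] \<open>finite B\<close> by auto
    then have "\<forall>b\<in>B. \<exists>c. of_int D * u b = of_int c" by (meson Ints_cases)
    then obtain c where c: "\<And>b. b \<in> B \<Longrightarrow> of_int D * u b = of_int (c b)" by metis
    have c': "of_int D * of_rat (u b) = (of_int (c b) :: complex)" if "b \<in> B" for b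
      using c[OF that] by (metis of_rat_mult of_rat_of_int_eq)
    define P :: "complex poly" where "P = (\<Sum>b\<in>B. monom (of_int (c b)) (e b)) - monom (of_int D) j"
    have ev: "poly P z = of_int D * ((\<Sum>b\<in>B. rat_scale (u b) (z ^ e b)) - z ^ j)" for z
      unfolding P_def by (simp add: poly_sum poly_monom c'[symmetric] sum_distrib_left right_diff_distrib mult.assoc)
    have "int_coeffs P" unfolding P_def int_coeffs_def by (auto simp: coeff_sum intro!: Ints_diff Ints_sum)
    moreover have "poly P \<zeta> = 0" unfolding ev using u e by (simp cong: sum.cong)
    ultimately have "poly P (\<zeta> ^ k) = 0" using int_poly_conjugate_root[OF \<zeta> M] k by blast
    then have "(\<zeta> ^ k) ^ j = (\<Sum>b\<in>B. rat_scale (u b) ((\<zeta> ^ k) ^ e b))"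
      unfolding ev using D(1) by simp
    also have "\<dots> = (\<Sum>b\<in>B. rat_scale (u b) (\<psi> b))" using \<psi>(2) by (simp add: power_mult)
    also have "\<dots> = \<psi> (\<zeta> ^ j)" unfolding u \<psi>.sum \<psi>.scale ..
    finally show ?thesis by (simp add: power_mult)
  qed
  then show thesis using that \<psi>.add by blast
qed

text \<open>The map is the projection of \<open>\<psi>\<close> to the maps that are semilinear over the cyclotomic field,
  symmetrised with respect to complex conjugation.\<close>

lemma ex_semilinear_conjugation:
  fixes \<zeta> :: complex
  assumes \<zeta>: "\<zeta> ^ M = 1" and M: "M > 0" and k: "coprime k M"
  obtains \<Phi> :: "complex \<Rightarrow> complex" where
    "\<And>x y. \<Phi> (x + y) = \<Phi> x + \<Phi> y" "\<And>x. \<Phi> (\<zeta> * x) = \<zeta> ^ k * \<Phi> x"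
    "\<And>x. \<Phi> (cnj x) = cnj (\<Phi> x)" "\<Phi> 1 = 1"
proof -
  obtain \<psi> :: "complex \<Rightarrow> complex" where
    \<psi>: "\<And>x y. \<psi> (x + y) = \<psi> x + \<psi> y" "\<And>j. \<psi> (\<zeta> ^ j) = \<zeta> ^ (k * j)"
    using ex_conjugation_on_powers[OF assms] by blast
  have "norm \<zeta> = 1" using \<zeta> M by (metis norm_one norm_power norm_ge_zero power_eq_1_iff less_irrefl)
  then have inv: "cnj \<zeta> * \<zeta> = 1" "\<zeta> * cnj \<zeta> = 1"
    using complex_norm_square[of \<zeta>] by (simp_all add: mult.commute)
  have cM: "cnj \<zeta> ^ M = 1" using \<zeta> by (metis complex_cnj_one complex_cnj_power)
  define h where "h x j = \<zeta> ^ (k * j) * \<psi> (cnj \<zeta> ^ j * x)" for x j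
  define \<Psi> where "\<Psi> x = (\<Sum>j<M. h x j) / of_nat M" for x
  have add: "\<Psi> (x + y) = \<Psi> x + \<Psi> y" for x y
    by (simp add: \<Psi>_def h_def \<psi>(1) distrib_left sum.distrib add_divide_distrib)
  have mult: "\<Psi> (\<zeta> * x) = \<zeta> ^ k * \<Psi> x" for x
  proof -
    have "h (\<zeta> * x) M = h (\<zeta> * x) 0"
      unfolding h_def cM using \<zeta> by (simp add: power_mult mult.commute[of k])
    then have "(\<Sum>j<M. h (\<zeta> * x) j) = (\<Sum>j<M. h (\<zeta> * x) (Suc j))"
      using sum.lessThan_Suc_shift[of "h (\<zeta> * x)" M] by simp
    also have "\<dots> = (\<Sum>j<M. \<zeta> ^ k * h x j)"
    proof (rule sum.cong)
      fix j
      have "cnj \<zeta> ^ Suc j * (\<zeta> * x) = (cnj \<zeta> * \<zeta>) * (cnj \<zeta> ^ j * x)" by (simp only: power_Suc mult_ac)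
      then have "cnj \<zeta> ^ Suc j * (\<zeta> * x) = cnj \<zeta> ^ j * x" using inv by simp
      then show "h (\<zeta> * x) (Suc j) = \<zeta> ^ k * h x j"
        unfolding h_def by (simp only: mult_Suc_right power_add mult.assoc)
    qed simp
    finally show ?thesis by (simp add: \<Psi>_def sum_distrib_left)
  qed
  have one: "\<Psi> 1 = 1"
  proof -
    have "h 1 j = 1" for j
    proof -
      have "\<zeta> ^ (M - 1) = cnj \<zeta>"
      proof -
        have "\<zeta> ^ (M - 1) * \<zeta> = 1" using \<zeta> M by (metis power_minus_mult)
        then show ?thesis using inv by (metis mult.assoc mult.left_neutral mult.right_neutral)
      qed
      then have "cnj \<zeta> ^ j = \<zeta> ^ ((M - 1) * j)" by (simp add: power_mult)
      then have "h 1 j = \<zeta> ^ (k * j + k * ((M - 1) * j))" unfolding h_def by (simp add: \<psi>(2) power_add)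
      also have "k * j + k * ((M - 1) * j) = M * (k * j)" using M by (cases M) (auto simp: algebra_simps)
      finally show ?thesis using \<zeta> by (simp add: power_mult)
    qed
    then show ?thesis using M by (simp add: \<Psi>_def)
  qed
  define \<Phi> where "\<Phi> x = (\<Psi> x + cnj (\<Psi> (cnj x))) / 2" for x
  have mult': "\<Psi> (cnj \<zeta> * x) = cnj \<zeta> ^ k * \<Psi> x" for x
  proof -
    have "\<Psi> x = \<Psi> (\<zeta> * (cnj \<zeta> * x))" using inv by (simp flip: mult.assoc)
    also have "\<dots> = \<zeta> ^ k * \<Psi> (cnj \<zeta> * x)" by (rule mult)
    finally have "cnj \<zeta> ^ k * \<Psi> x = (cnj \<zeta> * \<zeta>) ^ k * \<Psi> (cnj \<zeta> * x)"
      by (simp add: power_mult_distrib mult.assoc)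
    then show ?thesis using inv by simp
  qed
  show thesis
  proof
    show "\<Phi> (x + y) = \<Phi> x + \<Phi> y" for x y by (simp add: \<Phi>_def add add_divide_distrib)
    show "\<Phi> (\<zeta> * x) = \<zeta> ^ k * \<Phi> x" for x by (simp add: \<Phi>_def mult mult' algebra_simps)
    show "\<Phi> (cnj x) = cnj (\<Phi> x)" for x by (simp add: \<Phi>_def add.commute)
    show "\<Phi> 1 = 1" by (simp add: \<Phi>_def one)
  qed
qed

section \<open>Convex polygons and their edges\<close>

text \<open>The determinant of two plane vectors: twice the signed area of the triangle spanned by them.\<close>

definition wedge :: "complex \<Rightarrow> complex \<Rightarrow> real" where
  "wedge u v = Re u * Im v - Im u * Re v"

lemma wedge_add_left: "wedge (u + u') v = wedge u v + wedge u' v"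
  and wedge_add_right: "wedge u (v + v') = wedge u v + wedge u v'"
  and wedge_diff_left: "wedge (u - u') v = wedge u v - wedge u' v"
  and wedge_diff_right: "wedge u (v - v') = wedge u v - wedge u v'"
  and wedge_minus_left: "wedge (- u) v = - wedge u v"
  and wedge_minus_right: "wedge u (- v) = - wedge u v"
  and wedge_scaleR_left: "wedge (r *\<^sub>R u) v = r * wedge u v"
  and wedge_scaleR_right: "wedge u (r *\<^sub>R v) = r * wedge u v"
  by (simp_all add: wedge_def algebra_simps)

lemmas wedge_simps = wedge_add_left wedge_add_right wedge_diff_left wedge_diff_right
  wedge_minus_left wedge_minus_right wedge_scaleR_left wedge_scaleR_right

lemma wedge_self [simp]: "wedge u u = 0" by (simp add: wedge_def)
lemma wedge_zero [simp]: "wedge 0 u = 0" "wedge u 0 = 0" by (simp_all add: wedge_def)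
lemma wedge_commute: "wedge u v = - wedge v u" by (simp add: wedge_def)
lemma wedge_i_pos: "u \<noteq> 0 \<Longrightarrow> wedge u (\<i> * u) > 0"
  by (simp add: wedge_def complex_eq_iff) (metis not_sum_power2_lt_zero power2_eq_square sum_power2_gt_zero_iff)

lemma continuous_wedge [continuous_intros]:
  "continuous_on S f \<Longrightarrow> continuous_on S g \<Longrightarrow> continuous_on S (\<lambda>x. wedge (f x) (g x))"
  unfolding wedge_def by (intro continuous_intros)

lemma wedge_eq_0_imp_parallel:
  assumes "d \<noteq> 0" "wedge d e = 0"
  obtains r where "e = r *\<^sub>R d"
proof -
  have "Im (e / d) = 0" using assms(2) by (simp add: wedge_def Im_divide field_simps)
  then have "e / d = complex_of_real (Re (e / d))" by (simp add: complex_eq_iff)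
  then have "e = Re (e / d) *\<^sub>R d" using assms(1) by (simp add: scaleR_conv_of_real field_simps)
  then show thesis by (rule that)
qed

text \<open>The vectors \<open>d\<close> and \<open>e\<close> are positive multiples of each other.\<close>

definition same_direction :: "complex \<Rightarrow> complex \<Rightarrow> bool" where
  "same_direction d e \<longleftrightarrow> (\<exists>r>0. e = r *\<^sub>R d)"

lemma same_direction_sym: "same_direction d e \<Longrightarrow> same_direction e d"
  unfolding same_direction_def
  by (elim exE conjE) (rule_tac x = "inverse r" in exI, simp)

lemma same_direction_trans: "same_direction d e \<Longrightarrow> same_direction e f \<Longrightarrow> same_direction d f"
  unfolding same_direction_def by (metis mult_pos_pos scaleR_scaleR)

lemma same_direction_wedge: "same_direction d e \<Longrightarrow> wedge e v > 0 \<longleftrightarrow> wedge d v > 0"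
  unfolding same_direction_def by (auto simp: wedge_simps zero_less_mult_iff)

text \<open>Two open half planes through the origin are disjoint only if they are opposite.\<close>

lemma half_planes_meet:
  assumes "d \<noteq> 0" "e \<noteq> 0" "\<not> same_direction (- d) e"
  obtains v where "wedge d v > 0" "wedge e v > 0"
proof (cases "wedge d e = 0")
  case True
  then obtain r where r: "e = r *\<^sub>R d" using wedge_eq_0_imp_parallel assms(1) by blast
  have "r \<noteq> 0" using r assms(2) by auto
  moreover have "\<not> r < 0" using assms(3) r unfolding same_direction_def
    by (metis neg_0_less_iff_less scaleR_minus_left scaleR_minus_right minus_minus)
  ultimately have "r > 0" by simp
  then show thesis using wedge_i_pos[OF assms(1)] r by (intro that[of "\<i> * d"]) (auto simp: wedge_simps)
next
  case False
  define c where "c = wedge d e"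
  have "wedge e d = - c" unfolding c_def by (rule wedge_commute)
  then have "wedge d (c *\<^sub>R (e - d)) = c * c" "wedge e (c *\<^sub>R (e - d)) = c * c"
    by (simp_all add: wedge_simps c_def[symmetric])
  moreover have "c * c > 0" using False c_def by (metis mult_eq_0_iff not_real_square_gt_zero)
  ultimately show thesis using that by metis
qed

text \<open>A convex polygon is given by the set \<open>E\<close> of its edges, directed counterclockwise. Its interior is
  the intersection of the open half planes to the left of the edges.\<close>

definition polygon_interior :: "(complex \<times> complex) set \<Rightarrow> complex set" where
  "polygon_interior E = {z. \<forall>(p, q)\<in>E. 0 < wedge (q - p) (z - p)}"

text \<open>The region \<open>A\<close> is the intersection of the closed half planes to the left of the edges, it has interior
  points, and each edge in \<open>E\<close> is exactly the part of \<open>A\<close> on its line. Thus no edge is missing or subdivided.\<close>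

definition convex_polygon :: "(complex \<times> complex) set \<Rightarrow> complex set \<Rightarrow> bool" where
  "convex_polygon E A \<longleftrightarrow>
     finite E \<and> A = {z. \<forall>(p, q)\<in>E. 0 \<le> wedge (q - p) (z - p)} \<and> polygon_interior E \<noteq> {} \<and>
     (\<forall>(p, q)\<in>E. p \<noteq> q \<and> {z \<in> A. wedge (q - p) (z - p) = 0} = closed_segment p q)"

text \<open>The edge from \<open>p\<close> to \<open>q\<close> has \<open>m\<close> in its relative interior.\<close>

definition edge_at :: "(complex \<times> complex) set \<Rightarrow> complex \<Rightarrow> complex \<Rightarrow> complex \<Rightarrow> bool" where
  "edge_at E m p q \<longleftrightarrow> (p, q) \<in> E \<and> m \<in> open_segment p q"

context
  fixes E A
  assumes P: "convex_polygon E A"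
begin

lemma polygon_finite: "finite E" using P by (simp add: convex_polygon_def)

lemma polygon_memD: "z \<in> A \<Longrightarrow> (p, q) \<in> E \<Longrightarrow> 0 \<le> wedge (q - p) (z - p)"
  using P unfolding convex_polygon_def by blast

lemma polygon_memI: "(\<And>p q. (p, q) \<in> E \<Longrightarrow> 0 \<le> wedge (q - p) (z - p)) \<Longrightarrow> z \<in> A"
  using P unfolding convex_polygon_def by blast

lemma polygon_edge_neq: "(p, q) \<in> E \<Longrightarrow> p \<noteq> q"
  using P unfolding convex_polygon_def by blast

lemma polygon_edge: "(p, q) \<in> E \<Longrightarrow> z \<in> closed_segment p q \<longleftrightarrow> z \<in> A \<and> wedge (q - p) (z - p) = 0"
  using P unfolding convex_polygon_def by blast

lemma polygon_interior_subset: "polygon_interior E \<subseteq> A"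
  unfolding polygon_interior_def using less_imp_le by (auto intro!: polygon_memI)

lemma polygon_closed: "closed A"
proof -
  have "A = (\<Inter>(p, q)\<in>E. {z. 0 \<le> wedge (q - p) (z - p)})"
    using P unfolding convex_polygon_def by auto
  moreover have "closed {z. 0 \<le> wedge (q - p) (z - p)}" for p q
    by (intro closed_Collect_le continuous_intros)
  ultimately show ?thesis by (auto intro!: closed_INT)
qed

lemma polygon_edge_unique:
  assumes e: "(p, q) \<in> E" "m \<in> open_segment p q" and e': "(p', q') \<in> E" and m: "wedge (q' - p') (m - p') = 0"
  shows "p' = p \<and> q' = q"
proof -
  define f where "f z = wedge (q' - p') (z - p')" for z
  obtain t where t: "0 < t" "t < 1" "m = (1 - t) *\<^sub>R p + t *\<^sub>R q"
    using e(2) by (auto simp: in_segment)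
  have pq: "p \<in> A" "q \<in> A" using polygon_edge[OF e(1)] by auto
  have "f m = (1 - t) * f p + t * f q" unfolding f_def t(3) by (simp add: wedge_simps algebra_simps)
  moreover have "f p \<ge> 0" "f q \<ge> 0" using pq polygon_memD e' by (auto simp: f_def)
  moreover have "f m = 0" using m by (simp add: f_def)
  ultimately have f0: "f p = 0" "f q = 0" using t(1,2)
    by (auto simp: add_nonneg_eq_0_iff)
  then have 1: "p \<in> closed_segment p' q'" "q \<in> closed_segment p' q'"
    using polygon_edge[OF e'] pq by (auto simp: f_def)
  have "p' \<noteq> q'" by (rule polygon_edge_neq[OF e'])
  obtain a b where ab: "p - p' = a *\<^sub>R (q' - p')" "q - p' = b *\<^sub>R (q' - p')"
    using f0 wedge_eq_0_imp_parallel[of "q' - p'"] \<open>p' \<noteq> q'\<close> unfolding f_def by (metis right_minus_eq)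
  have "q - p = (q - p') - (p - p')" "p' - p = - (p - p')" "q' - p = (q' - p') - (p - p')" by simp_all
  then have "q - p = (b - a) *\<^sub>R (q' - p')" "p' - p = (- a) *\<^sub>R (q' - p')"
      "q' - p = (1 - a) *\<^sub>R (q' - p')"
    unfolding ab by (simp_all add: scaleR_diff_left)
  then have "wedge (q - p) (p' - p) = 0" "wedge (q - p) (q' - p) = 0"
    by (simp_all only: wedge_scaleR_left wedge_scaleR_right wedge_self mult_zero_right)
  then have 2: "p' \<in> closed_segment p q" "q' \<in> closed_segment p q"
    using polygon_edge[OF e(1)] polygon_edge[OF e'] by auto
  have "closed_segment p q = closed_segment p' q'"
    using 1 2 by (intro subset_antisym closed_segment_subset convex_closed_segment)
  then have "{p, q} = {p', q'}" by (simp add: closed_segment_eq)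
  moreover have "\<not> (p' = q \<and> q' = p)"
  proof
    assume *: "p' = q \<and> q' = p"
    obtain z where z: "z \<in> polygon_interior E" using P by (auto simp: convex_polygon_def)
    have "0 < wedge (q - p) (z - p)" "0 < wedge (p - q) (z - q)"
      using z e(1) e' * unfolding polygon_interior_def by auto
    then show False by (simp add: wedge_simps wedge_commute[of q p])
  qed
  ultimately show ?thesis by (auto simp: doubleton_eq_iff)
qed

lemma edge_at_unique: "edge_at E m p q \<Longrightarrow> edge_at E m p' q' \<Longrightarrow> p' = p \<and> q' = q"
  unfolding edge_at_def
  using polygon_edge_unique polygon_edge segment_open_subset_closed by blast

lemma edge_at_mem: "edge_at E m p q \<Longrightarrow> m \<in> A \<and> wedge (q - p) (m - p) = 0"
  unfolding edge_at_def using polygon_edge segment_open_subset_closed by blast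

text \<open>The shape of a convex polygon near a point that is not a vertex.\<close>

lemma polygon_germ:
  assumes "m \<in> A" "\<And>p q. (p, q) \<in> E \<Longrightarrow> m \<noteq> p \<and> m \<noteq> q"
  shows "m \<in> polygon_interior E \<or> (\<exists>p q. edge_at E m p q)"
proof (cases "m \<in> polygon_interior E")
  case False
  then obtain p q where e: "(p, q) \<in> E" "\<not> 0 < wedge (q - p) (m - p)"
    unfolding polygon_interior_def by auto
  then have "wedge (q - p) (m - p) = 0" using polygon_memD[OF assms(1) e(1)] by simp
  then have "m \<in> closed_segment p q" using polygon_edge[OF e(1)] assms(1) by blast
  then have "m \<in> open_segment p q" using assms(2)[OF e(1)] by (simp add: open_segment_def)
  then show ?thesis using e(1) by (auto simp: edge_at_def)
qed simp

lemma eventually_inside: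
  assumes "\<And>p q. (p, q) \<in> E \<Longrightarrow>
    wedge (q - p) (m - p) > 0 \<or> wedge (q - p) (m - p) = 0 \<and> wedge (q - p) v > 0"
  shows "\<forall>\<^sub>F \<delta> in at_right 0. m + \<delta> *\<^sub>R v \<in> polygon_interior E"
proof -
  have "\<forall>\<^sub>F \<delta> in at_right 0. 0 < wedge (snd e - fst e) (m + \<delta> *\<^sub>R v - fst e)" if e: "e \<in> E" for e
  proof -
    obtain p q where pq: "e = (p, q)" by (cases e)
    have eq: "wedge (q - p) (m + \<delta> *\<^sub>R v - p) = wedge (q - p) (m - p) + \<delta> * wedge (q - p) v" for \<delta>
      by (simp add: wedge_simps)
    consider "wedge (q - p) (m - p) > 0" | "wedge (q - p) (m - p) = 0" "wedge (q - p) v > 0"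
      using assms e pq by blast
    then show ?thesis
    proof cases
      case 1
      have "((\<lambda>\<delta>. wedge (q - p) (m - p) + \<delta> * wedge (q - p) v) \<longlongrightarrow> wedge (q - p) (m - p) + 0 * wedge (q - p) v) (at_right 0)"
        by (intro tendsto_intros)
      from order_tendstoD(1)[OF this] 1 show ?thesis by (simp add: pq eq)
    next
      case 2
      then show ?thesis by (simp add: pq eq eventually_at_right_less eventually_mono[OF eventually_at_right_less])
    qed
  qed
  then have "\<forall>\<^sub>F \<delta> in at_right 0. \<forall>e\<in>E. 0 < wedge (snd e - fst e) (m + \<delta> *\<^sub>R v - fst e)"
    by (intro eventually_ball_finite polygon_finite) blast
  then show ?thesis unfolding polygon_interior_def by eventually_elim auto
qed

lemma eventually_inside_interior:
  "m \<in> polygon_interior E \<Longrightarrow> \<forall>\<^sub>F \<delta> in at_right 0. m + \<delta> *\<^sub>R v \<in> polygon_interior E"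
  by (rule eventually_inside) (auto simp: polygon_interior_def)

lemma eventually_inside_edge:
  assumes "edge_at E m p q" "wedge (q - p) v > 0"
  shows "\<forall>\<^sub>F \<delta> in at_right 0. m + \<delta> *\<^sub>R v \<in> polygon_interior E"
proof (rule eventually_inside)
  fix p' q' assume e': "(p', q') \<in> E"
  have e: "(p, q) \<in> E" "m \<in> open_segment p q" using assms(1) by (auto simp: edge_at_def)
  have "wedge (q' - p') (m - p') \<ge> 0" using edge_at_mem[OF assms(1)] polygon_memD[OF _ e'] by blast
  then show "wedge (q' - p') (m - p') > 0 \<or> wedge (q' - p') (m - p') = 0 \<and> wedge (q' - p') v > 0"
    using polygon_edge_unique[OF e e'] assms(2) by (auto simp: less_le)
qed

lemma outside_edge:
  assumes "edge_at E m p q" "wedge (q - p) v < 0" "\<delta> > 0"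
  shows "m + \<delta> *\<^sub>R v \<notin> A"
proof
  assume "m + \<delta> *\<^sub>R v \<in> A"
  then have "0 \<le> wedge (q - p) (m + \<delta> *\<^sub>R v - p)" using assms(1) polygon_memD by (simp add: edge_at_def)
  also have "\<dots> = wedge (q - p) (m - p) + \<delta> * wedge (q - p) v" by (simp add: wedge_simps)
  also have "\<dots> < 0" using edge_at_mem[OF assms(1)] assms(2,3) by (simp add: mult_pos_neg)
  finally show False by simp
qed

end

text \<open>The directed segment \<open>f\<close> is a part of the directed segment \<open>e\<close>, with the same direction.\<close>

definition covers :: "complex \<times> complex \<Rightarrow> complex \<times> complex \<Rightarrow> bool" where
  "covers e f \<longleftrightarrow> (\<exists>s t. 0 \<le> s \<and> s < t \<and> t \<le> 1 \<and>
     fst f = fst e + s *\<^sub>R (snd e - fst e) \<and> snd f = fst e + t *\<^sub>R (snd e - fst e))"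

text \<open>The directed segments between points of \<open>V\<close> that contain no further point of \<open>V\<close>.\<close>

definition elementary :: "complex set \<Rightarrow> (complex \<times> complex) set" where
  "elementary V = {(x, y). x \<in> V \<and> y \<in> V \<and> x \<noteq> y \<and> open_segment x y \<inter> V = {}}"

lemma finite_elementary: "finite V \<Longrightarrow> finite (elementary V)"
  by (rule finite_subset[of _ "V \<times> V"]) (auto simp: elementary_def)

lemma open_segment_param:
  "v \<in> open_segment p q \<longleftrightarrow> p \<noteq> q \<and> (\<exists>r. 0 < r \<and> r < 1 \<and> v = p + r *\<^sub>R (q - p))"
  for p q :: "'a::real_vector"
proof -
  have "p + r *\<^sub>R (q - p) = (1 - r) *\<^sub>R p + r *\<^sub>R q" for r by (simp add: algebra_simps)
  then show ?thesis by (simp add: in_segment)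
qed

lemma param_inject: "p \<noteq> q \<Longrightarrow> p + s *\<^sub>R (q - p) = p + t *\<^sub>R (q - p) \<longleftrightarrow> s = t"
  for p q :: "'a::real_vector"
  by simp

lemma covers_elementary_iff:
  assumes "(p, q) \<in> elementary V" "(x, y) \<in> elementary V"
  shows "covers (p, q) (x, y) \<longleftrightarrow> x = p \<and> y = q"
proof
  assume "covers (p, q) (x, y)"
  then obtain s t where st: "0 \<le> s" "s < t" "t \<le> 1" "x = p + s *\<^sub>R (q - p)" "y = p + t *\<^sub>R (q - p)"
    by (auto simp: covers_def)
  have "p \<noteq> q" using assms(1) by (auto simp: elementary_def)
  then have "r \<le> 0 \<or> r \<ge> 1" if "p + r *\<^sub>R (q - p) \<in> V" for r
    using assms(1) that open_segment_param[of "p + r *\<^sub>R (q - p)" p q]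
    unfolding elementary_def by force
  moreover have "x \<in> V" "y \<in> V" using assms(2) by (auto simp: elementary_def)
  ultimately have "s = 0" "t = 1" using st by force+
  then show "x = p \<and> y = q" using st by simp
next
  assume "x = p \<and> y = q"
  then show "covers (p, q) (x, y)" unfolding covers_def
    by (intro exI[of _ 0] exI[of _ 1]) simp
qed

lemma covers_split:
  assumes v: "v \<in> V" "v \<in> open_segment p q" and f: "f \<in> elementary V"
  shows "of_bool (covers (p, q) f) = (of_bool (covers (p, v) f) + of_bool (covers (v, q) f) :: real)"
proof -
  obtain x y where xy: "f = (x, y)" by (cases f)
  obtain r where r: "0 < r" "r < 1" "v = p + r *\<^sub>R (q - p)" and pq: "p \<noteq> q"
    using v(2) by (auto simp: open_segment_param)
  have 1: "covers (p, v) f \<longleftrightarrow> (\<exists>s t. 0 \<le> s \<and> s < t \<and> t \<le> r \<and> x = p + s *\<^sub>R (q - p) \<and> y = p + t *\<^sub>R (q - p))"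
  proof
    assume "covers (p, v) f"
    then obtain s t where "0 \<le> s" "s < t" "t \<le> 1" "x = p + s *\<^sub>R (v - p)" "y = p + t *\<^sub>R (v - p)"
      by (auto simp: covers_def xy)
    then show "\<exists>s t. 0 \<le> s \<and> s < t \<and> t \<le> r \<and> x = p + s *\<^sub>R (q - p) \<and> y = p + t *\<^sub>R (q - p)"
      using r by (intro exI[of _ "s * r"] exI[of _ "t * r"]) (auto simp: mult_left_le_one_le)
  next
    assume "\<exists>s t. 0 \<le> s \<and> s < t \<and> t \<le> r \<and> x = p + s *\<^sub>R (q - p) \<and> y = p + t *\<^sub>R (q - p)"
    then obtain s t where "0 \<le> s" "s < t" "t \<le> r" "x = p + s *\<^sub>R (q - p)" "y = p + t *\<^sub>R (q - p)" by blast
    then show "covers (p, v) f" unfolding covers_def xy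
      using r by (intro exI[of _ "s / r"] exI[of _ "t / r"]) (auto simp: divide_strict_right_mono)
  qed
  have 2: "covers (v, q) f \<longleftrightarrow> (\<exists>s t. r \<le> s \<and> s < t \<and> t \<le> 1 \<and> x = p + s *\<^sub>R (q - p) \<and> y = p + t *\<^sub>R (q - p))"
  proof -
    have vq: "v + s *\<^sub>R (q - v) = p + (r + s * (1 - r)) *\<^sub>R (q - p)" for s
      unfolding r(3) by (simp add: algebra_simps)
    show ?thesis
    proof
      assume "covers (v, q) f"
      then obtain s t where st: "0 \<le> s" "s < t" "t \<le> 1" "x = v + s *\<^sub>R (q - v)" "y = v + t *\<^sub>R (q - v)"
        by (auto simp: covers_def xy)
      have "t * (1 - r) \<le> 1 * (1 - r)" using st r by (intro mult_right_mono) auto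
      moreover have "s * (1 - r) < t * (1 - r)" using st r by (intro mult_strict_right_mono) auto
      moreover have "0 \<le> s * (1 - r)" using st r by simp
      ultimately show "\<exists>s t. r \<le> s \<and> s < t \<and> t \<le> 1 \<and> x = p + s *\<^sub>R (q - p) \<and> y = p + t *\<^sub>R (q - p)"
        using st(4,5) unfolding vq by (intro exI[of _ "r + s * (1 - r)"] exI[of _ "r + t * (1 - r)"]) auto
    next
      assume "\<exists>s t. r \<le> s \<and> s < t \<and> t \<le> 1 \<and> x = p + s *\<^sub>R (q - p) \<and> y = p + t *\<^sub>R (q - p)"
      then obtain s t where st: "r \<le> s" "s < t" "t \<le> 1" "x = p + s *\<^sub>R (q - p)" "y = p + t *\<^sub>R (q - p)" by blast
      have *: "p + u *\<^sub>R (q - p) = v + ((u - r) / (1 - r)) *\<^sub>R (q - v)" for u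
        unfolding vq using r by simp
      show "covers (v, q) f" unfolding covers_def xy
        using r st(1-3) by (intro exI[of _ "(s - r) / (1 - r)"] exI[of _ "(t - r) / (1 - r)"])
          (auto simp: divide_strict_right_mono * st(4,5))
    qed
  qed
  have 3: "t \<le> r \<or> r \<le> s" if "s < t" "x = p + s *\<^sub>R (q - p)" "y = p + t *\<^sub>R (q - p)" for s t
  proof (rule ccontr)
    assume *: "\<not> ?thesis"
    have "v = x + ((r - s) / (t - s)) *\<^sub>R (y - x)"
    proof -
      have "y - x = (t - s) *\<^sub>R (q - p)" by (simp add: that algebra_simps)
      then have "((r - s) / (t - s)) *\<^sub>R (y - x) = (r - s) *\<^sub>R (q - p)" using that(1) by simp
      then show ?thesis unfolding that(2) r(3) by (simp add: algebra_simps)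
    qed
    moreover have "x \<noteq> y" using f xy by (auto simp: elementary_def)
    ultimately have "v \<in> open_segment x y"
      unfolding open_segment_param using * that(1) by (auto intro!: exI[of _ "(r - s) / (t - s)"])
    then show False using f v(1) by (auto simp: elementary_def xy)
  qed
  have 4: "\<not> (covers (p, v) f \<and> covers (v, q) f)"
  proof
    assume "covers (p, v) f \<and> covers (v, q) f"
    then obtain s t s' t' where "s < t" "t \<le> r" "x = p + s *\<^sub>R (q - p)" "r \<le> s'" "x = p + s' *\<^sub>R (q - p)"
      unfolding 1 2 by blast
    then show False using param_inject[OF pq, of s s'] by simp
  qed
  have 5: "covers (p, q) f \<longleftrightarrow> covers (p, v) f \<or> covers (v, q) f"
  proof
    assume "covers (p, q) f"
    then obtain s t where st: "0 \<le> s" "s < t" "t \<le> 1" "x = p + s *\<^sub>R (q - p)" "y = p + t *\<^sub>R (q - p)"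
      by (auto simp: covers_def xy)
    from 3[OF st(2,4,5)] show "covers (p, v) f \<or> covers (v, q) f" unfolding 1 2 using st by blast
  next
    assume "covers (p, v) f \<or> covers (v, q) f"
    then show "covers (p, q) f"
    proof
      assume "covers (p, v) f"
      then obtain s t where "0 \<le> s" "s < t" "t \<le> r" "x = p + s *\<^sub>R (q - p)" "y = p + t *\<^sub>R (q - p)"
        unfolding 1 by blast
      then show ?thesis unfolding covers_def xy using r by (intro exI[of _ s] exI[of _ t]) auto
    next
      assume "covers (v, q) f"
      then obtain s t where "r \<le> s" "s < t" "t \<le> 1" "x = p + s *\<^sub>R (q - p)" "y = p + t *\<^sub>R (q - p)"
        unfolding 2 by blast
      then show ?thesis unfolding covers_def xy using r by (intro exI[of _ s] exI[of _ t]) auto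
    qed
  qed
  show ?thesis using 4 5 by auto
qed

text \<open>By additivity, the value on a segment is the sum over the elementary segments that it consists of.\<close>

lemma edge_functional_elementary:
  fixes F :: "complex \<Rightarrow> complex \<Rightarrow> real"
  assumes V: "finite V" and add: "\<And>p q r. q \<in> open_segment p r \<Longrightarrow> F p r = F p q + F q r"
    and "p \<in> V" "q \<in> V" "p \<noteq> q"
  shows "F p q = (\<Sum>f\<in>elementary V. of_bool (covers (p, q) f) * F (fst f) (snd f))"
  using assms(3-5)
proof (induction "card (open_segment p q \<inter> V)" arbitrary: p q rule: less_induct)
  case less
  show ?case
  proof (cases "open_segment p q \<inter> V = {}")
    case True
    then have e: "(p, q) \<in> elementary V" using less.prems by (auto simp: elementary_def)
    have "(\<Sum>f\<in>elementary V. of_bool (covers (p, q) f) * F (fst f) (snd f)) =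
        (\<Sum>f\<in>elementary V. if f = (p, q) then F p q else 0)"
      using covers_elementary_iff[OF e] by (intro sum.cong) (auto split: prod.splits)
    then show ?thesis using e finite_elementary[OF V] by simp
  next
    case False
    then obtain v where v: "v \<in> V" "v \<in> open_segment p q" by blast
    have "open_segment p v \<inter> V \<subset> open_segment p q \<inter> V" "open_segment v q \<inter> V \<subset> open_segment p q \<inter> V"
      using v subset_open_segment[of p v p q] subset_open_segment[of v q p q]
      by (auto simp: open_segment_def)
    then have less': "card (open_segment p v \<inter> V) < card (open_segment p q \<inter> V)"
        "card (open_segment v q \<inter> V) < card (open_segment p q \<inter> V)"
      using V by (auto intro!: psubset_card_mono)
    have neq: "p \<noteq> v" "v \<noteq> q" using v(2) by (auto simp: open_segment_def)
    have "F p q = F p v + F v q" using add[OF v(2)] .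
    also have "\<dots> = (\<Sum>f\<in>elementary V. (of_bool (covers (p, v) f) + of_bool (covers (v, q) f)) * F (fst f) (snd f))"
      using less.hyps[OF less'(1)] less.hyps[OF less'(2)] less.prems v(1) neq
      by (simp add: distrib_right sum.distrib)
    also have "\<dots> = (\<Sum>f\<in>elementary V. of_bool (covers (p, q) f) * F (fst f) (snd f))"
      using covers_split[OF v] by (intro sum.cong) simp_all
    finally show ?thesis .
  qed
qed

lemma covers_iff_edge_at:
  assumes "(p, q) \<in> E" "p \<in> V" "q \<in> V" "p \<noteq> q" and f: "(x, y) \<in> elementary V"
  shows "covers (p, q) (x, y) \<longleftrightarrow> edge_at E (midpoint x y) p q \<and> same_direction (y - x) (q - p)"
proof
  assume "covers (p, q) (x, y)"
  then obtain s t where st: "0 \<le> s" "s < t" "t \<le> 1" "x = p + s *\<^sub>R (q - p)" "y = p + t *\<^sub>R (q - p)"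
    by (auto simp: covers_def)
  have "midpoint x y = p + ((s + t) / 2) *\<^sub>R (q - p)"
    unfolding st(4,5) by (simp add: midpoint_def scaleR_conv_of_real field_simps)
  moreover have "y - x = (t - s) *\<^sub>R (q - p)" unfolding st(4,5) by (simp add: algebra_simps)
  then have "same_direction (q - p) (y - x)"
    unfolding same_direction_def using st(2) by (intro exI[of _ "t - s"]) simp
  moreover have "0 < (s + t) / 2 \<and> (s + t) / 2 < 1" using st(1-3) by simp
  ultimately show "edge_at E (midpoint x y) p q \<and> same_direction (y - x) (q - p)"
    unfolding edge_at_def open_segment_param using assms(1,4) same_direction_sym by blast
next
  assume a: "edge_at E (midpoint x y) p q \<and> same_direction (y - x) (q - p)"
  then obtain r where r: "0 < r" "r < 1" "midpoint x y = p + r *\<^sub>R (q - p)"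
    by (auto simp: edge_at_def open_segment_param)
  obtain c where c: "c > 0" "y - x = c *\<^sub>R (q - p)"
    using a same_direction_sym by (auto simp: same_direction_def)
  have "x = midpoint x y - (1/2) *\<^sub>R (y - x)" "y = midpoint x y + (1/2) *\<^sub>R (y - x)"
    by (simp_all add: midpoint_def scaleR_conv_of_real field_simps)
  then have xy: "x = p + (r - c / 2) *\<^sub>R (q - p)" "y = p + (r + c / 2) *\<^sub>R (q - p)"
    unfolding r(3) c(2) by (simp_all add: algebra_simps)
  have disj: "x \<noteq> y" "p \<notin> open_segment x y" "q \<notin> open_segment x y"
    using f assms(2,3) by (auto simp: elementary_def)
  have at: "x + u *\<^sub>R (y - x) = p + (r - c / 2 + u * c) *\<^sub>R (q - p)" for u
    unfolding c(2) unfolding xy(1) by (simp add: algebra_simps)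
  have "0 \<le> r - c / 2"
  proof (rule ccontr)
    assume *: "\<not> ?thesis"
    have "p = x + ((c / 2 - r) / c) *\<^sub>R (y - x)" unfolding at using c(1) by simp
    then have "p \<in> open_segment x y" unfolding open_segment_param
      using * c(1) disj(1) r(1) by (auto intro!: exI[of _ "(c / 2 - r) / c"] simp: field_simps)
    then show False using disj by blast
  qed
  moreover have "r + c / 2 \<le> 1"
  proof (rule ccontr)
    assume *: "\<not> ?thesis"
    have "q = x + ((1 - r + c / 2) / c) *\<^sub>R (y - x)" unfolding at using c(1) by simp
    then have "q \<in> open_segment x y" unfolding open_segment_param
      using * c(1) disj(1) r(2) by (auto intro!: exI[of _ "(1 - r + c / 2) / c"] simp: field_simps)
    then show False using disj by blast
  qed
  ultimately show "covers (p, q) (x, y)" unfolding covers_def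
    using c(1) by (intro exI[of _ "r - c / 2"] exI[of _ "r + c / 2"]) (simp flip: xy)
qed

text \<open>Some edge passes through \<open>m\<close> in the direction \<open>d\<close>, so that near \<open>m\<close> the polygon is the half disc
  to the left of \<open>d\<close>.\<close>

definition edge_along :: "(complex \<times> complex) set \<Rightarrow> complex \<Rightarrow> complex \<Rightarrow> bool" where
  "edge_along E m d \<longleftrightarrow> (\<exists>p q. edge_at E m p q \<and> same_direction d (q - p))"

text \<open>In the following, the polygons \<open>(E t, R t)\<close> for \<open>t \<in> T\<close> tile the polygon \<open>(E0, A)\<close>. First the
  tiling is examined near a point \<open>m\<close> that is a vertex of none of them: if a tile has an edge through
  \<open>m\<close> in direction \<open>d\<close>, then either there is exactly one further tile at \<open>m\<close>, on the other side of the
  edge, or the polygon itself has an edge through \<open>m\<close> in direction \<open>d\<close>.\<close>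

lemma eventually_at_right_0_False: "\<not> (\<forall>\<^sub>F (\<delta>::real) in at_right 0. False)"
  by simp

context
  fixes T :: "'i set" and E :: "'i \<Rightarrow> (complex \<times> complex) set" and R :: "'i \<Rightarrow> complex set"
    and E0 :: "(complex \<times> complex) set" and A :: "complex set"
  assumes T: "finite T"
    and poly: "\<And>t. t \<in> T \<Longrightarrow> convex_polygon (E t) (R t)"
    and outer: "convex_polygon E0 A"
    and union: "(\<Union>t\<in>T. R t) = A"
    and disjoint: "\<And>s t. s \<in> T \<Longrightarrow> t \<in> T \<Longrightarrow> s \<noteq> t \<Longrightarrow>
        polygon_interior (E s) \<inter> polygon_interior (E t) = {}"
begin

lemma no_overlap:
  assumes "s \<in> T" "t \<in> T"
    and "\<forall>\<^sub>F \<delta> in at_right (0::real). m + \<delta> *\<^sub>R v \<in> polygon_interior (E s)"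
    and "\<forall>\<^sub>F \<delta> in at_right 0. m + \<delta> *\<^sub>R v \<in> polygon_interior (E t)"
  shows "s = t"
proof (rule ccontr)
  assume "s \<noteq> t"
  have "\<forall>\<^sub>F \<delta> in at_right (0::real). False"
    using assms(3,4) by eventually_elim (use disjoint[OF assms(1,2) \<open>s \<noteq> t\<close>] in blast)
  then show False using eventually_at_right_0_False by blast
qed

context
  fixes m d :: complex
  assumes d: "d \<noteq> 0"
    and not_vertex: "\<And>t p q. t \<in> T \<Longrightarrow> (p, q) \<in> E t \<Longrightarrow> m \<noteq> p \<and> m \<noteq> q"
    and not_outer_vertex: "\<And>p q. (p, q) \<in> E0 \<Longrightarrow> m \<noteq> p \<and> m \<noteq> q"
begin

lemma edge_along_unique:
  assumes "t \<in> T" "edge_along (E t) m e" "edge_along (E t) m e'"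
  shows "same_direction e e'"
  using assms edge_at_unique[OF poly[OF assms(1)]] unfolding edge_along_def
  by (metis same_direction_sym same_direction_trans)

lemma edge_along_inside:
  assumes "t \<in> T" "edge_along (E t) m e" "wedge e v > 0"
  shows "\<forall>\<^sub>F \<delta> in at_right (0::real). m + \<delta> *\<^sub>R v \<in> polygon_interior (E t)"
  using assms eventually_inside_edge[OF poly[OF assms(1)]] unfolding edge_along_def
  by (metis same_direction_wedge)

lemma edge_along_mem: "t \<in> T \<Longrightarrow> edge_along (E t) m e \<Longrightarrow> m \<in> R t"
  unfolding edge_along_def using edge_at_mem[OF poly] by blast

lemma edge_at_neq: "t \<in> T \<Longrightarrow> edge_at (E t) m p q \<Longrightarrow> q - p \<noteq> 0"
  using polygon_edge_neq[OF poly] by (auto simp: edge_at_def)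

lemma other_tile_opposite:
  assumes t: "t \<in> T" "edge_along (E t) m e" "e \<noteq> 0" and s: "s \<in> T" "s \<noteq> t" "m \<in> R s"
  shows "edge_along (E s) m (- e)"
proof -
  have "m \<notin> polygon_interior (E s)"
    using no_overlap[OF t(1) s(1) edge_along_inside[OF t(1,2) wedge_i_pos[OF t(3)]]]
      eventually_inside_interior[OF poly[OF s(1)]] s(2) by blast
  then obtain p q where pq: "edge_at (E s) m p q"
    using polygon_germ[OF poly[OF s(1)] s(3)] not_vertex[OF s(1)] by blast
  have "same_direction (- e) (q - p)"
  proof (rule ccontr)
    assume "\<not> ?thesis"
    then obtain v where v: "wedge e v > 0" "wedge (q - p) v > 0"
      using half_planes_meet[OF t(3) edge_at_neq[OF s(1) pq]] by blast
    show False
      using no_overlap[OF t(1) s(1) edge_along_inside[OF t(1,2) v(1)]]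
        eventually_inside_edge[OF poly[OF s(1)] pq v(2)] s(2) by blast
  qed
  then show ?thesis using pq by (auto simp: edge_along_def)
qed

lemma boundary_tile_along:
  assumes e: "edge_at E0 m p q" and t: "t \<in> T" "m \<in> R t"
  shows "edge_along (E t) m (q - p)"
proof -
  have neq: "p - q \<noteq> 0" "q - p \<noteq> 0" using polygon_edge_neq[OF outer] e by (auto simp: edge_at_def)
  have out: "\<not> (\<forall>\<^sub>F \<delta> in at_right (0::real). m + \<delta> *\<^sub>R v \<in> polygon_interior (E t))" if "wedge (p - q) v > 0" for v
  proof
    assume "\<forall>\<^sub>F \<delta> in at_right (0::real). m + \<delta> *\<^sub>R v \<in> polygon_interior (E t)"
    moreover have "\<forall>\<^sub>F \<delta> in at_right (0::real). \<delta> > 0" by (simp add: eventually_at_right_less)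
    ultimately have "\<forall>\<^sub>F \<delta> in at_right (0::real). False"
    proof eventually_elim
      case (elim \<delta>)
      have "wedge (q - p) v < 0" using that by (simp add: wedge_simps)
      then have "m + \<delta> *\<^sub>R v \<notin> A" using outside_edge[OF outer e] elim by blast
      moreover have "m + \<delta> *\<^sub>R v \<in> A" using elim polygon_interior_subset[OF poly[OF t(1)]] union t(1) by blast
      ultimately show ?case by blast
    qed
    then show False using eventually_at_right_0_False by blast
  qed
  have "m \<notin> polygon_interior (E t)"
    using out[OF wedge_i_pos[OF neq(1)]] eventually_inside_interior[OF poly[OF t(1)]] by blast
  then obtain p' q' where pq: "edge_at (E t) m p' q'"
    using polygon_germ[OF poly[OF t(1)] t(2)] not_vertex[OF t(1)] by blast
  have "same_direction (- (p - q)) (q' - p')"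
  proof (rule ccontr)
    assume "\<not> ?thesis"
    then obtain v where v: "wedge (p - q) v > 0" "wedge (q' - p') v > 0"
      using half_planes_meet[OF neq(1) edge_at_neq[OF t(1) pq]] by blast
    show False using out[OF v(1)] eventually_inside_edge[OF poly[OF t(1)] pq v(2)] by blast
  qed
  then show ?thesis using pq by (auto simp: edge_along_def)
qed

lemma outer_edge_along:
  assumes "edge_along E0 m e" "t \<in> T" "m \<in> R t"
  shows "edge_along (E t) m e"
proof -
  obtain p q where "edge_at E0 m p q" "same_direction e (q - p)" using assms(1) by (auto simp: edge_along_def)
  then show ?thesis using boundary_tile_along[of p q t] assms(2,3) unfolding edge_along_def
    by (meson same_direction_trans)
qed

lemma opposite_tile_exists:
  assumes t: "t \<in> T" "edge_along (E t) m e" "e \<noteq> 0" and no: "\<not> edge_along E0 m e"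
  shows "\<exists>s\<in>T. edge_along (E s) m (- e)"
proof -
  have mt: "m \<in> R t" using edge_along_mem t by blast
  then have "m \<in> A" using union t(1) by blast
  have "\<not> edge_at E0 m p q" for p q
  proof
    assume e0: "edge_at E0 m p q"
    then have "edge_along (E t) m (q - p)" by (rule boundary_tile_along[OF _ t(1) mt])
    then have "same_direction e (q - p)" by (rule edge_along_unique[OF t(1,2)])
    then show False using no e0 by (auto simp: edge_along_def)
  qed
  then have "m \<in> polygon_interior E0"
    using polygon_germ[OF outer \<open>m \<in> A\<close> not_outer_vertex] by blast
  \<comment> \<open>The region to the right of the edge of \<open>t\<close> is covered by another tile.\<close>
  define v where "v = - (\<i> * e)"
  have v: "wedge e v < 0" using wedge_i_pos[OF t(3)] by (simp add: v_def wedge_simps)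
  have ev: "\<forall>\<^sub>F \<delta> in at_right (0::real). m + \<delta> *\<^sub>R v \<in> A"
    using eventually_inside_interior[OF outer \<open>m \<in> polygon_interior E0\<close>]
    by (rule eventually_mono) (use polygon_interior_subset[OF outer] in blast)
  have "\<exists>s\<in>T. \<not> (\<forall>\<^sub>F \<delta> in at_right (0::real). m + \<delta> *\<^sub>R v \<notin> R s)"
  proof (rule ccontr)
    assume "\<not> ?thesis"
    then have "\<forall>\<^sub>F \<delta> in at_right (0::real). \<forall>s\<in>T. m + \<delta> *\<^sub>R v \<notin> R s"
      by (intro eventually_ball_finite T) blast
    with ev have "\<forall>\<^sub>F \<delta> in at_right (0::real). False"
      by eventually_elim (use union in blast)
    then show False using eventually_at_right_0_False by blast
  qed
  then obtain s where s: "s \<in> T" "\<not> (\<forall>\<^sub>F \<delta> in at_right (0::real). m + \<delta> *\<^sub>R v \<notin> R s)" by blast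
  have "m \<in> R s"
  proof (rule ccontr)
    assume "m \<notin> R s"
    then have *: "open (- R s)" "m + 0 *\<^sub>R v \<in> - R s"
      using polygon_closed[OF poly[OF s(1)]] by (auto simp: open_Compl)
    have "((\<lambda>\<delta>. m + \<delta> *\<^sub>R v) \<longlongrightarrow> m + 0 *\<^sub>R v) (at_right 0)" by (intro tendsto_intros)
    from topological_tendstoD[OF this *] show False using s(2) by simp
  qed
  moreover have "s \<noteq> t"
  proof
    assume "s = t"
    obtain p q where pq: "edge_at (E t) m p q" "same_direction e (q - p)" using t(2) by (auto simp: edge_along_def)
    have "wedge (q - p) v < 0"
      using same_direction_wedge[OF pq(2), of "- v"] v by (simp add: wedge_simps)
    then have "\<forall>\<^sub>F \<delta> in at_right (0::real). m + \<delta> *\<^sub>R v \<notin> R t"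
      using outside_edge[OF poly[OF t(1)] pq(1)] eventually_at_right_less[of "0::real"]
      by (auto elim: eventually_mono)
    then show False using s(2) \<open>s = t\<close> by blast
  qed
  ultimately show ?thesis using other_tile_opposite[OF t s(1)] s(1) by blast
qed

lemma sum_edge_along:
  "(\<Sum>t\<in>T. of_bool (edge_along (E t) m e) :: real) = of_bool (\<exists>t\<in>T. edge_along (E t) m e)" if "e \<noteq> 0"
proof (cases "\<exists>t\<in>T. edge_along (E t) m e")
  case True
  then obtain t where t: "t \<in> T" "edge_along (E t) m e" by blast
  have "edge_along (E s) m e \<longleftrightarrow> s = t" if s: "s \<in> T" for s
  proof
    assume s': "edge_along (E s) m e"
    show "s = t"
    proof (rule ccontr)
      assume "s \<noteq> t"
      then have "edge_along (E s) m (- e)"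
        using other_tile_opposite[OF t \<open>e \<noteq> 0\<close> s] edge_along_mem[OF s s'] by blast
      then have "same_direction e (- e)" by (rule edge_along_unique[OF s s'])
      then show False using same_direction_wedge[of e "- e" "\<i> * e"] wedge_i_pos[OF \<open>e \<noteq> 0\<close>]
        by (simp add: wedge_simps)
    qed
  qed (use t in simp)
  then have "(\<Sum>s\<in>T. of_bool (edge_along (E s) m e) :: real) = (\<Sum>s\<in>T. if s = t then 1 else 0)"
    by (intro sum.cong) auto
  then show ?thesis using T t by auto
qed simp

lemma edge_balance:
  "(\<Sum>t\<in>T. of_bool (edge_along (E t) m d) - of_bool (edge_along (E t) m (- d))) =
     (of_bool (edge_along E0 m d) - of_bool (edge_along E0 m (- d)) :: real)"
proof -
  define P where "P e = (\<exists>t\<in>T. edge_along (E t) m e)" for e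
  have O_P: "P e" if "edge_along E0 m e" for e
  proof -
    have "m \<in> A" using that edge_at_mem[OF outer] by (auto simp: edge_along_def)
    then obtain t where "t \<in> T" "m \<in> R t" using union by blast
    then show ?thesis using outer_edge_along[OF that] by (auto simp: P_def)
  qed
  have O_nP: "\<not> P (- e)" if o: "edge_along E0 m e" "e \<noteq> 0" for e
  proof
    assume "P (- e)"
    then obtain t where t: "t \<in> T" "edge_along (E t) m (- e)" by (auto simp: P_def)
    then have "edge_along (E t) m e" using outer_edge_along[OF o(1) t(1)] edge_along_mem by blast
    then have "same_direction e (- e)" using edge_along_unique t by blast
    then show False using same_direction_wedge[of e "- e" "\<i> * e"] wedge_i_pos[OF o(2)]
      by (simp add: wedge_simps)
  qed
  have P_P: "P (- e)" if "P e" "\<not> edge_along E0 m e" "e \<noteq> 0" for e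
    using that opposite_tile_exists by (auto simp: P_def)
  have "of_bool (P d) - of_bool (P (- d)) = (of_bool (edge_along E0 m d) - of_bool (edge_along E0 m (- d)) :: real)"
    using O_P[of d] O_P[of "- d"] O_nP[of d] O_nP[of "- d"] P_P[of d] P_P[of "- d"] d by auto
  then show ?thesis using d by (simp add: sum_subtractf sum_edge_along P_def)
qed

end

text \<open>The midpoint of an elementary segment decides how often it is traversed by the edges of a polygon.\<close>

lemma sum_covers:
  assumes P: "convex_polygon D B" and V: "\<And>p q. (p, q) \<in> D \<Longrightarrow> p \<in> V \<and> q \<in> V" and f: "(x, y) \<in> elementary V"
  shows "(\<Sum>e\<in>D. of_bool (covers e (x, y)) :: real) = of_bool (edge_along D (midpoint x y) (y - x))"
proof -
  let ?m = "midpoint x y"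
  have c: "covers (p, q) (x, y) \<longleftrightarrow> edge_at D ?m p q \<and> same_direction (y - x) (q - p)" if "(p, q) \<in> D" for p q
    using covers_iff_edge_at[OF that _ _ polygon_edge_neq[OF P that] f] V[OF that] by blast
  show ?thesis
  proof (cases "edge_along D ?m (y - x)")
    case True
    then obtain p q where pq: "edge_at D ?m p q" "same_direction (y - x) (q - p)" by (auto simp: edge_along_def)
    have "(p, q) \<in> D" using pq by (simp add: edge_at_def)
    have "(\<Sum>e\<in>D. of_bool (covers e (x, y)) :: real) = (\<Sum>e\<in>D. if e = (p, q) then 1 else 0)"
    proof (rule sum.cong)
      fix e assume "e \<in> D"
      moreover obtain p' q' where e: "e = (p', q')" by (cases e)
      ultimately have "covers e (x, y) \<longleftrightarrow> e = (p, q)"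
        using c[of p' q'] c[OF \<open>(p, q) \<in> D\<close>] edge_at_unique[OF P pq(1), of p' q'] pq by blast
      then show "of_bool (covers e (x, y)) = (if e = (p, q) then 1 else 0 :: real)" by simp
    qed simp
    then show ?thesis using True \<open>(p, q) \<in> D\<close> polygon_finite[OF P] by simp
  next
    case False
    then have "\<not> covers e (x, y)" if "e \<in> D" for e
      using c[of "fst e" "snd e"] that unfolding edge_along_def by (metis prod.collapse)
    then show ?thesis using False by simp
  qed
qed

text \<open>Expand both sides into elementary segments. By \<open>edge_balance\<close> the excess \<open>g\<close> of the coefficients on
  the left over those on the right is the same for both directions of a segment, while \<open>F\<close> changes its
  sign.\<close>

theorem sum_edges_tiling:
  fixes F :: "complex \<Rightarrow> complex \<Rightarrow> real"
  assumes add: "\<And>p q r. q \<in> open_segment p r \<Longrightarrow> F p r = F p q + F q r"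
    and anti: "\<And>p q. F q p = - F p q"
  shows "(\<Sum>t\<in>T. \<Sum>(p, q)\<in>E t. F p q) = (\<Sum>(p, q)\<in>E0. F p q)"
proof -
  define V where "V = (\<Union>e\<in>E0 \<union> (\<Union>t\<in>T. E t). {fst e, snd e})"
  have "finite V" unfolding V_def using T polygon_finite[OF poly] polygon_finite[OF outer] by auto
  have VE0: "p \<in> V \<and> q \<in> V" if "(p, q) \<in> E0" for p q using that unfolding V_def by force
  have VE: "p \<in> V \<and> q \<in> V" if "t \<in> T" "(p, q) \<in> E t" for p q t using that unfolding V_def by force
  define n where "n D f = (\<Sum>e\<in>D. of_bool (covers e f) :: real)" for D f
  let ?El = "elementary V"
  have expand: "(\<Sum>(p, q)\<in>D. F p q) = (\<Sum>f\<in>?El. n D f * F (fst f) (snd f))"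
    if P: "convex_polygon D B" and DV: "\<And>p q. (p, q) \<in> D \<Longrightarrow> p \<in> V \<and> q \<in> V" for D B
  proof -
    have "(\<Sum>(p, q)\<in>D. F p q) = (\<Sum>e\<in>D. \<Sum>f\<in>?El. of_bool (covers e f) * F (fst f) (snd f))"
      using edge_functional_elementary[of V F, OF \<open>finite V\<close> add] DV polygon_edge_neq[OF P]
      by (intro sum.cong) (auto split: prod.splits)
    also have "\<dots> = (\<Sum>f\<in>?El. \<Sum>e\<in>D. of_bool (covers e f) * F (fst f) (snd f))" by (rule sum.swap)
    finally show ?thesis by (simp add: n_def sum_distrib_right)
  qed
  define g where "g f = (\<Sum>t\<in>T. n (E t) f) - n E0 f" for f
  have sym: "g (y, x) = g (x, y)" if f: "(x, y) \<in> ?El" for x y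
  proof -
    have f': "(y, x) \<in> ?El" using f by (auto simp: elementary_def open_segment_commute)
    let ?m = "midpoint x y"
    have "x \<noteq> y" "?m \<in> open_segment x y" using f by (auto simp: elementary_def)
    moreover have "open_segment x y \<inter> V = {}" using f by (auto simp: elementary_def)
    ultimately have "?m \<notin> V" by blast
    have n: "n D (x, y) - n D (y, x) = of_bool (edge_along D ?m (y - x)) - of_bool (edge_along D ?m (- (y - x)))"
      if "convex_polygon D B" "\<And>p q. (p, q) \<in> D \<Longrightarrow> p \<in> V \<and> q \<in> V" for D B
      using sum_covers[OF that f] sum_covers[OF that f'] by (simp add: n_def midpoint_sym)
    have "(\<Sum>t\<in>T. n (E t) (x, y) - n (E t) (y, x)) =
        (\<Sum>t\<in>T. of_bool (edge_along (E t) ?m (y - x)) - of_bool (edge_along (E t) ?m (- (y - x))))"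
      by (intro sum.cong refl n[OF poly VE])
    also have "\<dots> = of_bool (edge_along E0 ?m (y - x)) - of_bool (edge_along E0 ?m (- (y - x)))"
      using \<open>x \<noteq> y\<close> VE VE0 \<open>?m \<notin> V\<close> by (intro edge_balance) (simp, blast+)
    also have "\<dots> = n E0 (x, y) - n E0 (y, x)" using n[OF outer VE0] by simp
    finally have "(\<Sum>t\<in>T. n (E t) (x, y) - n (E t) (y, x)) = n E0 (x, y) - n E0 (y, x)" .
    then show ?thesis by (simp add: g_def sum_subtractf)
  qed
  have "(\<Sum>t\<in>T. \<Sum>(p, q)\<in>E t. F p q) = (\<Sum>t\<in>T. \<Sum>f\<in>?El. n (E t) f * F (fst f) (snd f))"
    using expand[OF poly VE] by simp
  also have "\<dots> = (\<Sum>f\<in>?El. \<Sum>t\<in>T. n (E t) f * F (fst f) (snd f))" by (rule sum.swap)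
  finally have "(\<Sum>t\<in>T. \<Sum>(p, q)\<in>E t. F p q) - (\<Sum>(p, q)\<in>E0. F p q) = (\<Sum>f\<in>?El. g f * F (fst f) (snd f))"
    by (simp add: expand[OF outer VE0] g_def sum_distrib_right left_diff_distrib sum_subtractf)
  moreover have "(\<Sum>f\<in>?El. g f * F (fst f) (snd f)) = 0"
  proof -
    have "(\<Sum>f\<in>?El. g f * F (fst f) (snd f)) = (\<Sum>f\<in>?El. g (prod.swap f) * F (snd f) (fst f))"
      by (rule sum.reindex_bij_witness[of _ prod.swap prod.swap])
        (auto simp: elementary_def open_segment_commute)
    also have "\<dots> = (\<Sum>f\<in>?El. - (g f * F (fst f) (snd f)))"
    proof (rule sum.cong)
      fix f assume "f \<in> ?El"
      moreover obtain x y where f: "f = (x, y)" by (cases f)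
      ultimately show "g (prod.swap f) * F (snd f) (fst f) = - (g f * F (fst f) (snd f))"
        using sym[of x y] anti[where p = x and q = y] by simp
    qed simp
    finally show ?thesis by (simp add: sum_negf)
  qed
  ultimately show ?thesis by simp
qed

end

section \<open>Triangles and the regular polygon\<close>

lemma open_polygon_interior: "finite E \<Longrightarrow> open (polygon_interior E)"
proof -
  assume "finite E"
  moreover have "polygon_interior E = (\<Inter>e\<in>E. {z. 0 < wedge (snd e - fst e) (z - fst e)})"
    unfolding polygon_interior_def by fastforce
  moreover have "open {z. 0 < wedge (snd e - fst e) (z - fst e)}" for e
    by (intro open_Collect_less continuous_intros)
  ultimately show ?thesis by (auto intro!: open_INT)
qed

lemma polygon_interior_subset_interior: "convex_polygon E A \<Longrightarrow> polygon_interior E \<subseteq> interior A"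
  by (intro interior_maximal polygon_interior_subset open_polygon_interior polygon_finite)

lemma wedge_barycentric:
  assumes "u + v + t = 1" "z = u *\<^sub>R a + v *\<^sub>R b + t *\<^sub>R c"
  shows "wedge (b - a) (z - a) = t * wedge (b - a) (c - a)"
    "wedge (c - b) (z - b) = u * wedge (b - a) (c - a)"
    "wedge (a - c) (z - c) = v * wedge (b - a) (c - a)"
proof -
  have u: "u = 1 - v - t" using assms(1) by simp
  show "wedge (b - a) (z - a) = t * wedge (b - a) (c - a)"
    "wedge (c - b) (z - b) = u * wedge (b - a) (c - a)"
    "wedge (a - c) (z - c) = v * wedge (b - a) (c - a)"
    unfolding assms(2) u by (simp_all add: wedge_def algebra_simps)
qed

lemma barycentric_coordinates:
  assumes "wedge (b - a) (c - a) \<noteq> 0"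
  obtains u v t where "u + v + t = 1" "z = u *\<^sub>R a + v *\<^sub>R b + t *\<^sub>R c"
proof -
  define D where "D = wedge (b - a) (c - a)"
  define u v t where "u = wedge (c - b) (z - b) / D" and "v = wedge (a - c) (z - c) / D"
    and "t = wedge (b - a) (z - a) / D"
  have D: "D \<noteq> 0" using assms by (simp add: D_def)
  have "wedge (c - b) (z - b) + wedge (a - c) (z - c) + wedge (b - a) (z - a) = D"
    by (simp add: D_def wedge_def algebra_simps)
  then have "u + v + t = 1" using D by (simp add: u_def v_def t_def flip: add_divide_distrib)
  moreover have "D *\<^sub>R z = wedge (c - b) (z - b) *\<^sub>R a + wedge (a - c) (z - c) *\<^sub>R b + wedge (b - a) (z - a) *\<^sub>R c"
    by (simp add: D_def wedge_def complex_eq_iff algebra_simps)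
  then have "(1 / D) *\<^sub>R D *\<^sub>R z = u *\<^sub>R a + v *\<^sub>R b + t *\<^sub>R c"
    by (simp add: u_def v_def t_def scaleR_add_right divide_inverse_commute)
  then have "z = u *\<^sub>R a + v *\<^sub>R b + t *\<^sub>R c" using D by simp
  ultimately show thesis by (rule that)
qed

lemma triangle_polygon:
  assumes pos: "wedge (b - a) (c - a) > 0"
  shows "convex_polygon {(a, b), (b, c), (c, a)} (convex hull {a, b, c})"
proof -
  let ?E = "{(a, b), (b, c), (c, a)}" and ?A = "convex hull {a, b, c}"
  have nz: "wedge (b - a) (c - a) \<noteq> 0" using pos by simp
  have mem: "z \<in> ?A \<longleftrightarrow> 0 \<le> u \<and> 0 \<le> v \<and> 0 \<le> t"
    if "u + v + t = 1" "z = u *\<^sub>R a + v *\<^sub>R b + t *\<^sub>R c" for z u v t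
  proof
    assume "z \<in> ?A"
    then obtain u' v' t' where *: "0 \<le> u'" "0 \<le> v'" "0 \<le> t'" "u' + v' + t' = 1"
        "z = u' *\<^sub>R a + v' *\<^sub>R b + t' *\<^sub>R c"
      by (auto simp: convex_hull_3)
    have "u' = u" "v' = v" "t' = t"
      using wedge_barycentric[OF that] wedge_barycentric[OF *(4,5)] nz by simp_all
    then show "0 \<le> u \<and> 0 \<le> v \<and> 0 \<le> t" using * by simp
  qed (use that in \<open>auto simp: convex_hull_3\<close>)
  have seg: "z \<in> closed_segment p q \<longleftrightarrow> (\<exists>u v. 0 \<le> u \<and> 0 \<le> v \<and> u + v = 1 \<and> z = u *\<^sub>R p + v *\<^sub>R q)"
    for z p q :: complex
    by (auto simp: segment_convex_hull convex_hull_2)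
  have A: "?A = {z. \<forall>(p, q)\<in>?E. 0 \<le> wedge (q - p) (z - p)}"
  proof (intro set_eqI)
    fix z
    obtain u v t where c: "u + v + t = 1" "z = u *\<^sub>R a + v *\<^sub>R b + t *\<^sub>R c"
      using barycentric_coordinates[OF nz] by blast
    show "z \<in> ?A \<longleftrightarrow> z \<in> {z. \<forall>(p, q)\<in>?E. 0 \<le> wedge (q - p) (z - p)}"
      using mem[OF c] wedge_barycentric[OF c] pos by (auto simp: zero_le_mult_iff)
  qed
  have edges: "{z \<in> ?A. wedge (b - a) (z - a) = 0} = closed_segment a b"
    "{z \<in> ?A. wedge (c - b) (z - b) = 0} = closed_segment b c"
    "{z \<in> ?A. wedge (a - c) (z - c) = 0} = closed_segment c a"
  proof -
    have one: "{z \<in> ?A. P z} = closed_segment p q"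
      if "\<And>u v t z. u + v + t = 1 \<Longrightarrow> z = u *\<^sub>R a + v *\<^sub>R b + t *\<^sub>R c \<Longrightarrow> 0 \<le> u \<Longrightarrow> 0 \<le> v \<Longrightarrow> 0 \<le> t \<Longrightarrow> P z \<Longrightarrow>
            z \<in> closed_segment p q"
        "p \<in> ?A" "q \<in> ?A" "\<And>z. z \<in> closed_segment p q \<Longrightarrow> P z" for P p q
    proof (intro set_eqI iffI)
      fix z assume z: "z \<in> {z \<in> ?A. P z}"
      then obtain u v t where "0 \<le> u" "0 \<le> v" "0 \<le> t" "u + v + t = 1" "z = u *\<^sub>R a + v *\<^sub>R b + t *\<^sub>R c"
        by (auto simp: convex_hull_3)
      then show "z \<in> closed_segment p q" using that(1) z by blast
    next
      fix z assume z: "z \<in> closed_segment p q"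
      have "closed_segment p q \<subseteq> ?A" using that(2,3) by (intro closed_segment_subset) auto
      then show "z \<in> {z \<in> ?A. P z}" using that(4) z by blast
    qed
    have abc: "a \<in> ?A" "b \<in> ?A" "c \<in> ?A" by (auto intro: hull_inc)
    have line: "wedge (q - p) (z - p) = 0" if z: "z \<in> closed_segment p q" for p q z
    proof -
      obtain r where "z = (1 - r) *\<^sub>R p + r *\<^sub>R q" using z by (auto simp: in_segment)
      then have "z - p = r *\<^sub>R (q - p)" by (simp add: algebra_simps)
      then show ?thesis by (simp add: wedge_simps)
    qed
    show "{z \<in> ?A. wedge (b - a) (z - a) = 0} = closed_segment a b"
    proof (rule one)
      fix u v t z assume h: "u + v + t = 1" "z = u *\<^sub>R a + v *\<^sub>R b + t *\<^sub>R c" "0 \<le> u" "0 \<le> v" "wedge (b - a) (z - a) = 0"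
      then have "t = 0" using wedge_barycentric(1)[OF h(1,2)] nz by simp
      then show "z \<in> closed_segment a b" unfolding seg using h(1-4) by auto
    qed (use abc line in auto)
    show "{z \<in> ?A. wedge (c - b) (z - b) = 0} = closed_segment b c"
    proof (rule one)
      fix u v t z assume h: "u + v + t = 1" "z = u *\<^sub>R a + v *\<^sub>R b + t *\<^sub>R c" "0 \<le> v" "0 \<le> t" "wedge (c - b) (z - b) = 0"
      then have "u = 0" using wedge_barycentric(2)[OF h(1,2)] nz by simp
      then show "z \<in> closed_segment b c" unfolding seg using h(1-4) by auto
    qed (use abc line in auto)
    show "{z \<in> ?A. wedge (a - c) (z - c) = 0} = closed_segment c a"
    proof (rule one)
      fix u v t z assume h: "u + v + t = 1" "z = u *\<^sub>R a + v *\<^sub>R b + t *\<^sub>R c" "0 \<le> u" "0 \<le> t" "wedge (a - c) (z - c) = 0"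
      then have "v = 0" using wedge_barycentric(3)[OF h(1,2)] nz by simp
      then show "z \<in> closed_segment c a" unfolding seg using h(1-4) by (intro exI[of _ t] exI[of _ u]) auto
    qed (use abc line in auto)
  qed
  define g where "g = (1/3) *\<^sub>R a + (1/3) *\<^sub>R b + (1/3) *\<^sub>R c"
  have "g \<in> polygon_interior ?E"
    unfolding polygon_interior_def using wedge_barycentric[of "1/3" "1/3" "1/3" g a b c] pos
    by (auto simp: g_def)
  moreover have "a \<noteq> b" "b \<noteq> c" "c \<noteq> a" using nz by (auto simp: wedge_def)
  ultimately show ?thesis unfolding convex_polygon_def using A edges by auto
qed

lemma not_collinear_wedge: "\<not> collinear {a, b, c} \<Longrightarrow> wedge (b - a) (c - a) \<noteq> 0"
proof
  assume nc: "\<not> collinear {a, b, c}" and w: "wedge (b - a) (c - a) = 0"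
  have "b - a \<noteq> 0" using nc by (auto simp: insert_commute)
  then obtain r where "c - a = r *\<^sub>R (b - a)" using wedge_eq_0_imp_parallel w by blast
  then have "collinear {0, b - a, c - a}" by (auto simp: collinear_lemma)
  then have "collinear {b, a, c}" by (simp add: collinear_3)
  then show False using nc by (simp add: insert_commute)
qed

lemma wedge_mult: "wedge (w * a) (w * b) = (norm w)\<^sup>2 * wedge a b"
  unfolding cmod_power2 by (simp add: wedge_def algebra_simps power2_eq_square)

lemma wedge_cis: "wedge (cis x) (cis y) = sin (y - x)"
  by (simp add: wedge_def sin_diff)

text \<open>The vertices of the regular polygon, numbered by all integers, periodically and starting with \<open>0\<close>.\<close>

definition ngon_point :: "nat \<Rightarrow> complex \<Rightarrow> complex \<Rightarrow> int \<Rightarrow> complex" where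
  "ngon_point N z w k = z + w * cis (2 * pi * of_int k / real N)"

definition ngon_edges :: "nat \<Rightarrow> complex \<Rightarrow> complex \<Rightarrow> (complex \<times> complex) set" where
  "ngon_edges N z w = (\<lambda>k. (ngon_point N z w k, ngon_point N z w (k + 1))) ` {0..<int N}"

context
  fixes N :: nat and z w :: complex and \<theta> :: real
  assumes N: "N \<ge> 3" and w: "w \<noteq> 0" and \<theta>: "\<theta> = 2 * pi / real N"
begin

private abbreviation "V \<equiv> ngon_point N z w"

lemma theta: "0 < \<theta>" "\<theta> < pi" "0 < \<theta> / 2" "\<theta> / 2 < pi" "real N * \<theta> = 2 * pi"
  unfolding \<theta> using N by (auto simp: field_simps)

lemma sin_theta: "sin \<theta> > 0" "sin (\<theta> / 2) > 0"
  using theta by (auto intro!: sin_gt_zero)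

lemma V_eq: "V k = z + w * cis (of_int k * \<theta>)"
  by (simp add: ngon_point_def \<theta> field_simps)

lemma V_periodic: "V (k + int N * j) = V k"
proof -
  have "of_int (k + int N * j) * \<theta> = of_int k * \<theta> + 2 * pi * of_int j"
    using theta(5) by (simp add: algebra_simps)
  then show ?thesis unfolding V_eq by (simp add: cis_mult[symmetric] cis_multiple_2pi)
qed

lemma V_mod: "V (k mod int N) = V k"
  using V_periodic[of "k mod int N" "k div int N"] by simp

lemma ngon_vertex_eq: "ngon_vertex N z w j = V (int j - 1)"
  by (simp add: ngon_vertex_def ngon_point_def)

lemma V_image: "ngon_vertex N z w ` {1..N} = range V"
proof (intro set_eqI iffI)
  fix x assume "x \<in> range V"
  then obtain k where k: "x = V k" by blast
  have "x = V (k mod int N)" using k V_mod by simp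
  also have "\<dots> = ngon_vertex N z w (nat (k mod int N) + 1)"
    using N by (simp add: ngon_vertex_eq)
  finally show "x \<in> ngon_vertex N z w ` {1..N}"
    using N by (auto intro!: image_eqI[of _ _ "nat (k mod int N) + 1"] simp: nat_less_iff Suc_le_eq)
qed (auto simp: ngon_vertex_eq)

lemma ngon_edges_eq: "ngon_edges N z w = range (\<lambda>k. (V k, V (k + 1)))"
proof (intro set_eqI iffI)
  fix e assume "e \<in> range (\<lambda>k. (V k, V (k + 1)))"
  then obtain k where k: "e = (V k, V (k + 1))" by blast
  have "V (k mod int N + 1) = V (k + 1)"
    using V_periodic[of "k mod int N + 1" "k div int N"] by (simp add: algebra_simps)
  then show "e \<in> ngon_edges N z w"
    unfolding ngon_edges_def k using N by (intro image_eqI[of _ _ "k mod int N"]) (auto simp: V_mod)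
qed (auto simp: ngon_edges_def)

lemma wedge_V:
  "wedge (V (k + 1) - V k) (V i - V k) =
     (norm w)\<^sup>2 * (4 * sin (\<theta> / 2) * sin (of_int (i - k) * \<theta> / 2) * sin (of_int (i - k - 1) * \<theta> / 2))"
proof -
  define x y where "x = \<theta> / 2" and "y = of_int (i - k - 1) * \<theta> / 2"
  have x2: "2 * x = \<theta>" and y2: "2 * y = of_int (i - k - 1) * \<theta>" by (simp_all add: x_def y_def)
  have xy: "of_int (i - k) * \<theta> / 2 = x + y" by (simp add: x_def y_def field_simps)
  have "wedge (V (k + 1) - V k) (V i - V k) =
      (norm w)\<^sup>2 * wedge (cis (of_int (k + 1) * \<theta>) - cis (of_int k * \<theta>)) (cis (of_int i * \<theta>) - cis (of_int k * \<theta>))"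
    unfolding wedge_mult[symmetric] V_eq by (simp add: right_diff_distrib)
  also have "wedge (cis (of_int (k + 1) * \<theta>) - cis (of_int k * \<theta>)) (cis (of_int i * \<theta>) - cis (of_int k * \<theta>)) =
      sin (2 * y) + sin (2 * x) - sin (2 * x + 2 * y)"
  proof -
    have eq: "of_int i * \<theta> - of_int (k + 1) * \<theta> = 2 * y" "of_int k * \<theta> - of_int (k + 1) * \<theta> = - (2 * x)"
      "of_int i * \<theta> - of_int k * \<theta> = 2 * x + 2 * y"
      unfolding x2 y2 by (simp_all add: algebra_simps)
    show ?thesis unfolding wedge_diff_left wedge_diff_right wedge_cis eq by simp
  qed
  also have "\<dots> = sin (2 * y) * (1 - cos (2 * x)) + sin (2 * x) * (1 - cos (2 * y))"
    by (simp add: sin_add algebra_simps)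
  also have "\<dots> = 4 * sin x * sin (x + y) * sin y"
    unfolding cos_double_sin sin_double sin_add by (simp add: algebra_simps power2_eq_square)
  finally show ?thesis unfolding xy by (simp add: x_def y_def)
qed

lemma wedge_V_nonneg: "wedge (V (k + 1) - V k) (V i - V k) \<ge> 0"
proof -
  define n where "n = (i - k) mod int N"
  have "V i = V (k + n)"
    using V_periodic[of "k + n" "(i - k) div int N"] by (simp add: n_def algebra_simps)
  moreover have "wedge (V (k + 1) - V k) (V (k + n) - V k) \<ge> 0"
  proof (cases "n = 0")
    case False
    have "0 \<le> n" "n < int N" using N by (simp_all add: n_def)
    then have n: "0 < n" "n < int N" using False by simp_all
    have *: "0 \<le> sin (of_int l * \<theta> / 2)" if l: "0 \<le> l" "l < int N" for l
    proof (rule sin_ge_zero)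
      have "real_of_int l \<le> real N" using l by linarith
      then have "of_int l * \<theta> \<le> real N * \<theta>" using theta(1) by (intro mult_right_mono) auto
      then show "of_int l * \<theta> / 2 \<le> pi" using theta(5) by simp
    qed (use l theta in simp)
    show ?thesis unfolding wedge_V using *[of n] *[of "n - 1"] n sin_theta(2) by simp
  qed simp
  ultimately show ?thesis by simp
qed

lemma wedge_V_turn: "wedge (V (k + 1) - V k) (V (k + 2) - V (k + 1)) > 0"
proof -
  have "wedge (V (k + 1) - V k) (V (k + 2) - V (k + 1)) = wedge (V (k + 1) - V k) (V (k + 2) - V k)"
    by (simp add: wedge_simps wedge_commute[of "V k" "V (k + 1)"])
  also have "\<dots> > 0" unfolding wedge_V using sin_theta w by simp
  finally show ?thesis .
qed

lemma V_distinct: "V k \<noteq> V (k + 1)"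
  using wedge_V_turn[of k] by auto

lemma centre_in_hull: "z \<in> convex hull (range V)"
proof -
  have "(\<Sum>j<N. cis \<theta> ^ j) = 0"
  proof -
    have "cis \<theta> \<noteq> 1" using sin_theta(1) by (auto simp: complex_eq_iff)
    moreover have "cis \<theta> ^ N = 1" using theta(5) by (simp add: Complex.DeMoivre)
    ultimately show ?thesis by (simp add: geometric_sum)
  qed
  moreover have "(\<Sum>j<N. (1 / real N) *\<^sub>R V (int j)) = (\<Sum>j<N. z / of_nat N + w / of_nat N * cis \<theta> ^ j)"
    by (intro sum.cong) (auto simp: V_eq Complex.DeMoivre scaleR_conv_of_real add_divide_distrib)
  then have "(\<Sum>j<N. (1 / real N) *\<^sub>R V (int j)) = (\<Sum>j<N. z / of_nat N) + w / of_nat N * (\<Sum>j<N. cis \<theta> ^ j)"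
    by (simp only: sum.distrib sum_distrib_left)
  ultimately have "(\<Sum>j<N. (1 / real N) *\<^sub>R V (int j)) = z"
    using N by simp
  moreover have "(\<Sum>j<N. (1 / real N) *\<^sub>R V (int j)) \<in> convex hull (range V)"
    using N by (intro convex_sum) (auto intro: hull_inc)
  ultimately show ?thesis by simp
qed

lemma ngon_centre_wedge: "wedge (V (k + 1) - V k) (z - V k) = (norm w)\<^sup>2 * sin \<theta>"
proof -
  have "wedge (V (k + 1) - V k) (z - V k) =
    (norm w)\<^sup>2 * wedge (cis (of_int (k + 1) * \<theta>) - cis (of_int k * \<theta>)) (- cis (of_int k * \<theta>))"
    unfolding wedge_mult[symmetric] V_eq by (simp add: right_diff_distrib)
  also have "\<dots> = (norm w)\<^sup>2 * sin \<theta>"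
    by (simp add: wedge_simps wedge_cis algebra_simps)
  finally show ?thesis .
qed

text \<open>For the nontrivial inclusion, a point in the intersection of the half planes is expressed by the centre
  and the two vertices \<open>V j\<close>, \<open>V (j + 1)\<close> that bound its sector; the half plane of this edge shows that
  the coefficients sum up to at most \<open>1\<close>.\<close>

lemma regular_ngon_halfplanes:
  "regular_ngon N z w = {y. \<forall>(p, q)\<in>ngon_edges N z w. 0 \<le> wedge (q - p) (y - p)}"
proof (intro subset_antisym subsetI)
  fix y assume "y \<in> regular_ngon N z w"
  moreover have "convex hull (range V) \<subseteq> {y. 0 \<le> wedge (V (k + 1) - V k) (y - V k)}" for k
  proof (rule hull_minimal)
    show "convex {y. 0 \<le> wedge (V (k + 1) - V k) (y - V k)}"
    proof (rule convexI)
      fix x y u v assume h: "x \<in> {y. 0 \<le> wedge (V (k + 1) - V k) (y - V k)}"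
        "y \<in> {y. 0 \<le> wedge (V (k + 1) - V k) (y - V k)}" "0 \<le> u" "0 \<le> v" "u + v = (1::real)"
      have "u *\<^sub>R x + v *\<^sub>R y - V k = u *\<^sub>R (x - V k) + v *\<^sub>R (y - V k) + (u + v - 1) *\<^sub>R V k"
        by (simp add: algebra_simps)
      then have "wedge (V (k + 1) - V k) (u *\<^sub>R x + v *\<^sub>R y - V k) =
          u * wedge (V (k + 1) - V k) (x - V k) + v * wedge (V (k + 1) - V k) (y - V k)"
        using h(5) by (simp only: wedge_simps(2) wedge_simps(8)) simp
      then show "u *\<^sub>R x + v *\<^sub>R y \<in> {y. 0 \<le> wedge (V (k + 1) - V k) (y - V k)}" using h by simp
    qed
  qed (use wedge_V_nonneg in auto)
  ultimately show "y \<in> {y. \<forall>(p, q)\<in>ngon_edges N z w. 0 \<le> wedge (q - p) (y - p)}"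
    unfolding regular_ngon_def V_image ngon_edges_eq by blast
next
  fix y assume y: "y \<in> {y. \<forall>(p, q)\<in>ngon_edges N z w. 0 \<le> wedge (q - p) (y - p)}"
  define u where "u = (y - z) / w"
  define \<phi> where "\<phi> = Arg2pi u"
  define j where "j = \<lfloor>\<phi> / \<theta>\<rfloor>"
  define \<tau> where "\<tau> = \<phi> - of_int j * \<theta>"
  have "of_int j \<le> \<phi> / \<theta>" "\<phi> / \<theta> < of_int j + 1" by (auto simp: j_def)
  then have \<tau>: "0 \<le> \<tau>" "\<tau> \<le> \<theta>"
    using theta(1) unfolding \<tau>_def pos_le_divide_eq[OF theta(1)] pos_divide_less_eq[OF theta(1)]
    by (auto simp: algebra_simps less_imp_le)
  define s t where "s = norm u * sin (\<theta> - \<tau>) / sin \<theta>" and "t = norm u * sin \<tau> / sin \<theta>"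
  have st: "0 \<le> s" "0 \<le> t" unfolding s_def t_def using \<tau> theta sin_theta
    by (auto intro!: divide_nonneg_pos mult_nonneg_nonneg sin_ge_zero)
  have "sin \<theta> *\<^sub>R cis \<tau> = sin (\<theta> - \<tau>) *\<^sub>R 1 + sin \<tau> *\<^sub>R cis \<theta>"
    by (simp add: complex_eq_iff sin_diff)
  then have "cis (of_int j * \<theta>) * (sin \<theta> *\<^sub>R cis \<tau>) = cis (of_int j * \<theta>) * (sin (\<theta> - \<tau>) *\<^sub>R 1 + sin \<tau> *\<^sub>R cis \<theta>)"
    by simp
  moreover have "of_int j * \<theta> + \<tau> = \<phi>" "of_int j * \<theta> + \<theta> = of_int (j + 1) * \<theta>"
    by (simp_all add: \<tau>_def algebra_simps)
  ultimately have "sin \<theta> *\<^sub>R cis \<phi> = sin (\<theta> - \<tau>) *\<^sub>R cis (of_int j * \<theta>) + sin \<tau> *\<^sub>R cis (of_int (j + 1) * \<theta>)"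
    by (simp only: mult_scaleR_right distrib_left cis_mult mult_1_right)
  then have "(norm u / sin \<theta>) *\<^sub>R (sin \<theta> *\<^sub>R cis \<phi>) = s *\<^sub>R cis (of_int j * \<theta>) + t *\<^sub>R cis (of_int (j + 1) * \<theta>)"
    by (simp only: scaleR_add_right scaleR_scaleR s_def t_def) simp
  moreover have "(norm u / sin \<theta>) *\<^sub>R (sin \<theta> *\<^sub>R cis \<phi>) = norm u *\<^sub>R cis \<phi>"
    using sin_theta(1) by simp
  moreover have "u = norm u *\<^sub>R cis \<phi>"
    unfolding \<phi>_def cis_conv_exp scaleR_conv_of_real by (rule Arg2pi_eq)
  ultimately have u: "u = s *\<^sub>R cis (of_int j * \<theta>) + t *\<^sub>R cis (of_int (j + 1) * \<theta>)" by simp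
  have "y = z + w * u" using w by (simp add: u_def)
  then have y_eq: "y = (1 - s - t) *\<^sub>R z + s *\<^sub>R V j + t *\<^sub>R V (j + 1)"
    unfolding u V_eq by (simp add: scaleR_conv_of_real algebra_simps)
  have "0 \<le> wedge (V (j + 1) - V j) (y - V j)" using y by (auto simp: ngon_edges_eq)
  also have "y - V j = (1 - s - t) *\<^sub>R (z - V j) + t *\<^sub>R (V (j + 1) - V j)"
    unfolding y_eq by (simp add: algebra_simps)
  finally have "0 \<le> (1 - s - t) * ((norm w)\<^sup>2 * sin \<theta>)" by (simp add: wedge_add_right wedge_scaleR_right ngon_centre_wedge)
  moreover have "0 < (norm w)\<^sup>2 * sin \<theta>" using w sin_theta(1) by simp
  ultimately have "0 \<le> 1 - s - t" unfolding zero_le_mult_iff by linarith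
  then have "y \<in> convex hull {z, V j, V (j + 1)}" unfolding convex_hull_3
    by (intro CollectI exI[of _ "1 - s - t"] exI[of _ s] exI[of _ t]) (use st y_eq in simp)
  moreover have "convex hull {z, V j, V (j + 1)} \<subseteq> convex hull (range V)"
    using centre_in_hull by (intro hull_minimal) (auto intro: hull_inc)
  ultimately show "y \<in> regular_ngon N z w" unfolding regular_ngon_def V_image by blast
qed

lemma ngon_polygon: "convex_polygon (ngon_edges N z w) (regular_ngon N z w)"
proof -
  let ?A = "regular_ngon N z w"
  have mem: "0 \<le> wedge (V (k + 1) - V k) (y - V k)" if "y \<in> ?A" for y k
    using that unfolding regular_ngon_halfplanes ngon_edges_eq by blast
  have "{y \<in> ?A. wedge (V (k + 1) - V k) (y - V k) = 0} = closed_segment (V k) (V (k + 1))" for k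
  proof (intro set_eqI iffI)
    fix y assume y: "y \<in> {y \<in> ?A. wedge (V (k + 1) - V k) (y - V k) = 0}"
    then obtain r where r: "y - V k = r *\<^sub>R (V (k + 1) - V k)"
      using wedge_eq_0_imp_parallel[of "V (k + 1) - V k" "y - V k"] V_distinct[of k] by auto
    have "y - V (k + 1) = (y - V k) - (V (k + 1) - V k)" by simp
    also have "\<dots> = (r - 1) *\<^sub>R (V (k + 1) - V k)" unfolding r by (simp add: scaleR_diff_left)
    finally have "0 \<le> wedge (V (k + 2) - V (k + 1)) ((r - 1) *\<^sub>R (V (k + 1) - V k))"
      using mem[of y "k + 1"] y by (simp add: add.assoc)
    then have "0 \<le> (1 - r) * wedge (V (k + 1) - V k) (V (k + 2) - V (k + 1))"
      unfolding wedge_scaleR_right wedge_commute[of "V (k + 2) - V (k + 1)" "V (k + 1) - V k"]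
      by (simp add: left_diff_distrib)
    then have "r \<le> 1" using wedge_V_turn[of k] by (simp add: zero_le_mult_iff)
    have y': "y - V (k - 1) = (V k - V (k - 1)) + r *\<^sub>R (V (k + 1) - V k)" unfolding r[symmetric] by simp
    have "0 \<le> wedge (V (k - 1 + 1) - V (k - 1)) (y - V (k - 1))" using y by (intro mem) simp
    then have "0 \<le> wedge (V k - V (k - 1)) ((V k - V (k - 1)) + r *\<^sub>R (V (k + 1) - V k))"
      unfolding y' by simp
    then have "0 \<le> r * wedge (V k - V (k - 1)) (V (k + 1) - V k)"
      unfolding wedge_add_right wedge_scaleR_right by simp
    moreover have "0 < wedge (V k - V (k - 1)) (V (k + 1) - V k)"
      using wedge_V_turn[of "k - 1"] by (simp add: add.commute)
    ultimately have "0 \<le> r" unfolding zero_le_mult_iff by linarith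
    have "y = (1 - r) *\<^sub>R V k + r *\<^sub>R V (k + 1)" using r by (simp add: algebra_simps)
    then show "y \<in> closed_segment (V k) (V (k + 1))" using \<open>0 \<le> r\<close> \<open>r \<le> 1\<close> by (auto simp: in_segment)
  next
    fix y assume y: "y \<in> closed_segment (V k) (V (k + 1))"
    have "closed_segment (V k) (V (k + 1)) \<subseteq> ?A"
      unfolding regular_ngon_def V_image by (intro closed_segment_subset) (auto intro: hull_inc)
    moreover obtain r where "y = (1 - r) *\<^sub>R V k + r *\<^sub>R V (k + 1)" using y by (auto simp: in_segment)
    then have "y - V k = r *\<^sub>R (V (k + 1) - V k)" by (simp add: algebra_simps)
    then have "wedge (V (k + 1) - V k) (y - V k) = 0" by (simp add: wedge_scaleR_right)
    ultimately show "y \<in> {y \<in> ?A. wedge (V (k + 1) - V k) (y - V k) = 0}" using y by blast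
  qed
  moreover have "finite (ngon_edges N z w)" by (simp add: ngon_edges_def)
  moreover have "z \<in> polygon_interior (ngon_edges N z w)"
    using w sin_theta(1) by (auto simp: polygon_interior_def ngon_edges_eq ngon_centre_wedge)
  ultimately show ?thesis
    unfolding convex_polygon_def using regular_ngon_halfplanes V_distinct
    by (auto simp: ngon_edges_eq)
qed

lemma V_eq_iff: "V k = V l \<longleftrightarrow> k mod int N = l mod int N"
proof
  assume h: "V k = V l"
  define t where "t = of_int (l - k) * \<theta>"
  have "w * cis (of_int k * \<theta>) = w * cis (of_int l * \<theta>)" using h by (simp add: V_eq)
  then have "cis (of_int l * \<theta>) / cis (of_int k * \<theta>) = 1" using w by simp
  then have "cis t = 1" unfolding cis_divide t_def by (simp add: algebra_simps)
  then have "cos t = 1" by (simp add: complex_eq_iff)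
  then obtain x :: int where "t = of_int x * 2 * pi" by (auto simp: cos_one_2pi_int)
  then have "of_int (l - k) * (2 * pi) = of_int x * (2 * pi) * real N"
    using N by (simp add: t_def \<theta> field_simps)
  then have "real_of_int (l - k) = of_int (x * int N)" by simp
  then have "l - k = x * int N" by (simp only: of_int_eq_iff)
  then show "k mod int N = l mod int N" by (metis diff_eq_eq mod_mult_self3)
next
  assume "k mod int N = l mod int N"
  then show "V k = V l" using V_mod[of k] V_mod[of l] by simp
qed

lemma sum_ngon_edges: "(\<Sum>(p, q)\<in>ngon_edges N z w. F p q) = (\<Sum>k\<in>{0..<int N}. F (V k) (V (k + 1)))"
proof -
  have "inj_on (\<lambda>k. (V k, V (k + 1))) {0..<int N}"
    by (rule inj_onI) (simp add: V_eq_iff)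
  then show ?thesis unfolding ngon_edges_def by (simp add: sum.reindex)
qed

end

section \<open>Angles of the tiles\<close>

lemma cnj_mult_eq: "cnj u * v = Complex (u \<bullet> v) (wedge u v)"
  by (simp add: complex_eq_iff wedge_def inner_complex_def)

lemma polar_angle:
  assumes "u \<noteq> 0" "v \<noteq> 0" "0 \<le> wedge u v"
  shows "cnj u * v = of_real (norm u * norm v) * cis (arccos (u \<bullet> v / (norm u * norm v)))"
proof -
  define n where "n = norm u * norm v"
  have n: "n > 0" using assms by (simp add: n_def)
  have "(u \<bullet> v)\<^sup>2 + (wedge u v)\<^sup>2 = (norm (cnj u * v))\<^sup>2"
    unfolding cnj_mult_eq cmod_power2 by simp
  also have "\<dots> = n\<^sup>2" by (simp add: n_def norm_mult)
  finally have eq: "(u \<bullet> v)\<^sup>2 + (wedge u v)\<^sup>2 = n\<^sup>2" .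
  define c where "c = u \<bullet> v / n"
  have cs: "c\<^sup>2 + (wedge u v / n)\<^sup>2 = 1"
    using eq n by (simp add: c_def power_divide flip: add_divide_distrib)
  then have "c\<^sup>2 \<le> 1" by (metis le_add_same_cancel1 zero_le_power2)
  then have "\<bar>c\<bar> \<le> 1" by (simp add: abs_square_le_1)
  then have c: "-1 \<le> c" "c \<le> 1" by (simp_all add: abs_le_iff)
  have "sin (arccos c) = sqrt (1 - c\<^sup>2)" using c by (rule sin_arccos)
  also have "1 - c\<^sup>2 = (wedge u v / n)\<^sup>2" using cs by simp
  also have "sqrt \<dots> = wedge u v / n" using assms(3) n unfolding real_sqrt_abs by simp
  finally have s: "sin (arccos c) = wedge u v / n" .
  have "cnj u * v = of_real n * cis (arccos c)"
    unfolding cnj_mult_eq using n c s by (simp add: complex_eq_iff c_def cos_arccos)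
  then show ?thesis by (simp add: n_def c_def)
qed

lemma angle_commute: "angle a b c = angle c b a"
  by (simp add: angle_def inner_commute mult.commute)

lemma angle_polar:
  assumes "wedge (q - p) (r - p) > 0"
  shows "cnj (q - p) * (r - p) = of_real (norm (q - p) * norm (r - p)) * cis (angle q p r)"
    "0 < angle q p r" "angle q p r < pi"
proof -
  have nz: "q - p \<noteq> 0" "r - p \<noteq> 0" using assms by auto
  show *: "cnj (q - p) * (r - p) = of_real (norm (q - p) * norm (r - p)) * cis (angle q p r)"
    unfolding angle_def using polar_angle[OF nz] assms by simp
  have "wedge (q - p) (r - p) = norm (q - p) * norm (r - p) * sin (angle q p r)"
    using arg_cong[OF *, of Im] unfolding cnj_mult_eq by simp
  moreover have "0 < norm (q - p) * norm (r - p)" using nz by simp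
  ultimately have s: "sin (angle q p r) > 0" using assms by (metis zero_less_mult_pos)
  have "\<bar>(q - p) \<bullet> (r - p) / (norm (q - p) * norm (r - p))\<bar> \<le> 1"
    using Cauchy_Schwarz_ineq2[of "q - p" "r - p"] nz by (simp add: abs_mult divide_le_eq)
  then have "0 \<le> angle q p r" "angle q p r \<le> pi"
    unfolding angle_def abs_le_iff
    by (auto intro!: arccos_lbound arccos_ubound simp only: minus_le_iff)
  moreover have "angle q p r \<noteq> 0" "angle q p r \<noteq> pi" using s by auto
  ultimately show "0 < angle q p r" "angle q p r < pi" by auto
qed

text \<open>The angle sum and the law of sines. All angles are expressed by the unoriented \<open>angle\<close>.\<close>

lemma triangle_shape:
  assumes pos: "wedge (q - p) (r - p) > 0"
  defines "A \<equiv> angle q p r" and "B \<equiv> angle p q r" and "C \<equiv> angle p r q"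
  shows "0 < A" "0 < B" "0 < C" "A + B + C = pi"
    and "\<exists>\<rho>. \<rho> \<noteq> 0 \<and> q - p = \<rho> * of_real (sin C) \<and> r - p = \<rho> * of_real (sin B) * cis A"
proof -
  have posq: "wedge (r - q) (p - q) > 0" and posr: "wedge (p - r) (q - r) > 0"
    using pos by (simp_all add: wedge_def algebra_simps)
  have B: "angle r q p = B" unfolding B_def by (rule angle_commute)
  note a = angle_polar[OF pos, folded A_def]
  note b = angle_polar[OF posq, unfolded B]
  note c = angle_polar[OF posr, folded C_def]
  show A0: "0 < A" and B0: "0 < B" and C0: "0 < C" using a b c by auto
  have nz: "q - p \<noteq> 0" "r - p \<noteq> 0" "r - q \<noteq> 0" using pos posq by auto
  define x y z where "x = norm (q - p)" and "y = norm (r - p)" and "z = norm (r - q)"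
  have xyz: "x > 0" "y > 0" "z > 0" using nz by (auto simp: x_def y_def z_def)
  have nm: "norm (p - q) = x" "norm (p - r) = y" "norm (q - r) = z"
    by (auto simp: x_def y_def z_def norm_minus_commute)
  have a': "cnj (q - p) * (r - p) = of_real (x * y) * cis A" using a(1) by (simp add: x_def y_def)
  have b': "cnj (r - q) * (p - q) = of_real (z * x) * cis B" using b(1) by (simp add: z_def nm)
  have c': "cnj (p - r) * (q - r) = of_real (y * z) * cis C" using c(1) by (simp add: nm)
  \<comment> \<open>The angle sum follows as the product of \<open>a'\<close>, \<open>b'\<close> and \<open>c'\<close> is a negative real number.\<close>
  have "(of_real (x * y) * cis A) * (of_real (z * x) * cis B) * (of_real (y * z) * cis C) =
      (cnj (q - p) * (r - p)) * (cnj (r - q) * (p - q)) * (cnj (p - r) * (q - r))"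
    by (simp only: a' b' c')
  also have "\<dots> = - ((cnj (q - p) * (q - p)) * (cnj (r - q) * (r - q)) * (cnj (r - p) * (r - p)))"
    by (simp add: algebra_simps)
  also have "\<dots> = - of_real ((x * y * z)\<^sup>2)"
    unfolding complex_norm_square[symmetric] mult.commute[of "cnj _"] x_def y_def z_def
    by (simp add: power_mult_distrib mult_ac)
  finally have "of_real ((x * y * z)\<^sup>2) * (cis (A + B + C)) = - of_real ((x * y * z)\<^sup>2)"
    by (simp add: cis_mult[symmetric] power2_eq_square mult_ac)
  then have "of_real ((x * y * z)\<^sup>2) * (cis (A + B + C) + 1) = 0" by (simp only: distrib_left) simp
  then have "cis (A + B + C) + 1 = 0" using xyz by simp
  then have "cis (A + B + C) = - 1" by (simp add: eq_neg_iff_add_eq_0)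
  then have "cos (A + B + C) = - 1" by (simp add: complex_eq_iff)
  then obtain k :: int where k: "A + B + C = of_int k * 2 * pi + pi"
    by (auto simp: cos_eq_minus1 algebra_simps)
  then have "A + B + C = (2 * of_int k + 1) * pi" by (simp add: algebra_simps)
  then have "0 * pi < (2 * of_int k + 1) * pi" "(2 * of_int k + 1) * pi < 3 * pi"
    using A0 B0 C0 a(3) b(3) c(3) by linarith+
  then have "0 < 2 * real_of_int k + 1" "2 * real_of_int k + 1 < 3"
    using pi_gt_zero by (simp_all only: mult_less_cancel_right_pos)
  then have "k = 0" by linarith
  then show "A + B + C = pi" using k by simp
  have "sin C > 0" using C0 c(3) by (simp add: sin_gt_zero)
  have sine: "y * sin C = x * sin B"
  proof -
    have "wedge (r - q) (p - q) = z * x * sin B" "wedge (p - r) (q - r) = y * z * sin C"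
      using arg_cong[OF b', of Im] arg_cong[OF c', of Im] unfolding cnj_mult_eq by simp_all
    moreover have "wedge (r - q) (p - q) = wedge (p - r) (q - r)" by (simp add: wedge_def algebra_simps)
    ultimately show ?thesis using xyz by simp
  qed
  show "\<exists>\<rho>. \<rho> \<noteq> 0 \<and> q - p = \<rho> * of_real (sin C) \<and> r - p = \<rho> * of_real (sin B) * cis A"
  proof (intro exI conjI)
    let ?\<rho> = "(q - p) / of_real (sin C)"
    show "?\<rho> \<noteq> 0" "q - p = ?\<rho> * of_real (sin C)" using nz \<open>sin C > 0\<close> by auto
    have "(cnj (q - p) * (q - p)) * (r - p) = (q - p) * (of_real (x * y) * cis A)"
      using a' by (simp add: mult_ac)
    moreover have "cnj (q - p) * (q - p) = of_real (x\<^sup>2)"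
      unfolding x_def complex_norm_square by (rule mult.commute)
    ultimately have "of_real (x\<^sup>2) * (r - p) = (q - p) * (of_real (x * y) * cis A)" by (simp only:)
    then have "of_real x * (r - p) = (q - p) * of_real y * cis A"
      using xyz by (simp add: power2_eq_square mult_ac)
    then have "of_real x * (r - p) * of_real (sin C) = (q - p) * of_real (y * sin C) * cis A"
      by (simp add: mult_ac)
    then have "of_real x * ((r - p) * of_real (sin C)) = of_real x * ((q - p) * of_real (sin B) * cis A)"
      unfolding sine by (simp add: mult_ac)
    then have "(r - p) * of_real (sin C) = (q - p) * of_real (sin B) * cis A" using xyz by simp
    then show "r - p = ?\<rho> * of_real (sin B) * cis A" using \<open>sin C > 0\<close> by (simp add: field_simps)
  qed
qed

text \<open>The edges of a tile in counterclockwise direction, whatever the orientation of the labelled triangle.\<close>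

fun tile_edges :: "tile \<Rightarrow> (complex \<times> complex) set" where
  "tile_edges (a, b, c) =
     (if wedge (b - a) (c - a) > 0 then {(a, b), (b, c), (c, a)} else {(a, c), (c, b), (b, a)})"

lemma sum_triangle_edges:
  assumes "wedge (q - p) (r - p) > 0"
  shows "(\<Sum>(x, y)\<in>{(p, q), (q, r), (r, p)}. F x y) = F p q + F q r + F r p"
proof -
  have "p \<noteq> q" "q \<noteq> r" "r \<noteq> p" using assms by (auto simp: wedge_def)
  then show ?thesis by (simp add: add_ac)
qed

text \<open>A tile with its vertices renamed counterclockwise to \<open>p\<close>, \<open>q\<close>, \<open>r\<close>, where \<open>p\<close> keeps the angle \<open>\<alpha>\<close>.\<close>

lemma tile_cases:
  assumes "is_tile \<alpha> \<beta> \<gamma> (a, b, c)"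
  obtains p q r B C where "wedge (q - p) (r - p) > 0" "tile_edges (a, b, c) = {(p, q), (q, r), (r, p)}"
    "region (a, b, c) = convex hull {p, q, r}" "angle q p r = \<alpha>" "angle p q r = B" "angle p r q = C"
    "p = a" "q = b \<and> r = c \<and> B = \<beta> \<and> C = \<gamma> \<or> q = c \<and> r = b \<and> B = \<gamma> \<and> C = \<beta>"
proof (cases "wedge (b - a) (c - a) > 0")
  case True
  then show thesis using assms by (intro that[of b a c \<beta> \<gamma>]) auto
next
  case False
  have "wedge (b - a) (c - a) \<noteq> 0" using assms not_collinear_wedge by auto
  then have "wedge (c - a) (b - a) > 0" using False wedge_commute[of "c - a" "b - a"] by simp
  then show thesis using assms False
    by (intro that[of c a b \<gamma> \<beta>]) (auto simp: insert_commute angle_commute)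
qed

lemma tile_polygon: "is_tile \<alpha> \<beta> \<gamma> t \<Longrightarrow> convex_polygon (tile_edges t) (region t)"
proof -
  assume t: "is_tile \<alpha> \<beta> \<gamma> t"
  obtain a b c where abc: "t = (a, b, c)" by (cases t)
  show ?thesis using t unfolding abc by (elim tile_cases) (simp add: triangle_polygon)
qed

lemma tiling_sum_edges:
  fixes F :: "complex \<Rightarrow> complex \<Rightarrow> real"
  assumes T: "is_tiling \<alpha> \<beta> \<gamma> (regular_ngon N z w) T" and N: "N \<ge> 3" "w \<noteq> 0"
    and add: "\<And>p q r. q \<in> open_segment p r \<Longrightarrow> F p r = F p q + F q r"
    and anti: "\<And>p q. F q p = - F p q"
  shows "(\<Sum>t\<in>T. \<Sum>(p, q)\<in>tile_edges t. F p q) =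
    (\<Sum>k\<in>{0..<int N}. F (ngon_point N z w k) (ngon_point N z w (k + 1)))"
proof -
  have poly: "convex_polygon (tile_edges t) (region t)" if "t \<in> T" for t
    using T that tile_polygon unfolding is_tiling_def by blast
  have "(\<Sum>t\<in>T. \<Sum>(p, q)\<in>tile_edges t. F p q) = (\<Sum>(p, q)\<in>ngon_edges N z w. F p q)"
  proof (rule sum_edges_tiling[where R = region])
    show "polygon_interior (tile_edges s) \<inter> polygon_interior (tile_edges t) = {}"
      if "s \<in> T" "t \<in> T" "s \<noteq> t" for s t
      using T that polygon_interior_subset_interior[OF poly] unfolding is_tiling_def pairwise_def
      by blast
    show "finite T" "(\<Union>t\<in>T. region t) = regular_ngon N z w" using T by (simp_all add: is_tiling_def)
    show "convex_polygon (ngon_edges N z w) (regular_ngon N z w)" by (rule ngon_polygon[OF N refl])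
    show "F p r = F p q + F q r" if "q \<in> open_segment p r" for p q r by (rule add[OF that])
    show "F q p = - F p q" for p q by (rule anti)
  qed (rule poly)
  then show ?thesis using sum_ngon_edges[OF N refl] by simp
qed


text \<open>A functional on directed segments that only sees the directions of the segments at the point \<open>v\<close>. If
  \<open>h\<close> is a branch of the argument without jump inside a triangle with vertex \<open>v\<close>, then the sum over the
  counterclockwise boundary of the triangle is minus its angle at \<open>v\<close>.\<close>

definition vertex_functional :: "(complex \<Rightarrow> real) \<Rightarrow> complex \<Rightarrow> complex \<Rightarrow> complex \<Rightarrow> real" where
  "vertex_functional h v p q =
     (if v \<in> closed_segment p q
      then (if q = v then 0 else h (q - v)) - (if p = v then 0 else h (p - v)) else 0)"

lemma vertex_functional_swap: "vertex_functional h v q p = - vertex_functional h v p q"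
  by (simp add: vertex_functional_def closed_segment_commute)

lemma vertex_functional_add:
  assumes h: "\<And>r u. r > 0 \<Longrightarrow> h (r *\<^sub>R u) = h u" and q: "q \<in> open_segment p r"
  shows "vertex_functional h v p r = vertex_functional h v p q + vertex_functional h v q r"
proof -
  obtain t where t: "0 < t" "t < 1" "q = p + t *\<^sub>R (r - p)" and pr: "p \<noteq> r"
    using q by (auto simp: open_segment_param)
  define d where "d = r - p"
  have d: "d \<noteq> 0" "r = p + 1 *\<^sub>R d" "q = p + t *\<^sub>R d" using pr t by (auto simp: d_def)
  have seg: "v \<in> closed_segment x y \<longleftrightarrow> (\<exists>s. 0 \<le> s \<and> s \<le> 1 \<and> v = x + s *\<^sub>R (y - x))" for x y
  proof -
    have "x + s *\<^sub>R (y - x) = (1 - s) *\<^sub>R x + s *\<^sub>R y" for s by (simp add: algebra_simps)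
    then show ?thesis by (auto simp: in_segment)
  qed
  have pq: "v \<in> closed_segment p q \<longleftrightarrow> (\<exists>s. 0 \<le> s \<and> s \<le> t \<and> v = p + s *\<^sub>R d)"
  proof
    assume "v \<in> closed_segment p q"
    then obtain s where "0 \<le> s" "s \<le> 1" "v = p + (s * t) *\<^sub>R d" unfolding seg d(3) by auto
    then show "\<exists>s. 0 \<le> s \<and> s \<le> t \<and> v = p + s *\<^sub>R d"
      using t by (intro exI[of _ "s * t"]) (auto simp: mult_left_le_one_le)
  next
    assume "\<exists>s. 0 \<le> s \<and> s \<le> t \<and> v = p + s *\<^sub>R d"
    then obtain s where "0 \<le> s" "s \<le> t" "v = p + s *\<^sub>R d" by blast
    then show "v \<in> closed_segment p q" unfolding seg d(3) using t by (intro exI[of _ "s / t"]) auto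
  qed
  have qr: "v \<in> closed_segment q r \<longleftrightarrow> (\<exists>s. t \<le> s \<and> s \<le> 1 \<and> v = p + s *\<^sub>R d)"
  proof
    assume "v \<in> closed_segment q r"
    then obtain s where s: "0 \<le> s" "s \<le> 1" "v = q + s *\<^sub>R (r - q)" unfolding seg by blast
    have "v = p + (t + s * (1 - t)) *\<^sub>R d" unfolding s(3) d(2,3) by (simp add: algebra_simps)
    moreover have "s * (1 - t) \<le> 1 * (1 - t)" using s t by (intro mult_right_mono) auto
    then have "t + s * (1 - t) \<le> 1" by (simp add: algebra_simps)
    moreover have "t \<le> t + s * (1 - t)" using s t by simp
    ultimately show "\<exists>s. t \<le> s \<and> s \<le> 1 \<and> v = p + s *\<^sub>R d" by blast
  next
    assume "\<exists>s. t \<le> s \<and> s \<le> 1 \<and> v = p + s *\<^sub>R d"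
    then obtain s where s: "t \<le> s" "s \<le> 1" "v = p + s *\<^sub>R d" by blast
    have "r - q = (1 - t) *\<^sub>R d" unfolding d(2,3) by (simp add: scaleR_diff_left)
    then have "((s - t) / (1 - t)) *\<^sub>R (r - q) = (s - t) *\<^sub>R d" using t by simp
    then have "v = q + ((s - t) / (1 - t)) *\<^sub>R (r - q)"
      unfolding s(3) d(3) by (simp add: scaleR_diff_left)
    then show "v \<in> closed_segment q r" unfolding seg using s t
      by (intro exI[of _ "(s - t) / (1 - t)"]) auto
  qed
  have pr': "v \<in> closed_segment p r \<longleftrightarrow> (\<exists>s. 0 \<le> s \<and> s \<le> 1 \<and> v = p + s *\<^sub>R d)"
    unfolding seg d_def ..
  show ?thesis
  proof (cases "v \<in> closed_segment p r")
    case False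
    then have none: "v \<noteq> p + s *\<^sub>R d" if "0 \<le> s" "s \<le> 1" for s unfolding pr' using that by blast
    have "v \<notin> closed_segment p q" "v \<notin> closed_segment q r"
      unfolding pq qr using t none by auto
    then show ?thesis using False by (simp add: vertex_functional_def)
  next
    case True
    then obtain s where s: "0 \<le> s" "s \<le> 1" "v = p + s *\<^sub>R d" unfolding pr' by blast
    have unique: "s' = s" if "v = p + s' *\<^sub>R d" for s' using that s(3) d(1) by simp
    have diff: "q - v = (t - s) *\<^sub>R d" "r - v = (1 - s) *\<^sub>R d" "p - v = (s) *\<^sub>R (- d)"
        "q - v = (s - t) *\<^sub>R (- d)"
      unfolding s(3) d(2,3) by (simp_all add: scaleR_diff_left)
    \<comment> \<open>The points \<open>v\<close> and \<open>q\<close> have the positions \<open>s\<close> and \<open>t\<close> on the segment from \<open>p\<close> to \<open>r\<close>.\<close>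
    consider "s < t" | "s = t" | "s > t" by linarith
    then show ?thesis
    proof cases
      case 1
      then have "v \<in> closed_segment p q" "v \<notin> closed_segment q r"
        unfolding pq qr using s unique by force+
      moreover have "q \<noteq> v" "r \<noteq> v" using diff(1,2) 1 s t d(1) by auto
      moreover have "h (q - v) = h (r - v)" unfolding diff(1,2) using 1 t by (simp add: h)
      ultimately show ?thesis using True by (simp add: vertex_functional_def)
    next
      case 2
      then have "q = v" using diff(1) by simp
      then show ?thesis using True by (simp add: vertex_functional_def)
    next
      case 3
      then have "v \<notin> closed_segment p q" "v \<in> closed_segment q r"
        unfolding pq qr using s unique by force+
      moreover have "q \<noteq> v" "p \<noteq> v" using diff(3,4) 3 s t d(1) by auto
      moreover have "h (q - v) = h (p - v)" unfolding diff(3,4) using 3 t by (simp add: h del: scaleR_minus_right)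
      ultimately show ?thesis using True by (simp add: vertex_functional_def)
    qed
  qed
qed

lemma Arg_mult_cis:
  assumes "Re \<rho> > 0" "Re (\<rho> * cis A) > 0" "0 < A" "A < pi"
  shows "Arg (\<rho> * cis A) = Arg \<rho> + A"
proof -
  have "\<rho> \<noteq> 0" using assms(1) by auto
  have polar: "\<rho> = of_real (norm \<rho>) * exp (\<i> * of_real (Arg \<rho>))" using Arg_eq[OF \<open>\<rho> \<noteq> 0\<close>] .
  have eq: "\<rho> * cis A = of_real (norm \<rho>) * exp (\<i> * of_real (Arg \<rho> + A))"
    by (subst polar) (simp add: cis_conv_exp exp_add[symmetric] distrib_left)
  have bound: "- pi / 2 < Arg \<rho>" "Arg \<rho> < pi / 2" using Arg_Re_pos[of \<rho>] assms(1) by auto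
  have "Re (\<rho> * cis A) = norm \<rho> * cos (Arg \<rho> + A)"
    unfolding eq by (simp add: Re_exp)
  then have c: "cos (Arg \<rho> + A) > 0" using assms(2) \<open>\<rho> \<noteq> 0\<close> by (simp add: zero_less_mult_iff)
  have "Arg \<rho> + A \<le> pi"
  proof (rule ccontr)
    assume "\<not> ?thesis"
    then have "cos (Arg \<rho> + A - pi) \<ge> 0" using bound assms(3,4) by (intro cos_ge_zero) auto
    then show False using c by (simp add: cos_diff)
  qed
  then show ?thesis using eq bound assms(3) \<open>\<rho> \<noteq> 0\<close>
    by (intro Arg_unique[of "norm \<rho>"]) (auto simp: field_simps)
qed


section \<open>The vertex equation\<close>

lemma angle_via_Arg:
  assumes pos: "wedge (q - v) (r - v) > 0" and c: "Re (c * (q - v)) > 0" "Re (c * (r - v)) > 0"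
  shows "Arg (c * (r - v)) - Arg (c * (q - v)) = angle q v r"
proof -
  obtain \<rho> where \<rho>: "q - v = \<rho> * of_real (sin (angle v r q))" "r - v = \<rho> * of_real (sin (angle v q r)) * cis (angle q v r)"
    using triangle_shape(5)[OF pos] by blast
  note t = triangle_shape(1-4)[OF pos]
  have s: "sin (angle v r q) > 0" "sin (angle v q r) > 0" using t by (auto intro!: sin_gt_zero)
  have q: "c * (q - v) = sin (angle v r q) *\<^sub>R (c * \<rho>)"
    and r: "c * (r - v) = sin (angle v q r) *\<^sub>R (c * \<rho> * cis (angle q v r))"
    unfolding \<rho> by (simp_all add: scaleR_conv_of_real mult_ac)
  have "Re (c * \<rho>) > 0" "Re (c * \<rho> * cis (angle q v r)) > 0"
    using c s unfolding q r by (simp_all add: zero_less_mult_iff)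
  then have "Arg (c * \<rho> * cis (angle q v r)) = Arg (c * \<rho>) + angle q v r"
    using t by (intro Arg_mult_cis) auto
  then show ?thesis
    unfolding q r scaleR_conv_of_real Arg_times_of_real[OF s(1)] Arg_times_of_real[OF s(2)] by simp
qed

context
  fixes N :: nat and z w :: complex and \<theta> :: real
  assumes N: "N \<ge> 3" and w: "w \<noteq> 0" and \<theta>: "\<theta> = 2 * pi / real N"
begin

private abbreviation "U \<equiv> ngon_point N z w"

text \<open>Seen from \<open>U 0\<close>, the polygon lies in the open half plane around the direction \<open>- w\<close> of the centre. So
  arguments relative to this direction have no jump inside the polygon.\<close>

lemma ngon_first_vertex_convex:
  assumes "x \<in> regular_ngon N z w" "x \<noteq> U 0"
  shows "Re (- 1 / w * (x - U 0)) > 0"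
proof -
  have Veq: "U k = z + w * cis (of_int k * \<theta>)" for k by (rule V_eq[OF N w \<theta>])
  have s: "sin \<theta> > 0" by (rule sin_theta(1)[OF N w \<theta>])
  define u where "u = (x - U 0) / w"
  have x: "x - U 0 = w * u" using w by (simp add: u_def)
  have f: "0 \<le> wedge (U (k + 1) - U k) (x - U k)" for k
    using assms(1) unfolding regular_ngon_halfplanes[OF N w \<theta>] ngon_edges_eq[OF N w \<theta>] by blast
  have d0: "U 1 - U 0 = w * (cis \<theta> - 1)" "U 0 - U (-1) = w * (1 - cis (- \<theta>))"
    unfolding Veq by (simp_all add: algebra_simps)
  have f1: "0 \<le> wedge (cis \<theta> - 1) u"
    using f[of 0] w unfolding add_0 d0 x wedge_mult by (simp add: zero_le_mult_iff)
  have "wedge (U 0 - U (- 1)) (x - U (- 1)) = wedge (U 0 - U (- 1)) (x - U 0)"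
    by (simp add: wedge_def algebra_simps)
  then have f2: "0 \<le> wedge (1 - cis (- \<theta>)) u"
    using f[of "-1"] w unfolding add.left_inverse d0 x wedge_mult by (simp add: zero_le_mult_iff)
  have w1: "wedge (cis \<theta> - 1) u = (cos \<theta> - 1) * Im u - sin \<theta> * Re u"
    "wedge (1 - cis (- \<theta>)) u = (1 - cos \<theta>) * Im u - sin \<theta> * Re u"
    by (simp_all add: wedge_def)
  have "sin \<theta> * Re u \<le> 0" using f1 f2 unfolding w1 by (simp add: algebra_simps)
  then have "Re u \<le> 0" using s by (simp add: mult_le_0_iff)
  moreover have "Re u \<noteq> 0"
  proof
    assume r: "Re u = 0"
    have "cos \<theta> < 1"
    proof -
      have "cos \<theta> \<noteq> 1" using s sin_squared_eq[of \<theta>] by auto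
      then show ?thesis by (simp add: less_le)
    qed
    then have "Im u = 0" using f1 f2 unfolding w1 r by (simp add: zero_le_mult_iff mult_le_0_iff algebra_simps)
    then have "u = 0" using r by (simp add: complex_eq_iff)
    then show False using x assms(2) by simp
  qed
  ultimately show ?thesis using w by (simp add: u_def[symmetric])
qed

lemma vertex_functional_at_first:
  fixes h :: "complex \<Rightarrow> real"
  assumes "p \<in> regular_ngon N z w" "q \<in> regular_ngon N z w" "p \<noteq> q"
  shows "vertex_functional h (U 0) p q =
    (if p = U 0 then h (q - U 0) else if q = U 0 then - h (p - U 0) else 0)"
proof -
  have "U 0 \<notin> closed_segment p q" if "p \<noteq> U 0" "q \<noteq> U 0"
  proof
    assume "U 0 \<in> closed_segment p q"
    then obtain t where t: "0 \<le> t" "t \<le> 1" "U 0 = (1 - t) *\<^sub>R p + t *\<^sub>R q" by (auto simp: in_segment)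
    define L where "L x = Re (- 1 / w * (x - U 0))" for x
    have L: "L p > 0" "L q > 0" using ngon_first_vertex_convex assms that by (auto simp: L_def)
    have "0 = (1 - t) *\<^sub>R (p - U 0) + t *\<^sub>R (q - U 0)" using t(3) by (simp add: algebra_simps)
    then have "- 1 / w * 0 = - 1 / w * ((1 - t) *\<^sub>R (p - U 0) + t *\<^sub>R (q - U 0))" by simp
    also have "\<dots> = (1 - t) *\<^sub>R (- 1 / w * (p - U 0)) + t *\<^sub>R (- 1 / w * (q - U 0))"
      by (simp only: distrib_left mult_scaleR_right)
    finally have e: "- 1 / w * 0 = (1 - t) *\<^sub>R (- 1 / w * (p - U 0)) + t *\<^sub>R (- 1 / w * (q - U 0))" .
    have "0 = (1 - t) * L p + t * L q"
      using arg_cong[OF e, of Re] unfolding L_def plus_complex.sel scaleR_complex.sel by simp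
    moreover have "(1 - t) * L p \<ge> 0" "t * L q \<ge> 0" using L t by auto
    ultimately have "(1 - t) * L p = 0" "t * L q = 0" by linarith+
    then show False using L by auto
  qed
  then show ?thesis using assms(3) by (auto simp: vertex_functional_def)
qed

lemma triangle_vertex_functional:
  assumes pos: "wedge (q - p) (r - p) > 0" and sub: "convex hull {p, q, r} \<subseteq> regular_ngon N z w"
  defines "h \<equiv> \<lambda>u. Arg (- 1 / w * u)"
  shows "(\<Sum>(x, y)\<in>{(p, q), (q, r), (r, p)}. vertex_functional h (U 0) x y) =
    - (angle q p r * of_bool (p = U 0) + angle p q r * of_bool (q = U 0) + angle p r q * of_bool (r = U 0))"
proof -
  have mem: "p \<in> regular_ngon N z w" "q \<in> regular_ngon N z w" "r \<in> regular_ngon N z w"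
    using sub by (auto intro: hull_inc)
  have neq: "p \<noteq> q" "q \<noteq> r" "r \<noteq> p" using pos by (auto simp: wedge_def)
  have posq: "wedge (r - q) (p - q) > 0" and posr: "wedge (p - r) (q - r) > 0"
    using pos by (simp_all add: wedge_def algebra_simps)
  have A: "h (c - v) - h (b - v) = angle b v c"
    if "v = U 0" "b \<in> regular_ngon N z w" "c \<in> regular_ngon N z w" "b \<noteq> v" "c \<noteq> v" "wedge (b - v) (c - v) > 0" for v b c
    unfolding h_def using that ngon_first_vertex_convex by (intro angle_via_Arg) auto
  show ?thesis
    unfolding sum_triangle_edges[OF pos] vertex_functional_at_first[OF mem(1,2) neq(1)]
      vertex_functional_at_first[OF mem(2,3) neq(2)] vertex_functional_at_first[OF mem(3,1) neq(3)]
    using neq A[OF _ mem(2,3) _ _ pos] A[OF _ mem(3,1) _ _ posq] A[OF _ mem(1,2) _ _ posr]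
      angle_commute[of r q p]
    by auto
qed

theorem vertex_equation:
  assumes T: "is_tiling \<alpha> \<beta> \<gamma> (regular_ngon N z w) T" and num: "angle_numbers T (U 0) = (m, n, l)"
  shows "m * \<alpha> + n * \<beta> + l * \<gamma> = pi - \<theta>"
proof -
  define h where "h = (\<lambda>u. Arg (- 1 / w * u))"
  define F where "F = vertex_functional h (U 0)"
  have h: "h (r *\<^sub>R u) = h u" if "r > 0" for r u
    using Arg_times_of_real[OF that, of "- 1 / w * u"] by (simp add: h_def scaleR_conv_of_real mult_ac)
  have fin: "finite T" using T by (simp add: is_tiling_def)
  have tile: "(\<Sum>(p, q)\<in>tile_edges t. F p q) =
      - (\<alpha> * of_bool (fst t = U 0) + \<beta> * of_bool (fst (snd t) = U 0) + \<gamma> * of_bool (snd (snd t) = U 0))"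
    if t: "t \<in> T" for t
  proof -
    obtain a b c where abc: "t = (a, b, c)" by (cases t)
    have tt: "is_tile \<alpha> \<beta> \<gamma> (a, b, c)" "region (a, b, c) \<subseteq> regular_ngon N z w"
      using T t unfolding is_tiling_def abc by blast+
    from tt(1) show ?thesis
    proof (rule tile_cases)
      fix p q r B C assume *: "wedge (q - p) (r - p) > 0" "tile_edges (a, b, c) = {(p, q), (q, r), (r, p)}"
        "region (a, b, c) = convex hull {p, q, r}" "angle q p r = \<alpha>" "angle p q r = B" "angle p r q = C"
        "p = a" "q = b \<and> r = c \<and> B = \<beta> \<and> C = \<gamma> \<or> q = c \<and> r = b \<and> B = \<gamma> \<and> C = \<beta>"
      have "convex hull {p, q, r} \<subseteq> regular_ngon N z w" using tt(2) *(3) by simp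
      then show ?thesis using triangle_vertex_functional[OF *(1), folded h_def F_def] *(2,4-8)
        by (auto simp: abc)
    qed
  qed
  have count: "(\<Sum>t\<in>T. x * of_bool (P t)) = x * card {t \<in> T. P t}" for x :: real and P
  proof -
    have "(\<Sum>t\<in>T. x * of_bool (P t)) = (\<Sum>t\<in>{t \<in> T. P t}. x)"
      using fin by (intro sum.mono_neutral_cong_right) auto
    then show ?thesis by simp
  qed
  have "{t \<in> T. fst t = U 0} = {(a, b, c) \<in> T. a = U 0}" "{t \<in> T. fst (snd t) = U 0} = {(a, b, c) \<in> T. b = U 0}"
    "{t \<in> T. snd (snd t) = U 0} = {(a, b, c) \<in> T. c = U 0}" by auto
  then have cards: "card {t \<in> T. fst t = U 0} = m" "card {t \<in> T. fst (snd t) = U 0} = n"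
      "card {t \<in> T. snd (snd t) = U 0} = l"
    using num by (simp_all add: angle_numbers_def)
  have "(\<Sum>t\<in>T. \<Sum>(p, q)\<in>tile_edges t. F p q) = - (m * \<alpha> + n * \<beta> + l * \<gamma>)"
    using tile by (simp only: sum_negf sum.distrib count cards mult.commute cong: sum.cong)
  moreover have "(\<Sum>t\<in>T. \<Sum>(p, q)\<in>tile_edges t. F p q) = (\<Sum>k\<in>{0..<int N}. F (U k) (U (k + 1)))"
    unfolding F_def by (rule tiling_sum_edges[OF T N w]) (rule vertex_functional_add[OF h], assumption+, rule vertex_functional_swap)
  moreover have "(\<Sum>k\<in>{0..<int N}. F (U k) (U (k + 1))) = \<theta> - pi"
  proof -
    have V0: "U k = U 0 \<longleftrightarrow> k mod int N = 0" for k using V_eq_iff[OF N w \<theta>, of z k 0] by simp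
    have memV: "U k \<in> regular_ngon N z w" for k
      unfolding regular_ngon_def V_image[OF N w \<theta>] by (auto intro: hull_inc)
    have F: "F (U k) (U (k + 1)) =
        (if U k = U 0 then h (U (k + 1) - U 0) else if U (k + 1) = U 0 then - h (U k - U 0) else 0)" for k
      unfolding F_def by (rule vertex_functional_at_first[OF memV memV V_distinct[OF N w \<theta>]])
    have "F (U k) (U (k + 1)) = (if k = 0 then h (U 1 - U 0) else 0) + (if k = int N - 1 then - h (U (-1) - U 0) else 0)"
      if k: "k \<in> {0..<int N}" for k
    proof -
      have "U k = U 0 \<longleftrightarrow> k = 0" using V0[of k] k by simp
      moreover have "U (k + 1) = U 0 \<longleftrightarrow> k = int N - 1"
      proof (cases "k = int N - 1")
        case False
        then have "(k + 1) mod int N = k + 1" using k by (intro mod_pos_pos_trivial) auto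
        then show ?thesis using V0[of "k + 1"] k False by simp
      qed (use V0[of "k + 1"] in simp)
      moreover have "U (int N - 1) = U (-1)" using V_periodic[OF N w \<theta>, of z "-1" 1] by simp
      ultimately show ?thesis unfolding F using N by auto
    qed
    then have "(\<Sum>k\<in>{0..<int N}. F (U k) (U (k + 1))) = h (U 1 - U 0) - h (U (-1) - U 0)"
      using N by (simp add: sum.distrib)
    also have "\<dots> = \<theta> - pi"
    proof -
      have Veq: "U k = z + w * cis (of_int k * \<theta>)" for k by (rule V_eq[OF N w \<theta>])
      have "- 1 / w * (U 1 - U 0) = of_real (2 * sin (\<theta> / 2)) * exp (\<i> * of_real (\<theta> / 2 - pi / 2))"
      proof -
        have "- 1 / w * (U 1 - U 0) = 1 - cis \<theta>" unfolding Veq using w by (simp add: field_simps)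
        also have "\<dots> = of_real (2 * sin (\<theta> / 2)) * cis (\<theta> / 2 - pi / 2)"
          using cos_double_sin[of "\<theta> / 2"] sin_double[of "\<theta> / 2"]
          by (simp add: complex_eq_iff cos_diff sin_diff power2_eq_square)
        finally show ?thesis by (simp add: cis_conv_exp)
      qed
      from Arg_unique[OF this[symmetric]] have "h (U 1 - U 0) = \<theta> / 2 - pi / 2"
        unfolding h_def using theta[OF N w \<theta>] sin_theta[OF N w \<theta>] by simp
      moreover
      have "- 1 / w * (U (-1) - U 0) = of_real (2 * sin (\<theta> / 2)) * exp (\<i> * of_real (pi / 2 - \<theta> / 2))"
      proof -
        have "- 1 / w * (U (-1) - U 0) = 1 - cis (- \<theta>)" unfolding Veq using w by (simp add: field_simps)
        also have "\<dots> = of_real (2 * sin (\<theta> / 2)) * cis (pi / 2 - \<theta> / 2)"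
          using cos_double_sin[of "\<theta> / 2"] sin_double[of "\<theta> / 2"]
          by (simp add: complex_eq_iff cos_diff sin_diff power2_eq_square)
        finally show ?thesis by (simp add: cis_conv_exp)
      qed
      from Arg_unique[OF this[symmetric]] have "h (U (-1) - U 0) = pi / 2 - \<theta> / 2"
        unfolding h_def using theta[OF N w \<theta>] sin_theta[OF N w \<theta>] by simp
      ultimately show ?thesis by simp
    qed
    finally show ?thesis .
  qed
  ultimately show ?thesis by simp
qed

end

section \<open>The conjugate tiling\<close>

text \<open>In this part \<open>\<Phi>\<close> is a map as in \<open>ex_semilinear_conjugation\<close>, for \<open>\<zeta> = cis (2 * pi / M)\<close>.\<close>

lemma same_line_wedge: "wedge (u * of_real s) (u * of_real t) = 0"
  by (simp add: wedge_def algebra_simps)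

context
  fixes M k :: nat and \<Phi> :: "complex \<Rightarrow> complex" and w :: complex
  assumes M: "M > 0" "4 dvd M" and k: "coprime k M" and w: "w \<noteq> 0"
    and add: "\<And>x y. \<Phi> (x + y) = \<Phi> x + \<Phi> y"
    and rot: "\<And>x. \<Phi> (cis (2 * pi / real M) * x) = cis (2 * pi / real M) ^ k * \<Phi> x"
    and cnj: "\<And>x. \<Phi> (cnj x) = cnj (\<Phi> x)"
begin

text \<open>The multiples of \<open>2 * pi / M\<close>, that is, the arguments of the powers of \<open>\<zeta>\<close>.\<close>

definition cyclo_angle :: "real \<Rightarrow> bool" where
  "cyclo_angle A \<longleftrightarrow> (\<exists>a::nat. A = 2 * pi * real a / real M)"

lemma Phi_cis:
  assumes "cyclo_angle A" shows "\<Phi> (cis A * x) = cis (real k * A) * \<Phi> x"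
proof -
  let ?\<zeta> = "cis (2 * pi / real M)"
  have pow: "\<Phi> (?\<zeta> ^ j * x) = (?\<zeta> ^ k) ^ j * \<Phi> x" for j
    by (induction j) (simp_all add: rot mult.assoc)
  obtain a where a: "A = 2 * pi * real a / real M" using assms by (auto simp: cyclo_angle_def)
  have "cis A = ?\<zeta> ^ a" "cis (real k * A) = (?\<zeta> ^ k) ^ a"
    by (simp_all add: a Complex.DeMoivre mult_ac)
  then show ?thesis using pow by simp
qed

lemma Phi_cis_minus:
  assumes "cyclo_angle A" shows "\<Phi> (cis (- A) * x) = cis (- (real k * A)) * \<Phi> x"
proof -
  have "\<Phi> x = cis (real k * A) * \<Phi> (cis (- A) * x)"
    using Phi_cis[OF assms, of "cis (- A) * x"] by (simp add: cis_mult flip: mult.assoc)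
  then have "cis (- (real k * A)) * \<Phi> x = (cis (- (real k * A)) * cis (real k * A)) * \<Phi> (cis (- A) * x)"
    by (simp add: mult.assoc)
  then show ?thesis by (simp add: cis_mult)
qed

lemma Phi_minus: "\<Phi> (- x) = - \<Phi> x"
proof -
  have "\<Phi> 0 = 0" using add[of 0 0] by simp
  then show ?thesis using add[of x "- x"] by (simp add: eq_neg_iff_add_eq_0 add.commute)
qed

lemma Phi_diff: "\<Phi> (x - y) = \<Phi> x - \<Phi> y"
  using add[of x "- y"] by (simp add: Phi_minus)

text \<open>The restriction of \<open>\<Phi>\<close> to the real line.\<close>

definition phi :: "real \<Rightarrow> real" where "phi x = Re (\<Phi> (of_real x))"

text \<open>Since \<open>\<Phi>\<close> commutes with complex conjugation, it maps real numbers to real numbers.\<close>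

lemma Phi_of_real: "\<Phi> (of_real x) = of_real (phi x)"
  using cnj[of "of_real x"] by (simp add: phi_def complex_eq_iff)

text \<open>The factor that does not depend on \<open>A\<close> comes from the image of \<open>\<i>\<close>; it is \<open>1\<close> or \<open>-1\<close>, as \<open>k\<close> is odd.\<close>

lemma phi_sin:
  assumes "cyclo_angle A"
  shows "phi (x * sin A) = cos (pi / 2 - real k * (pi / 2)) * sin (real k * A) * phi x"
proof -
  have half: "cyclo_angle (pi / 2)"
  proof -
    obtain d where "M = 4 * d" using M(2) by (elim dvdE)
    then show ?thesis unfolding cyclo_angle_def using M(1) by (intro exI[of _ d]) simp
  qed
  let ?s = "of_real (x * sin A) :: complex"
  have "cis (pi / 2) * (?s + ?s) = cis A * of_real x - cis (- A) * of_real x"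
    by (simp add: complex_eq_iff)
  then have "\<Phi> (cis (pi / 2) * (?s + ?s)) = \<Phi> (cis A * of_real x - cis (- A) * of_real x)" by simp
  then have "cis (real k * (pi / 2)) * (2 * of_real (phi (x * sin A))) = (cis (real k * A) - cis (- (real k * A))) * of_real (phi x)"
    unfolding Phi_cis[OF half] Phi_diff Phi_cis[OF assms] Phi_cis_minus[OF assms] add Phi_of_real
    by (simp add: left_diff_distrib)
  also have "cis (real k * A) - cis (- (real k * A)) = 2 * cis (pi / 2) * of_real (sin (real k * A))"
    by (simp add: complex_eq_iff)
  finally have "cis (- (real k * (pi / 2))) * (cis (real k * (pi / 2)) * of_real (phi (x * sin A))) =
      cis (- (real k * (pi / 2))) * (cis (pi / 2) * of_real (sin (real k * A)) * of_real (phi x))" by simp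
  then have "(cis (- (real k * (pi / 2))) * cis (real k * (pi / 2))) * of_real (phi (x * sin A)) =
      (cis (- (real k * (pi / 2))) * cis (pi / 2)) * of_real (sin (real k * A) * phi x)"
    by (simp only: mult.assoc of_real_mult)
  moreover have "cis (- (real k * (pi / 2))) * cis (real k * (pi / 2)) = 1"
    "cis (- (real k * (pi / 2))) * cis (pi / 2) = cis (pi / 2 - real k * (pi / 2))"
    unfolding cis_mult by simp_all
  ultimately have "of_real (phi (x * sin A)) = cis (pi / 2 - real k * (pi / 2)) * of_real (sin (real k * A) * phi x)"
    by (simp only: mult_1_left)
  from arg_cong[OF this, of Re] show ?thesis by simp
qed

lemma epsilon_square: "(cos (pi / 2 - real k * (pi / 2)))\<^sup>2 = 1"
proof -
  have "even M" using M(2) dvd_trans[of 2 4 M] by simp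
  then have "odd k" using k coprime_common_divisor[of k M 2] by auto
  then obtain j where "k = 2 * j + 1" by (elim oddE)
  then have "pi / 2 - real k * (pi / 2) = - (j * pi)" by (simp add: field_simps)
  then show ?thesis by (simp add: power_even_eq[symmetric] power2_eq_square flip: power_add)
qed

text \<open>The vectors that are real multiples of \<open>w * \<zeta> ^ j\<close> for some \<open>j\<close>. On lines with such a direction
  \<open>\<Phi> (x / w)\<close> preserves collinearity.\<close>

definition cyclo_direction :: "complex \<Rightarrow> bool" where
  "cyclo_direction d \<longleftrightarrow> (\<exists>x::real. \<exists>A. cyclo_angle A \<and> d = w * (of_real x * cis A))"

lemma cyclo_angle_add: "cyclo_angle A \<Longrightarrow> cyclo_angle B \<Longrightarrow> cyclo_angle (A + B)"
proof -
  assume "cyclo_angle A" "cyclo_angle B"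
  then obtain a b where "A = 2 * pi * real a / real M" "B = 2 * pi * real b / real M" by (auto simp: cyclo_angle_def)
  then show ?thesis unfolding cyclo_angle_def by (intro exI[of _ "a + b"]) (simp add: add_divide_distrib distrib_left)
qed

lemma cyclo_angle_inverse: "cyclo_angle A \<Longrightarrow> \<exists>B. cyclo_angle B \<and> cis A * cis B = 1"
proof -
  assume "cyclo_angle A"
  then obtain a where a: "A = 2 * pi * real a / real M" by (auto simp: cyclo_angle_def)
  have "a \<le> a * M" using M by simp
  then have "A + 2 * pi * real (a * M - a) / real M = 2 * pi * real a"
    unfolding a using M by (simp add: of_nat_diff field_simps)
  then have "cis A * cis (2 * pi * real (a * M - a) / real M) = 1"
    by (simp add: cis_mult cis_multiple_2pi)
  then show ?thesis unfolding cyclo_angle_def by blast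
qed

lemma cyclo_direction_scale: "r \<noteq> 0 \<Longrightarrow> cyclo_direction (d * of_real r) \<longleftrightarrow> cyclo_direction d"
proof
  assume "cyclo_direction d"
  then obtain x A where "cyclo_angle A" "d = w * (of_real x * cis A)" by (auto simp: cyclo_direction_def)
  then show "cyclo_direction (d * of_real r)"
    unfolding cyclo_direction_def by (intro exI[of _ "x * r"] exI[of _ A]) simp
next
  assume r: "r \<noteq> 0" and "cyclo_direction (d * of_real r)"
  then obtain x A where A: "cyclo_angle A" "d * of_real r = w * (of_real x * cis A)" by (auto simp: cyclo_direction_def)
  have "d = (d * of_real r) * of_real (1 / r)" using r by simp
  also have "\<dots> = w * (of_real (x / r) * cis A)" unfolding A(2) by simp
  finally show "cyclo_direction d" unfolding cyclo_direction_def using A(1) by blast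
qed

lemma cyclo_direction_cis: "cyclo_angle B \<Longrightarrow> cyclo_direction (d * cis B) \<longleftrightarrow> cyclo_direction d"
proof
  assume B: "cyclo_angle B" and "cyclo_direction d"
  then obtain x A where "cyclo_angle A" "d = w * (of_real x * cis A)" by (auto simp: cyclo_direction_def)
  then show "cyclo_direction (d * cis B)"
    unfolding cyclo_direction_def using cyclo_angle_add[OF _ B]
    by (intro exI[of _ x] exI[of _ "A + B"]) (simp add: cis_mult mult.assoc)
next
  assume B: "cyclo_angle B" and "cyclo_direction (d * cis B)"
  then obtain x A where A: "cyclo_angle A" "d * cis B = w * (of_real x * cis A)" by (auto simp: cyclo_direction_def)
  obtain C where C: "cyclo_angle C" "cis B * cis C = 1" using cyclo_angle_inverse[OF B] by blast
  have "d = (d * cis B) * cis C" using C(2) by (simp add: mult.assoc)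
  also have "\<dots> = w * (of_real x * cis (A + C))" unfolding A(2) by (simp add: cis_mult mult.assoc)
  finally show "cyclo_direction d" unfolding cyclo_direction_def using cyclo_angle_add[OF A(1) C(1)] by blast
qed

context
  fixes z :: complex
begin

text \<open>Twice the signed area of the triangle formed by the origin and the images of \<open>p\<close> and \<open>q\<close>. Other
  directions are ignored, as additivity under subdivision may fail for them; in a triangle with
  angles in \<open>cyclo_angle\<close>, either all sides or no sides are ignored.\<close>

definition conj_area :: "complex \<Rightarrow> complex \<Rightarrow> real" where
  "conj_area p q = (if cyclo_direction (q - p) then wedge (\<Phi> ((p - z) / w)) (\<Phi> ((q - z) / w)) else 0)"

lemma conj_area_swap: "conj_area q p = - conj_area p q"
proof -
  have "cyclo_direction (p - q) \<longleftrightarrow> cyclo_direction (q - p)"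
    using cyclo_direction_scale[of "-1" "q - p"] by simp
  then show ?thesis by (simp add: conj_area_def wedge_commute[of "\<Phi> ((q - z) / w)"])
qed

lemma Phi_difference: "\<Phi> ((q - z) / w) - \<Phi> ((p - z) / w) = \<Phi> ((q - p) / w)"
  unfolding Phi_diff[symmetric] by (simp add: diff_divide_distrib)

lemma conj_area_add:
  assumes "q \<in> open_segment p r"
  shows "conj_area p r = conj_area p q + conj_area q r"
proof -
  obtain t where t: "0 < t" "t < 1" "q = p + t *\<^sub>R (r - p)" using assms by (auto simp: open_segment_param)
  have d: "q - p = (r - p) * of_real t" "r - q = (r - p) * of_real (1 - t)"
    unfolding t(3) by (simp_all add: scaleR_conv_of_real algebra_simps)
  have dir: "cyclo_direction (q - p) \<longleftrightarrow> cyclo_direction (r - p)"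
    "cyclo_direction (r - q) \<longleftrightarrow> cyclo_direction (r - p)"
    unfolding d using t by (simp_all only: cyclo_direction_scale)
  show ?thesis
  proof (cases "cyclo_direction (r - p)")
    case True
    then obtain x A where A: "cyclo_angle A" "r - p = w * (of_real x * cis A)" by (auto simp: cyclo_direction_def)
    have "(q - p) / w = cis A * of_real (x * t)" "(r - q) / w = cis A * of_real (x * (1 - t))"
      unfolding d A(2) using w by (simp_all add: mult_ac)
    then have "\<Phi> ((q - z) / w) - \<Phi> ((p - z) / w) = cis (real k * A) * of_real (phi (x * t))"
      "\<Phi> ((r - z) / w) - \<Phi> ((q - z) / w) = cis (real k * A) * of_real (phi (x * (1 - t)))"
      unfolding Phi_difference by (simp_all only: Phi_cis[OF A(1)] Phi_of_real)
    then have "wedge (\<Phi> ((q - z) / w) - \<Phi> ((p - z) / w)) (\<Phi> ((r - z) / w) - \<Phi> ((q - z) / w)) = 0"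
      by (simp only: same_line_wedge)
    then show ?thesis using True dir by (simp add: conj_area_def wedge_def algebra_simps)
  qed (use dir in \<open>simp add: conj_area_def\<close>)
qed

lemma triangle_conj_area:
  assumes pos: "wedge (q - p) (r - p) > 0"
    and cyc: "cyclo_angle (angle q p r)" "cyclo_angle (angle p q r)" "cyclo_angle (angle p r q)"
  shows "\<exists>s\<ge>0. conj_area p q + conj_area q r + conj_area r p =
    sin (real k * angle q p r) * sin (real k * angle p q r) * sin (real k * angle p r q) * s"
proof -
  define A B C where "A = angle q p r" and "B = angle p q r" and "C = angle p r q"
  note sh = triangle_shape[OF pos, folded A_def B_def C_def]
  note cyc' = cyc[folded A_def B_def C_def]
  obtain \<rho> where \<rho>: "q - p = \<rho> * of_real (sin C)" "r - p = \<rho> * of_real (sin B) * cis A"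
    using sh(5) by blast
  have sn: "sin A \<noteq> 0" "sin B \<noteq> 0" "sin C \<noteq> 0"
    using sin_gt_zero[of A] sin_gt_zero[of B] sin_gt_zero[of C] sh(1-4) by auto
  have C: "C = pi - (A + B)" using sh(4) by simp
  have rq: "(r - q) * cis B = \<rho> * of_real (- sin A)"
  proof -
    have "r - q = \<rho> * (of_real (sin B) * cis A - of_real (sin C))"
      using \<rho> by (simp add: algebra_simps)
    also have "of_real (sin B) * cis A - of_real (sin C) = of_real (- sin A) * cis (- B)"
      unfolding C by (simp add: complex_eq_iff sin_add)
    finally show ?thesis by (simp add: mult.assoc cis_mult)
  qed
  have dir: "cyclo_direction (q - p) \<longleftrightarrow> cyclo_direction \<rho>" "cyclo_direction (r - p) \<longleftrightarrow> cyclo_direction \<rho>"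
    "cyclo_direction (r - q) \<longleftrightarrow> cyclo_direction \<rho>"
  proof -
    show "cyclo_direction (q - p) \<longleftrightarrow> cyclo_direction \<rho>" "cyclo_direction (r - p) \<longleftrightarrow> cyclo_direction \<rho>"
      unfolding \<rho> cyclo_direction_cis[OF cyc'(1)] using sn by (simp_all add: cyclo_direction_scale)
    have "cyclo_direction (r - q) \<longleftrightarrow> cyclo_direction (\<rho> * of_real (- sin A))"
      unfolding rq[symmetric] cyclo_direction_cis[OF cyc'(2)] ..
    also have "\<dots> \<longleftrightarrow> cyclo_direction \<rho>" using sn by (intro cyclo_direction_scale) simp
    finally show "cyclo_direction (r - q) \<longleftrightarrow> cyclo_direction \<rho>" .
  qed
  have dir': "cyclo_direction (p - r) \<longleftrightarrow> cyclo_direction \<rho>"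
    using cyclo_direction_scale[of "-1" "r - p"] dir(2) by simp
  show ?thesis
  proof (cases "cyclo_direction \<rho>")
    case True
    then obtain x D where D: "cyclo_angle D" "\<rho> = w * (of_real x * cis D)" by (auto simp: cyclo_direction_def)
    define \<epsilon> where "\<epsilon> = cos (pi / 2 - real k * (pi / 2))"
    have qp: "(q - p) / w = cis D * of_real (x * sin C)"
      unfolding \<rho> D(2) using w by (simp add: mult_ac)
    have rp: "(r - p) / w = cis D * (cis A * of_real (x * sin B))"
      unfolding \<rho> D(2) using w by (simp add: mult_ac)
    have "\<Phi> ((q - z) / w) - \<Phi> ((p - z) / w) = cis (real k * D) * of_real (\<epsilon> * sin (real k * C) * phi x)"
      unfolding Phi_difference qp Phi_cis[OF D(1)] Phi_of_real phi_sin[OF cyc'(3)] \<epsilon>_def ..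
    moreover have "\<Phi> ((r - z) / w) - \<Phi> ((p - z) / w) =
        cis (real k * D) * (cis (real k * A) * of_real (\<epsilon> * sin (real k * B) * phi x))"
      unfolding Phi_difference rp Phi_cis[OF D(1)] Phi_cis[OF cyc'(1)] Phi_of_real phi_sin[OF cyc'(2)] \<epsilon>_def ..
    moreover have "conj_area p q + conj_area q r + conj_area r p =
        wedge (\<Phi> ((q - z) / w) - \<Phi> ((p - z) / w)) (\<Phi> ((r - z) / w) - \<Phi> ((p - z) / w))"
      using True dir dir' by (simp add: conj_area_def wedge_def algebra_simps)
    ultimately have "conj_area p q + conj_area q r + conj_area r p =
        wedge (of_real (\<epsilon> * sin (real k * C) * phi x)) (cis (real k * A) * of_real (\<epsilon> * sin (real k * B) * phi x))"
      by (simp only: wedge_mult) simp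
    also have "\<dots> = \<epsilon>\<^sup>2 * (sin (real k * A) * sin (real k * B) * sin (real k * C) * (phi x)\<^sup>2)"
      by (simp add: wedge_def power2_eq_square)
    also have "\<epsilon>\<^sup>2 = 1" unfolding \<epsilon>_def by (rule epsilon_square)
    finally show ?thesis unfolding A_def B_def C_def by (intro exI[of _ "(phi x)\<^sup>2"]) simp
  qed (use dir dir' in \<open>auto simp: conj_area_def intro!: exI[of _ 0]\<close>)
qed

end

end

text \<open>The left-hand side is twice the signed area of the image of the polygon. The factor \<open>4 * N\<close> in \<open>M\<close>
  makes \<open>pi / 2\<close> and the directions of the edges of the polygon multiples of \<open>2 * pi / M\<close>.\<close>

theorem conjugate_area_identity:
  fixes N M k d :: nat and \<alpha> \<beta> \<gamma> :: real
  assumes T: "is_tiling \<alpha> \<beta> \<gamma> (regular_ngon N z w) T" and N: "N \<ge> 3" and w: "w \<noteq> 0"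
    and M: "M = 4 * N * d" "d > 0"
    and a: "\<alpha> = 2 * pi * real a / real M" and b: "\<beta> = 2 * pi * real b / real M"
    and c: "\<gamma> = 2 * pi * real c / real M" and k: "coprime k M"
  shows "\<exists>S\<ge>0. real N * sin (k * (2 * pi / real N)) = sin (k * \<alpha>) * sin (k * \<beta>) * sin (k * \<gamma>) * S"
proof -
  define \<theta> where "\<theta> = 2 * pi / real N"
  have M0: "M > 0" "4 dvd M" using M N by auto
  let ?\<zeta> = "cis (2 * pi / real M)"
  have "?\<zeta> ^ M = 1" using M0 by (simp add: Complex.DeMoivre)
  then obtain \<Phi> where \<Phi>: "\<And>x y. \<Phi> (x + y) = \<Phi> x + \<Phi> y" "\<And>x. \<Phi> (?\<zeta> * x) = ?\<zeta> ^ k * \<Phi> x"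
    "\<And>x. \<Phi> (cnj x) = cnj (\<Phi> x)" "\<Phi> 1 = 1"
    using ex_semilinear_conjugation[OF _ M0(1) k] by metis
  note ctx = M0 k w \<Phi>(1-3)
  define F where "F = conj_area M \<Phi> w z"
  have cyc: "cyclo_angle M \<alpha>" "cyclo_angle M \<beta>" "cyclo_angle M \<gamma>"
    using a b c cyclo_angle_def[OF ctx] by blast+
  have tile: "\<exists>s\<ge>0. (\<Sum>(p, q)\<in>tile_edges t. F p q) = sin (k * \<alpha>) * sin (k * \<beta>) * sin (k * \<gamma>) * s"
    if t: "t \<in> T" for t
  proof -
    obtain u v x where abc: "t = (u, v, x)" by (cases t)
    have "is_tile \<alpha> \<beta> \<gamma> (u, v, x)" using T t unfolding is_tiling_def abc by blast
    then show ?thesis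
    proof (rule tile_cases)
      fix p q r B C assume *: "wedge (q - p) (r - p) > 0" "tile_edges (u, v, x) = {(p, q), (q, r), (r, p)}"
        "angle q p r = \<alpha>" "angle p q r = B" "angle p r q = C"
        "q = v \<and> r = x \<and> B = \<beta> \<and> C = \<gamma> \<or> q = x \<and> r = v \<and> B = \<gamma> \<and> C = \<beta>"
      have "\<exists>s\<ge>0. F p q + F q r + F r p = sin (k * \<alpha>) * sin (real k * B) * sin (real k * C) * s"
        unfolding F_def using triangle_conj_area[OF ctx *(1)] *(3-6) cyc by auto
      moreover have "sin (k * \<alpha>) * sin (real k * B) * sin (real k * C) = sin (k * \<alpha>) * sin (k * \<beta>) * sin (k * \<gamma>)"
        using *(6) by auto
      ultimately show ?thesis unfolding abc *(2) sum_triangle_edges[OF *(1)] by (simp only:)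
    qed
  qed
  then obtain s where s: "\<And>t. t \<in> T \<Longrightarrow> s t \<ge> 0"
    "\<And>t. t \<in> T \<Longrightarrow> (\<Sum>(p, q)\<in>tile_edges t. F p q) = sin (k * \<alpha>) * sin (k * \<beta>) * sin (k * \<gamma>) * s t"
    by metis
  have "(\<Sum>t\<in>T. \<Sum>(p, q)\<in>tile_edges t. F p q) = sin (k * \<alpha>) * sin (k * \<beta>) * sin (k * \<gamma>) * (\<Sum>t\<in>T. s t)"
    using s(2) by (simp add: sum_distrib_left)
  moreover have "(\<Sum>t\<in>T. \<Sum>(p, q)\<in>tile_edges t. F p q) =
      (\<Sum>i\<in>{0..<int N}. F (ngon_point N z w i) (ngon_point N z w (i + 1)))"
    unfolding F_def
    by (rule tiling_sum_edges[OF T N w], erule conj_area_add[OF ctx], rule conj_area_swap[OF ctx])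
  moreover have "F (ngon_point N z w i) (ngon_point N z w (i + 1)) = sin (k * \<theta>)" if i: "i \<in> {0..<int N}" for i
  proof -
    obtain j where j: "i = int j" using i by (metis atLeastLessThan_iff nonneg_int_cases)
    have Veq: "ngon_point N z w l = z + w * cis (of_int l * \<theta>)" for l by (rule V_eq[OF N w \<theta>_def])
    have pt: "(ngon_point N z w (int l) - z) / w = cis (l * \<theta>) * 1" for l
      unfolding Veq using w by simp
    have cl: "cyclo_angle M (l * \<theta>)" for l :: nat
      unfolding cyclo_angle_def[OF ctx] unfolding \<theta>_def M(1) using N M(2) by (intro exI[of _ "4 * d * l"]) simp
    have V: "\<Phi> ((ngon_point N z w (int l) - z) / w) = cis (k * (l * \<theta>))" for l
      unfolding pt Phi_cis[OF ctx cl] \<Phi>(4) by simp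
    have "cyclo_direction M w (ngon_point N z w (i + 1) - ngon_point N z w i)"
    proof -
      define h where "h = \<theta> / 2"
      have h: "\<theta> = 2 * h" by (simp add: h_def)
      have e: "of_int (i + 1) * \<theta> = (j * \<theta> + h) + h" "of_int i * \<theta> = (j * \<theta> + h) - h"
        by (simp_all add: j h algebra_simps)
      have "cis (y + h) - cis (y - h) = of_real (2 * sin h) * cis (y + pi / 2)" for y
        by (simp add: complex_eq_iff cos_add cos_diff sin_add sin_diff)
      then have "cis (of_int (i + 1) * \<theta>) - cis (of_int i * \<theta>) = of_real (2 * sin h) * cis (j * \<theta> + h + pi / 2)"
        unfolding e .
      then have "ngon_point N z w (i + 1) - ngon_point N z w i = w * (of_real (2 * sin h) * cis (j * \<theta> + h + pi / 2))"
        unfolding Veq by (simp flip: right_diff_distrib)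
      moreover have "cyclo_angle M (j * \<theta> + h + pi / 2)"
        unfolding cyclo_angle_def[OF ctx] unfolding h_def \<theta>_def M(1) using N M(2)
        by (intro exI[of _ "4 * d * j + 2 * d + N * d"]) (simp add: field_simps)
      ultimately show ?thesis unfolding cyclo_direction_def[OF ctx] by blast
    qed
    moreover have "i + 1 = int (j + 1)" using j by simp
    ultimately have "F (ngon_point N z w i) (ngon_point N z w (i + 1)) = wedge (cis (k * (j * \<theta>))) (cis (k * ((j + 1) * \<theta>)))"
      unfolding F_def conj_area_def[OF ctx] j using V[of j] V[of "j + 1"] by (simp add: add.commute)
    also have "\<dots> = sin (k * \<theta>)" unfolding wedge_cis by (simp add: algebra_simps)
    finally show ?thesis .
  qed
  ultimately have "real N * sin (k * \<theta>) = sin (k * \<alpha>) * sin (k * \<beta>) * sin (k * \<gamma>) * (\<Sum>t\<in>T. s t)" by simp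
  moreover have "(\<Sum>t\<in>T. s t) \<ge> 0" using s(1) by (rule sum_nonneg)
  ultimately show ?thesis unfolding \<theta>_def by blast
qed


section \<open>The arithmetic of the angles\<close>

lemma cos_cong:
  fixes a k n :: int
  assumes "[a = k] (mod n) \<or> [a = - k] (mod n)" "n > 0"
  shows "cos (2 * pi * of_int a / of_int n) = cos (2 * pi * of_int k / of_int n)"
proof -
  have main: "cos (2 * pi * of_int a / of_int n) = cos (2 * pi * of_int l / of_int n)" if "[a = l] (mod n)" for l
  proof -
    have "n dvd a - l" using that by (simp add: cong_iff_dvd_diff)
    then obtain j where "a - l = n * j" by (elim dvdE)
    then have "a = l + n * j" by simp
    then have "2 * pi * of_int a / of_int n = 2 * pi * of_int l / of_int n + 2 * pi * of_int j"
      using assms(2) by (simp add: field_simps)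
    then show ?thesis by (simp add: cos_add)
  qed
  show ?thesis using assms(1) main[of k] main[of "- k"] by auto
qed

lemma positive_rational_multiple_pi:
  assumes "x / pi \<in> \<rat>" "x > 0"
  obtains n d :: nat where "d > 0" "x = pi * real n / real d"
proof -
  obtain n d :: nat where "d \<noteq> 0" "\<bar>x / pi\<bar> = real n / real d"
    using Rats_abs_nat_div_natE[OF assms(1)] by metis
  then have "x / pi = real n / real d" using assms(2) by simp
  then show thesis using \<open>d \<noteq> 0\<close> by (intro that[of d n]) (simp_all add: field_simps)
qed

lemma sine_condition_imp_isosceles:
  fixes N M a b d :: nat and \<alpha> \<beta> \<theta> :: real
  assumes N: "N > 10" and M: "M = 4 * N * d" "d > 0"
    and a: "\<alpha> = 2 * pi * real a / real M"
    and pos: "\<alpha> > 0" "\<beta> > 0" and \<theta>: "\<theta> = 2 * pi / real N" and sum: "\<alpha> + \<beta> = pi - \<theta>"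
    and sine: "\<And>k::nat. coprime k M \<Longrightarrow> sin (k * \<alpha>) * sin (k * \<beta>) > 0"
  shows "\<alpha> = (pi - \<theta>) / 2"
proof -
  define \<psi> where "\<psi> = 2 * \<alpha> + \<theta>"
  have M0: "M > 0" using M N by simp
  have \<theta>0: "\<theta> > 0" using \<theta> N by simp
  have cosine: "cos (k * \<psi>) < cos (k * \<theta>)" if k: "coprime k M" for k :: nat
  proof -
    have "odd k"
    proof
      assume "even k"
      then have "is_unit (2::nat)" using coprime_common_divisor[OF k, of 2] M by auto
      then show False by simp
    qed
    then have kpi: "cos (x - k * pi) = - cos x" for x by (simp add: cos_diff)
    have "0 < 2 * (sin (k * \<alpha>) * sin (k * \<beta>))" using sine[OF k] by simp
    also have "\<dots> = cos (k * \<alpha> - k * \<beta>) - cos (k * \<alpha> + k * \<beta>)" by (simp add: cos_diff cos_add)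
    also have "\<dots> = cos (k * \<theta>) - cos (k * \<psi>)"
    proof -
      have "\<beta> = pi - \<theta> - \<alpha>" using sum by simp
      then have eq: "k * \<alpha> - k * \<beta> = k * \<psi> - k * pi" "k * \<alpha> + k * \<beta> = - (k * \<theta> - k * pi)"
        by (simp_all add: \<psi>_def right_diff_distrib distrib_left)
      show ?thesis unfolding eq cos_minus kpi by simp
    qed
    finally show ?thesis by simp
  qed
  \<comment> \<open>The fraction \<open>L / M\<close> is \<open>\<psi> / (2 * pi)\<close>, to be reduced to lowest terms.\<close>
  define L where "L = 2 * a + 4 * d"
  have \<psi>L: "\<psi> = 2 * pi * real L / real M"
    unfolding \<psi>_def \<theta> a L_def M(1) using N M(2) by (simp add: field_simps)
  define g l m where "g = gcd L M" and "l = L div g" and "m = M div g"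
  have g: "g > 0" using M0 by (simp add: g_def)
  have gl: "L = g * l" "M = g * m" by (simp_all add: g_def l_def m_def)
  have m0: "m > 0" using gl(2) M0 by (cases "m = 0") auto
  have lm: "coprime l m" unfolding l_def m_def g_def by (rule div_gcd_coprime) (use M0 in simp)
  have \<psi>: "\<psi> = 2 * pi * real l / real m" unfolding \<psi>L gl using g by simp
  have "int m = 2"
  proof (rule denominator_eq_2[of "int N" "int m" "int l"])
    fix k x y :: int
    assume k: "coprime k (int N)" "coprime k (int m)"
      and x: "[x = k] (mod int N) \<or> [x = - k] (mod int N)" "0 \<le> x" "2 * x \<le> int N"
      and y: "[y = k * int l] (mod int m) \<or> [y = - (k * int l)] (mod int m)" "0 \<le> y" "2 * y \<le> int m"
    have "coprime k (int N * int m)" using k by simp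
    then obtain k' where k': "[k' = k] (mod (int N * int m))" "coprime k' (int M)"
      using ex_cong_coprime[of k "int N * int m" "int M"] M0 by auto
    \<comment> \<open>A unit modulo \<open>N * m\<close> is replaced by a natural number that is coprime to \<open>M\<close>.\<close>
    define K where "K = nat (k' mod (int N * int m * int M))"
    have NmM: "int N * int m * int M > 0" using N m0 M0 by simp
    then have K: "int K = k' mod (int N * int m * int M)" by (simp add: K_def)
    then have Kc: "[int K = k'] (mod (int N * int m * int M))" by (simp add: Cong.cong_def)
    have "[int K = k'] (mod int M)" using Kc cong_dvd_modulus dvd_triv_right by blast
    then have "coprime (int K) (int M)" using k'(2) by (metis cong_imp_coprime cong_sym)
    then have "coprime K M" by simp
    have "[int K = k'] (mod (int N * int m))" using Kc cong_dvd_modulus dvd_triv_left by blast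
    then have Kk: "[int K = k] (mod (int N * int m))" using k'(1) cong_trans by blast
    have KN: "[int K = k] (mod int N)" and Km: "[int K = k] (mod int m)"
      using Kk cong_dvd_modulus dvd_triv_left dvd_triv_right by blast+
    have "[x = int K] (mod int N) \<or> [x = - int K] (mod int N)"
      using x(1) KN by (meson cong_minus_minus_iff cong_sym cong_trans)
    then have cx: "cos (2 * pi * of_int x / of_int (int N)) = cos (2 * pi * of_int (int K) / of_int (int N))"
      using N by (intro cos_cong) auto
    have "[int K * int l = k * int l] (mod int m)" using Km by (rule cong_scalar_right)
    then have "[y = int K * int l] (mod int m) \<or> [y = - (int K * int l)] (mod int m)"
      using y(1) by (meson cong_minus_minus_iff cong_sym cong_trans)
    then have cy: "cos (2 * pi * of_int y / of_int (int m)) = cos (2 * pi * of_int (int K * int l) / of_int (int m))"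
      using m0 by (intro cos_cong) auto
    have "cos (K * \<psi>) < cos (K * \<theta>)" by (rule cosine) fact
    then have "cos (2 * pi * of_int y / real m) < cos (2 * pi * of_int x / real N)"
      using cx cy by (simp add: \<psi> \<theta> mult_ac)
    moreover have range: "0 \<le> 2 * pi * of_int u / real n" "2 * pi * of_int u / real n \<le> pi"
      if "0 \<le> u" "2 * u \<le> int n" "n > 0" for u :: int and n :: nat
    proof -
      have "2 * real_of_int u \<le> real n" using that(2) by linarith
      then have "2 * real_of_int u * pi \<le> real n * pi" by (intro mult_right_mono) auto
      then show "2 * pi * of_int u / real n \<le> pi" using that(3) by (simp add: field_simps)
    qed (use that in simp)
    ultimately have "2 * pi * of_int x / real N < 2 * pi * of_int y / real m"
      using range[OF x(2,3)] range[OF y(2,3)] N m0 by (subst cos_mono_less_eq[symmetric]) auto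
    then have "of_int x * real m * (2 * pi) < of_int y * real N * (2 * pi)" using N m0 by (simp add: field_simps)
    then have "of_int x * real m < of_int y * real N" by simp
    then have "real_of_int (x * int m) < real_of_int (y * int N)" by simp
    then show "x * int m < y * int N" by (simp only: of_int_less_iff)
  qed (use N m0 lm in auto)
  then have "m = 2" by simp
  then have "\<psi> = pi * real l" using \<psi> by simp
  moreover have "\<psi> < 2 * pi" using sum pos \<theta>0 by (simp add: \<psi>_def)
  moreover have "\<psi> > 0" using pos \<theta>0 by (simp add: \<psi>_def)
  ultimately have "real l < 2" "real l > 0" by (simp_all add: zero_less_mult_iff)
  then have "l = 1" by linarith
  then have "\<psi> = pi" using \<open>\<psi> = pi * real l\<close> by simp
  then show ?thesis by (simp add: \<psi>_def)
qed

theorem theorem5: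
  fixes N :: nat and z w :: complex and \<alpha> \<beta> \<gamma> :: real and T :: "tile set"
  assumes "N > 10" and "w \<noteq> 0"
    and "is_tiling \<alpha> \<beta> \<gamma> (regular_ngon N z w) T"
    and "\<alpha> / pi \<in> \<rat>" and "\<beta> / pi \<in> \<rat>" and "\<gamma> / pi \<in> \<rat>"
    and "\<forall>j\<in>{1..N}. angle_numbers T (ngon_vertex N z w j) = (1, 1, 0)"
  shows "\<alpha> = ngon_angle N / 2 \<and> \<beta> = ngon_angle N / 2 \<and> \<gamma> = 2 * pi / real N"
proof -
  define \<theta> where "\<theta> = 2 * pi / real N"
  have N3: "N \<ge> 3" using assms(1) by simp
  have "angle_numbers T (ngon_vertex N z w 1) = (1, 1, 0)" using assms(1,7) by simp
  then have num: "angle_numbers T (ngon_point N z w 0) = (1, 1, 0)"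
    unfolding ngon_vertex_eq[OF N3 assms(2) \<theta>_def] by simp
  have sum: "\<alpha> + \<beta> = pi - \<theta>"
    using vertex_equation[OF N3 assms(2) \<theta>_def assms(3) num] by simp
  have "T \<noteq> {}"
  proof
    assume "T = {}"
    then show False using num by (auto simp: angle_numbers_def)
  qed
  then obtain a b c where "(a, b, c) \<in> T" by auto
  then have "is_tile \<alpha> \<beta> \<gamma> (a, b, c)" using assms(3) unfolding is_tiling_def by blast
  then have ang: "\<alpha> > 0 \<and> \<beta> > 0 \<and> \<alpha> + \<beta> + \<gamma> = pi"
  proof (rule tile_cases)
    fix p q r B C assume *: "wedge (q - p) (r - p) > 0" "angle q p r = \<alpha>" "angle p q r = B" "angle p r q = C"
      "q = b \<and> r = c \<and> B = \<beta> \<and> C = \<gamma> \<or> q = c \<and> r = b \<and> B = \<gamma> \<and> C = \<beta>"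
    show ?thesis using triangle_shape(1-4)[OF *(1)] *(2-5) by auto
  qed
  then have \<gamma>: "\<gamma> = \<theta>" using sum by simp
  obtain n1 d1 where 1: "d1 > 0" "\<alpha> = pi * real n1 / real d1"
    using positive_rational_multiple_pi[OF assms(4)] ang by blast
  obtain n2 d2 where 2: "d2 > 0" "\<beta> = pi * real n2 / real d2"
    using positive_rational_multiple_pi[OF assms(5)] ang by blast
  define M where "M = 4 * N * (d1 * d2)"
  have d: "d1 * d2 > 0" using 1 2 by simp
  have \<alpha>M: "\<alpha> = 2 * pi * real (n1 * 2 * N * d2) / real M" unfolding 1(2) M_def using assms(1) 1 2 by simp
  have \<beta>M: "\<beta> = 2 * pi * real (n2 * 2 * N * d1) / real M" unfolding 2(2) M_def using assms(1) 1 2 by simp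
  have \<gamma>M: "\<gamma> = 2 * pi * real (4 * d1 * d2) / real M" unfolding \<gamma> \<theta>_def M_def using assms(1) 1 2 by simp
  have sine: "sin (k * \<alpha>) * sin (k * \<beta>) > 0" if k: "coprime k M" for k :: nat
  proof -
    obtain S where S: "S \<ge> 0" "real N * sin (k * \<theta>) = sin (k * \<alpha>) * sin (k * \<beta>) * sin (k * \<theta>) * S"
      using conjugate_area_identity[OF assms(3) N3 assms(2) M_def d \<alpha>M \<beta>M \<gamma>M k] \<gamma> \<theta>_def by auto
    have "sin (k * \<theta>) \<noteq> 0"
    proof
      assume "sin (k * \<theta>) = 0"
      then obtain i :: int where "k * \<theta> = of_int i * pi" by (auto simp: sin_zero_iff_int2)
      then have "real k * 2 * pi = of_int i * real N * pi" using assms(1) by (simp add: \<theta>_def field_simps)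
      then have "real_of_int (int k * 2) = real_of_int (i * int N)" by simp
      then have "int k * 2 = i * int N" by (simp only: of_int_eq_iff)
      then have "int N dvd int (k * 2)" by simp
      then have "N dvd k * 2" by (simp only: int_dvd_int_iff)
      moreover have "coprime N k" using k by (simp add: M_def coprime_commute)
      ultimately have "N dvd 2" by (simp add: coprime_dvd_mult_right_iff)
      then have "N \<le> 2" by (rule dvd_imp_le) simp
      then show False using assms(1) by simp
    qed
    then have "real N = sin (k * \<alpha>) * sin (k * \<beta>) * S" using S(2) by (simp add: mult_ac)
    then have "0 < sin (k * \<alpha>) * sin (k * \<beta>) * S" using assms(1) by simp
    then show ?thesis using S(1) by (simp add: zero_less_mult_iff)
  qed
  have "\<alpha> = (pi - \<theta>) / 2"
    by (rule sine_condition_imp_isosceles[OF assms(1) M_def d \<alpha>M _ _ \<theta>_def sum sine]) (use ang in auto)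
  moreover have "ngon_angle N = pi - \<theta>"
    using assms(1) by (simp add: ngon_angle_def \<theta>_def field_simps)
  ultimately show ?thesis using sum \<gamma> \<theta>_def by auto
qed

end
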